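(* Let $P$ be a manifold, $G$ a Lie group and $(C^{\infty}(P),G,\alpha)$ a smooth dynamical system. Identify $P$ with the set of characters of $C^{\infty}(P)$ via $p\mapsto\delta_p$, where $\delta_p(f)=f(p)$. Then the homomorphism $\alpha: G\to\operatorname{Aut}(C^{\infty}(P))$ induces a smooth right action $$\sigma: P\times G\to P,\qquad (\delta_p,g)\mapsto\delta_p\circ\alpha(g)$$ of the Lie group $G$ on the manifold $P$.
   Context: Manifolds such as $P$ are finite-dimensional, paracompact, second countable and smooth; $C^{\infty}(P)$ is the unital Fréchet algebra of smooth $\mathbb{C}$-valued functions with the smooth compact open topology (uniform convergence of all derivatives on compact sets). A Lie group may be modeled on a locally convex space, with smoothness in the Michal–Bastiani sense (all iterated directional derivatives exist and are continuous). A character of a unital algebra $A$ is a nonzero algebra homomorphism $A\to\mathbb{C}$. It is known that $p\mapsto\delta_p$ is a bijection from $P$ onto the set of characters of $C^{\infty}(P)$. A smooth dynamical system is a triple $(A,G,\alpha)$ consisting of a unital locally convex algebra $A$ (Hausdorff locally convex, jointly continuous multiplication), a Lie group $G$ and a group homomorphism $\alpha:G\to\operatorname{Aut}(A)$ such that the action $G\times A\to A$, $(g,a)\mapsto\alpha(g)(a)$, is smooth. *)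

theory Defs
  imports "HOL-Analysis.Analysis" "HOL-Library.Function_Algebras" "HOL-Algebra.Bij"
begin

section \<open>Functions as a real vector space\<close>

instantiation "fun" :: (type, real_vector) real_vector
begin

definition scaleR_fun :: "real \<Rightarrow> ('a \<Rightarrow> 'b) \<Rightarrow> 'a \<Rightarrow> 'b"
  where "scaleR_fun c f = (\<lambda>x. c *\<^sub>R f x)"

instance
  by standard (auto simp: scaleR_fun_def fun_eq_iff scaleR_add_right scaleR_add_left)

end

section \<open>Locally convex spaces and Michal--Bastiani calculus\<close>

text \<open>A locally convex space is a topology whose underlying set is a linear subspace of an
  ambient vector space, so that the space of smooth functions on a manifold, which is not a type,
  is covered. All locally convex spaces are Hausdorff.\<close>

definition locally_convex_space :: "'a::real_vector topology \<Rightarrow> bool"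
  where "locally_convex_space T \<longleftrightarrow>
    subspace (topspace T) \<and> Hausdorff_space T \<and>
    continuous_map (prod_topology T T) T (\<lambda>(x, y). x + y) \<and>
    continuous_map (prod_topology euclideanreal T) T (\<lambda>(c, x). c *\<^sub>R x) \<and>
    (\<forall>U. openin T U \<and> 0 \<in> U \<longrightarrow> (\<exists>V. openin T V \<and> 0 \<in> V \<and> convex V \<and> V \<subseteq> U))"

definition has_dir_deriv ::
    "'b::real_vector topology \<Rightarrow> ('a::real_vector \<Rightarrow> 'b) \<Rightarrow> 'a \<Rightarrow> 'a \<Rightarrow> 'b \<Rightarrow> bool"
  where "has_dir_deriv S f x v l \<longleftrightarrow>
    limitin S (\<lambda>t. inverse t *\<^sub>R (f (x + t *\<^sub>R v) - f x)) l (at 0)"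

definition dir_deriv ::
    "'b::real_vector topology \<Rightarrow> ('a::real_vector \<Rightarrow> 'b) \<Rightarrow> 'a \<Rightarrow> 'a \<Rightarrow> 'b"
  where "dir_deriv S f x v = (THE l. has_dir_deriv S f x v l)"

text \<open>\<open>iter_deriv S f k v x\<close> is the iterated directional derivative of \<open>f\<close> at \<open>x\<close> in the
  directions \<open>v 0, \<dots>, v (k - 1)\<close>, taken in this order.\<close>

primrec iter_deriv ::
    "'b::real_vector topology \<Rightarrow> ('a::real_vector \<Rightarrow> 'b) \<Rightarrow> nat \<Rightarrow> (nat \<Rightarrow> 'a) \<Rightarrow> 'a \<Rightarrow> 'b"
  where
    "iter_deriv S f 0 v x = f x"
  | "iter_deriv S f (Suc k) v x = dir_deriv S (iter_deriv S f k v) x (v k)"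

text \<open>Smoothness on an open set \<open>U\<close>: all iterated directional derivatives exist, and the \<open>k\<close>-th
  one is jointly continuous in the base point and the \<open>k\<close> directions.\<close>

definition smooth_on ::
    "'a::real_vector topology \<Rightarrow> 'b::real_vector topology \<Rightarrow> 'a set \<Rightarrow> ('a \<Rightarrow> 'b) \<Rightarrow> bool"
  where "smooth_on T S U f \<longleftrightarrow>
    (\<forall>k. (\<forall>v \<in> {..<Suc k} \<rightarrow>\<^sub>E topspace T. \<forall>x\<in>U.
            \<exists>l. has_dir_deriv S (iter_deriv S f k v) x (v k) l) \<and>
         continuous_map (prod_topology (subtopology T U) (product_topology (\<lambda>_. T) {..<k})) S
           (\<lambda>(x, v). iter_deriv S f k v x))"

section \<open>Manifolds modelled on locally convex spaces\<close>

record ('p, 'v) manifold =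
  man_top :: "'p topology"
  man_model :: "'v topology"
  man_atlas :: "('p set \<times> ('p \<Rightarrow> 'v)) set"

abbreviation points :: "('p, 'v) manifold \<Rightarrow> 'p set"
  where "points M \<equiv> topspace (man_top M)"

definition smooth_manifold :: "('p, 'v::real_vector) manifold \<Rightarrow> bool"
  where "smooth_manifold M \<longleftrightarrow>
    locally_convex_space (man_model M) \<and> Hausdorff_space (man_top M) \<and>
    (\<Union>(U, \<phi>)\<in>man_atlas M. U) = points M \<and>
    (\<forall>(U, \<phi>)\<in>man_atlas M.
       openin (man_top M) U \<and> openin (man_model M) (\<phi> ` U) \<and>
       homeomorphic_map (subtopology (man_top M) U) (subtopology (man_model M) (\<phi> ` U)) \<phi>) \<and>
    (\<forall>(U, \<phi>)\<in>man_atlas M. \<forall>(V, \<psi>)\<in>man_atlas M.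
       smooth_on (man_model M) (man_model M) (\<phi> ` (U \<inter> V)) (\<psi> \<circ> inv_into U \<phi>))"

definition smooth_map ::
    "('p, 'v::real_vector) manifold \<Rightarrow> ('q, 'w::real_vector) manifold \<Rightarrow> ('p \<Rightarrow> 'q) \<Rightarrow> bool"
  where "smooth_map M N f \<longleftrightarrow>
    continuous_map (man_top M) (man_top N) f \<and>
    (\<forall>(U, \<phi>)\<in>man_atlas M. \<forall>(V, \<psi>)\<in>man_atlas N.
       smooth_on (man_model M) (man_model N) (\<phi> ` (U \<inter> f -` V)) (\<psi> \<circ> f \<circ> inv_into U \<phi>))"

definition prod_manifold ::
    "('p, 'v) manifold \<Rightarrow> ('q, 'w) manifold \<Rightarrow> ('p \<times> 'q, 'v \<times> 'w) manifold"
  where "prod_manifold M N =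
    \<lparr>man_top = prod_topology (man_top M) (man_top N),
     man_model = prod_topology (man_model M) (man_model N),
     man_atlas = {(U \<times> V, map_prod \<phi> \<psi>) |U \<phi> V \<psi>. (U, \<phi>) \<in> man_atlas M \<and> (V, \<psi>) \<in> man_atlas N}\<rparr>"

definition lcs_manifold :: "'a topology \<Rightarrow> ('a, 'a) manifold"
  where "lcs_manifold T = \<lparr>man_top = T, man_model = T, man_atlas = {(topspace T, id)}\<rparr>"

definition paracompact_space :: "'a topology \<Rightarrow> bool"
  where "paracompact_space X \<longleftrightarrow>
    (\<forall>\<U>. (\<forall>U\<in>\<U>. openin X U) \<and> \<Union>\<U> = topspace X \<longrightarrow>
      (\<exists>\<V>. (\<forall>V\<in>\<V>. openin X V \<and> (\<exists>U\<in>\<U>. V \<subseteq> U)) \<and> \<Union>\<V> = topspace X \<and>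
        (\<forall>x\<in>topspace X. \<exists>W. openin X W \<and> x \<in> W \<and> finite {V \<in> \<V>. V \<inter> W \<noteq> {}})))"

definition fin_dim_manifold :: "nat \<Rightarrow> ('p, nat \<Rightarrow> real) manifold \<Rightarrow> bool"
  where "fin_dim_manifold n P \<longleftrightarrow>
    smooth_manifold P \<and> man_model P = Euclidean_space n \<and>
    paracompact_space (man_top P) \<and> second_countable (man_top P)"

section \<open>Lie groups\<close>

record ('g, 'e) lie_group = "'g monoid" +
  lie_manifold :: "('g, 'e) manifold"

definition is_lie_group :: "('g, 'e::real_vector) lie_group \<Rightarrow> bool"
  where "is_lie_group G \<longleftrightarrow>
    group G \<and> smooth_manifold (lie_manifold G) \<and> points (lie_manifold G) = carrier G \<and>
    smooth_map (prod_manifold (lie_manifold G) (lie_manifold G)) (lie_manifold G)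
      (\<lambda>(g, h). g \<otimes>\<^bsub>G\<^esub> h) \<and>
    smooth_map (lie_manifold G) (lie_manifold G) (\<lambda>g. inv\<^bsub>G\<^esub> g)"

definition smooth_right_action ::
    "('p, 'v::real_vector) manifold \<Rightarrow> ('g, 'e::real_vector) lie_group \<Rightarrow> ('p \<Rightarrow> 'g \<Rightarrow> 'p) \<Rightarrow> bool"
  where "smooth_right_action P G \<sigma> \<longleftrightarrow>
    (\<forall>p\<in>points P. \<forall>g\<in>carrier G. \<sigma> p g \<in> points P) \<and>
    (\<forall>p\<in>points P. \<sigma> p \<one>\<^bsub>G\<^esub> = p) \<and>
    (\<forall>p\<in>points P. \<forall>g\<in>carrier G. \<forall>h\<in>carrier G. \<sigma> (\<sigma> p g) h = \<sigma> p (g \<otimes>\<^bsub>G\<^esub> h)) \<and>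
    smooth_map (prod_manifold P (lie_manifold G)) P (\<lambda>(p, g). \<sigma> p g)"

section \<open>Unital locally convex algebras\<close>

text \<open>Addition and real scalar multiplication are those of the ambient vector space. The unit is
  a separate component because it need not be a unit of the ambient type.\<close>

record 'a lc_algebra =
  alg_top :: "'a topology"
  alg_scale :: "complex \<Rightarrow> 'a \<Rightarrow> 'a"
  alg_mult :: "'a \<Rightarrow> 'a \<Rightarrow> 'a"
  alg_one :: "'a"

abbreviation alg_carrier :: "'a lc_algebra \<Rightarrow> 'a set"
  where "alg_carrier A \<equiv> topspace (alg_top A)"

definition locally_convex_algebra :: "'a::real_vector lc_algebra \<Rightarrow> bool"
  where "locally_convex_algebra A \<longleftrightarrow>
    locally_convex_space (alg_top A) \<and>
    continuous_map (prod_topology euclidean (alg_top A)) (alg_top A) (\<lambda>(c, a). alg_scale A c a) \<and>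
    (\<forall>r. \<forall>a\<in>alg_carrier A. alg_scale A (complex_of_real r) a = r *\<^sub>R a) \<and>
    (\<forall>c d. \<forall>a\<in>alg_carrier A. alg_scale A c (alg_scale A d a) = alg_scale A (c * d) a \<and>
       alg_scale A (c + d) a = alg_scale A c a + alg_scale A d a) \<and>
    (\<forall>c. \<forall>a\<in>alg_carrier A. \<forall>b\<in>alg_carrier A.
       alg_scale A c (a + b) = alg_scale A c a + alg_scale A c b \<and>
       alg_mult A (alg_scale A c a) b = alg_scale A c (alg_mult A a b) \<and>
       alg_mult A a (alg_scale A c b) = alg_scale A c (alg_mult A a b)) \<and>
    continuous_map (prod_topology (alg_top A) (alg_top A)) (alg_top A) (\<lambda>(a, b). alg_mult A a b) \<and>
    (\<forall>a\<in>alg_carrier A. \<forall>b\<in>alg_carrier A. \<forall>c\<in>alg_carrier A.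
       alg_mult A (alg_mult A a b) c = alg_mult A a (alg_mult A b c) \<and>
       alg_mult A (a + b) c = alg_mult A a c + alg_mult A b c \<and>
       alg_mult A a (b + c) = alg_mult A a b + alg_mult A a c) \<and>
    alg_one A \<in> alg_carrier A \<and>
    (\<forall>a\<in>alg_carrier A. alg_mult A (alg_one A) a = a \<and> alg_mult A a (alg_one A) = a)"

definition alg_auto :: "'a::real_vector lc_algebra \<Rightarrow> ('a \<Rightarrow> 'a) set"
  where "alg_auto A = {\<phi> \<in> Bij (alg_carrier A).
    (\<forall>a\<in>alg_carrier A. \<forall>b\<in>alg_carrier A.
       \<phi> (a + b) = \<phi> a + \<phi> b \<and> \<phi> (alg_mult A a b) = alg_mult A (\<phi> a) (\<phi> b)) \<and>
    (\<forall>c. \<forall>a\<in>alg_carrier A. \<phi> (alg_scale A c a) = alg_scale A c (\<phi> a)) \<and>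
    \<phi> (alg_one A) = alg_one A}"

definition Alg_Aut :: "'a::real_vector lc_algebra \<Rightarrow> ('a \<Rightarrow> 'a) monoid"
  where "Alg_Aut A = BijGroup (alg_carrier A) \<lparr>carrier := alg_auto A\<rparr>"

definition characters :: "'a::real_vector lc_algebra \<Rightarrow> ('a \<Rightarrow> complex) set"
  where "characters A = {\<eta> \<in> extensional (alg_carrier A).
    (\<forall>a\<in>alg_carrier A. \<forall>b\<in>alg_carrier A.
       \<eta> (a + b) = \<eta> a + \<eta> b \<and> \<eta> (alg_mult A a b) = \<eta> a * \<eta> b) \<and>
    (\<forall>c. \<forall>a\<in>alg_carrier A. \<eta> (alg_scale A c a) = c * \<eta> a) \<and>
    (\<exists>a\<in>alg_carrier A. \<eta> a \<noteq> 0)}"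

text \<open>Continuity of the individual automorphisms \<open>\<alpha> g\<close> (and of their inverses) is implied by
  smoothness of the action.\<close>

definition smooth_dynamical_system ::
    "'a::real_vector lc_algebra \<Rightarrow> ('g, 'e::real_vector) lie_group \<Rightarrow> ('g \<Rightarrow> 'a \<Rightarrow> 'a) \<Rightarrow> bool"
  where "smooth_dynamical_system A G \<alpha> \<longleftrightarrow>
    locally_convex_algebra A \<and> is_lie_group G \<and> \<alpha> \<in> hom G (Alg_Aut A) \<and>
    smooth_map (prod_manifold (lie_manifold G) (lcs_manifold (alg_top A))) (lcs_manifold (alg_top A))
      (\<lambda>(g, a). \<alpha> g a)"

section \<open>The algebra of smooth functions\<close>

text \<open>The set of points may be a proper subset of its type, hence smooth functions
  are normalised to vanish outside of it.\<close>

definition smooth_functions :: "('p, 'v::real_vector) manifold \<Rightarrow> ('p \<Rightarrow> complex) set"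
  where "smooth_functions P =
    {f. smooth_map P (lcs_manifold euclidean) f \<and> (\<forall>p. p \<notin> points P \<longrightarrow> f p = 0)}"

text \<open>The smooth compact open topology: uniform convergence of each iterated partial (directional)
  derivative on each compact subset of each chart. The whole set is inserted into
  the subbasis only for the sake of the empty manifold.\<close>

definition smooth_compact_open :: "('p, 'v::real_vector) manifold \<Rightarrow> ('p \<Rightarrow> complex) topology"
  where "smooth_compact_open P = topology_generated_by (insert (smooth_functions P)
    {{g \<in> smooth_functions P. \<forall>x\<in>K.
        cmod (iter_deriv euclidean (g \<circ> inv_into U \<phi>) k v x
            - iter_deriv euclidean (f \<circ> inv_into U \<phi>) k v x) < \<epsilon>}
     |f U \<phi> K k v \<epsilon>. f \<in> smooth_functions P \<and> (U, \<phi>) \<in> man_atlas P \<and>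
        compactin (man_model P) K \<and> K \<subseteq> \<phi> ` U \<and>
        v \<in> {..<k} \<rightarrow>\<^sub>E topspace (man_model P) \<and> \<epsilon> > 0})"

definition C_infinity :: "('p, 'v::real_vector) manifold \<Rightarrow> ('p \<Rightarrow> complex) lc_algebra"
  where "C_infinity P =
    \<lparr>alg_top = smooth_compact_open P,
     alg_scale = (\<lambda>c f p. c * f p),
     alg_mult = (\<lambda>f g p. f p * g p),
     alg_one = (\<lambda>p. if p \<in> points P then 1 else 0)\<rparr>"

definition delta :: "('p, 'v::real_vector) manifold \<Rightarrow> 'p \<Rightarrow> ('p \<Rightarrow> complex) \<Rightarrow> complex"
  where "delta P p = (\<lambda>f\<in>alg_carrier (C_infinity P). f p)"

definition act_char ::
    "('p, 'v::real_vector) manifold \<Rightarrow> ('g \<Rightarrow> ('p \<Rightarrow> complex) \<Rightarrow> ('p \<Rightarrow> complex))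
      \<Rightarrow> (('p \<Rightarrow> complex) \<Rightarrow> complex) \<Rightarrow> 'g \<Rightarrow> ('p \<Rightarrow> complex) \<Rightarrow> complex"
  where "act_char P \<alpha> \<eta> g = compose (alg_carrier (C_infinity P)) \<eta> (\<alpha> g)"

text \<open>The map \<open>(\<delta>\<^sub>p, g) \<mapsto> \<delta>\<^sub>p \<circ> \<alpha> g\<close>, read on points through the identification
  \<open>p \<mapsto> \<delta>\<^sub>p\<close> of \<open>P\<close> with the characters.\<close>

definition induced_action ::
    "('p, 'v::real_vector) manifold \<Rightarrow> ('g \<Rightarrow> ('p \<Rightarrow> complex) \<Rightarrow> ('p \<Rightarrow> complex)) \<Rightarrow> 'p \<Rightarrow> 'g \<Rightarrow> 'p"
  where "induced_action P \<alpha> p g =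
    the_inv_into (points P) (delta P) (act_char P \<alpha> (delta P p) g)"

end

theory Submission
  imports Defs
begin

text \<open>Write \<open>S\<close> for the space of smooth functions on \<open>P\<close> with the smooth compact open topology.  The
composite of a point evaluation with \<open>\<alpha> g\<close> is a character of \<open>S\<close>, and it is continuous because
\<open>\<alpha> g\<close> is.  A continuous character is a point evaluation: continuity provides a compact set
\<open>L\<close> such that the character \<open>\<eta>\<close> kills every function vanishing near \<open>L\<close>.  If no point of \<open>L\<close>
represented \<open>\<eta>\<close>, then a finite sum \<open>h\<close> of functions \<open>cnj f * f\<close> with \<open>\<eta> f = 0\<close> would be
positive on \<open>L\<close>, and adding to \<open>h\<close> a nonnegative function that vanishes near \<open>L\<close> and is positive where
\<open>h\<close> is small would give an invertible element of the kernel of \<open>\<eta>\<close>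
(\<open>continuous_character_is_evaluation\<close>).  Continuity thus takes the place of the
exhaustion function needed to treat arbitrary characters.  So there is a unique point
\<open>\<sigma> p g\<close> with \<open>f (\<sigma> p g) = \<alpha> g f p\<close> for all \<open>f\<close>, and the laws of a right action follow from those of
\<open>\<alpha>\<close> because smooth functions separate points.

For smoothness, fix \<open>f\<close>.  The map \<open>g \<mapsto> \<alpha> g f\<close> is smooth into \<open>S\<close>, so the question is why a smooth map
\<open>F\<close> into \<open>S\<close> yields a smooth function \<open>(x, y) \<mapsto> F y x\<close>.  Its derivatives are sums of terms
in which some directions differentiate \<open>F\<close> and the others differentiate the resulting function on
\<open>P\<close>.  Each term is continuous because the iterated derivative of a function at a point
depends jointly continuously on the function, the point and the directions
(\<open>evaluation_continuous\<close>); here finite dimension enters twice, through compact neighbourhoods and through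
the expansion of the directions in a basis.  Hence \<open>(p, g) \<mapsto> f (\<sigma> p g)\<close> is smooth for every \<open>f\<close>
(\<open>matrix_coefficient_smooth\<close>).  Taking for \<open>f\<close> a cut-off function gives continuity of \<open>\<sigma>\<close>, and taking
cut-off coordinates gives its smoothness in charts.

New smooth maps always arise from one principle (\<open>smooth_onI\<close>): a map is smooth if it belongs to a
family of continuous candidates for iterated derivatives that is closed under differentiation.\<close>

section \<open>Smooth maps between locally convex spaces\<close>

text \<open>The compatibility of topology and linear structure that directional derivatives rest on: a short
piece of a line through a point of an open set stays in that set. The condition passes to products componentwise.\<close>

definition line_continuous :: "'a::real_vector topology \<Rightarrow> bool"
  where "line_continuous T \<longleftrightarrow> (\<forall>x\<in>topspace T. \<forall>v\<in>topspace T.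
    continuous_map euclideanreal T (\<lambda>t. x + t *\<^sub>R v))"

lemma lcs_add:
  assumes "locally_convex_space T" "continuous_map X T f" "continuous_map X T g"
  shows "continuous_map X T (\<lambda>z. f z + g z)"
proof -
  have "continuous_map X T ((\<lambda>(x, y). x + y) \<circ> (\<lambda>z. (f z, g z)))"
    using assms by (intro continuous_map_compose[where X'="prod_topology T T"])
      (auto simp: locally_convex_space_def continuous_map_paired)
  then show ?thesis by (simp add: o_def)
qed

lemma lcs_scaleR:
  assumes "locally_convex_space T" "continuous_map X euclideanreal c" "continuous_map X T f"
  shows "continuous_map X T (\<lambda>z. c z *\<^sub>R f z)"
proof -
  have "continuous_map X T ((\<lambda>(c, x). c *\<^sub>R x) \<circ> (\<lambda>z. (c z, f z)))"
    using assms by (intro continuous_map_compose[where X'="prod_topology euclideanreal T"])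
      (auto simp: locally_convex_space_def continuous_map_paired)
  then show ?thesis by (simp add: o_def)
qed

lemma lcs_subspace: "locally_convex_space T \<Longrightarrow> subspace (topspace T)"
  by (simp add: locally_convex_space_def)

lemma line_continuous_lcs: "locally_convex_space T \<Longrightarrow> line_continuous T"
  unfolding line_continuous_def
  by (auto intro!: lcs_add lcs_scaleR)

lemma line_continuous_prod:
  assumes "line_continuous S" "line_continuous T"
  shows "line_continuous (prod_topology S T)"
  using assms unfolding line_continuous_def
  by (auto simp: continuous_map_paired)

lemma line_continuous_eventually:
  assumes "line_continuous T" "openin T U" "x \<in> U" "v \<in> topspace T"
  shows "\<forall>\<^sub>F t in at 0. x + t *\<^sub>R v \<in> U"
proof -
  have "continuous_map euclideanreal T (\<lambda>t. x + t *\<^sub>R v)"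
    using assms openin_subset unfolding line_continuous_def by blast
  then have "open {t. x + t *\<^sub>R v \<in> U}"
    using openin_continuous_map_preimage[OF _ assms(2)] by fastforce
  then have "\<forall>\<^sub>F t in nhds 0. t \<in> {t. x + t *\<^sub>R v \<in> U}"
    using assms(3) by (intro eventually_nhds_in_open) auto
  then show ?thesis by (auto simp: eventually_at_filter elim: eventually_mono)
qed

lemma has_dir_deriv_unique:
  "Hausdorff_space S \<Longrightarrow> has_dir_deriv S f x v l \<Longrightarrow> has_dir_deriv S f x v l' \<Longrightarrow> l = l'"
  unfolding has_dir_deriv_def by (rule limitin_Hausdorff_unique) auto

lemma dir_deriv_eq:
  "Hausdorff_space S \<Longrightarrow> has_dir_deriv S f x v l \<Longrightarrow> dir_deriv S f x v = l"
  unfolding dir_deriv_def by (blast intro: has_dir_deriv_unique)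

text \<open>A directional derivative sees only the germ of the map, because the line through \<open>x\<close> stays in \<open>U\<close> for
small times.\<close>

lemma has_dir_deriv_cong:
  assumes "line_continuous T" "openin T U" "x \<in> U" "v \<in> topspace T"
    and "\<And>y. y \<in> U \<Longrightarrow> f y = g y"
  shows "has_dir_deriv S f x v l \<longleftrightarrow> has_dir_deriv S g x v l"
proof -
  have ev: "\<forall>\<^sub>F t in at 0. inverse t *\<^sub>R (f (x + t *\<^sub>R v) - f x) = inverse t *\<^sub>R (g (x + t *\<^sub>R v) - g x)"
    using line_continuous_eventually[OF assms(1-4)]
    by eventually_elim (use assms in auto)
  have ev': "\<forall>\<^sub>F t in at 0. inverse t *\<^sub>R (g (x + t *\<^sub>R v) - g x) = inverse t *\<^sub>R (f (x + t *\<^sub>R v) - f x)"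
    using ev by eventually_elim auto
  show ?thesis
    unfolding has_dir_deriv_def
    using limitin_transform_eventually[where l=l and X=S, OF ev] limitin_transform_eventually[where l=l and X=S, OF ev'] by blast
qed

lemma dir_deriv_cong:
  assumes "line_continuous T" "openin T U" "x \<in> U" "v \<in> topspace T"
    and "\<And>y. y \<in> U \<Longrightarrow> f y = g y"
  shows "dir_deriv S f x v = dir_deriv S g x v"
proof -
  have "has_dir_deriv S f x v = has_dir_deriv S g x v"
    by (rule ext) (rule has_dir_deriv_cong[OF assms])
  then show ?thesis unfolding dir_deriv_def by simp
qed

lemma iter_deriv_cong:
  assumes "line_continuous T" "openin T U" "v \<in> {..<k} \<rightarrow> topspace T" "\<And>i. i < k \<Longrightarrow> v i = w i"
    and "\<And>y. y \<in> U \<Longrightarrow> f y = g y" "x \<in> U"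
  shows "iter_deriv S f k v x = iter_deriv S g k w x"
  using assms(3,4,6)
proof (induction k arbitrary: x)
  case (Suc k)
  have vk: "v k \<in> topspace T" and vw: "v k = w k" and v: "v \<in> {..<k} \<rightarrow> topspace T"
    using Suc.prems(1,2) by (auto simp: Pi_iff)
  have "iter_deriv S f k v y = iter_deriv S g k w y" if "y \<in> U" for y
    using Suc.IH[OF v _ that] Suc.prems(2) by simp
  then have "dir_deriv S (iter_deriv S f k v) x (v k) = dir_deriv S (iter_deriv S g k w) x (v k)"
    by (rule dir_deriv_cong[OF assms(1,2) Suc.prems(3) vk])
  then show ?case using vw by simp
qed (use assms in auto)

text \<open>Allows passing between directions given by total functions and by extensional ones, as
the product topologies in the definition of smoothness require.\<close>

lemma iter_deriv_dirs_cong: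
  "(\<And>i. i < k \<Longrightarrow> v i = w i) \<Longrightarrow> iter_deriv S f k v = iter_deriv S f k w"
proof (induction k)
  case (Suc k)
  then have "iter_deriv S f k v = iter_deriv S f k w" "v k = w k" by auto
  show ?case by (rule ext) (simp only: iter_deriv.simps \<open>iter_deriv S f k v = iter_deriv S f k w\<close> \<open>v k = w k\<close>)
qed (simp add: fun_eq_iff)

lemma smooth_on_has_dir_deriv:
  assumes "smooth_on T S U f" "v \<in> {..<Suc k} \<rightarrow> topspace T" "x \<in> U" "Hausdorff_space S"
  shows "has_dir_deriv S (iter_deriv S f k v) x (v k) (iter_deriv S f (Suc k) v x)"
proof -
  have r: "restrict v {..<Suc k} \<in> {..<Suc k} \<rightarrow>\<^sub>E topspace T" using assms(2) by auto
  then obtain l where l: "has_dir_deriv S (iter_deriv S f k (restrict v {..<Suc k})) x (restrict v {..<Suc k} k) l"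
    using assms(1,3) unfolding smooth_on_def by blast
  have "iter_deriv S f k (restrict v {..<Suc k}) = iter_deriv S f k v"
    by (rule iter_deriv_dirs_cong) auto
  with l have l: "has_dir_deriv S (iter_deriv S f k v) x (v k) l" by simp
  with dir_deriv_eq[OF assms(4) l] show ?thesis by simp
qed

lemma smooth_on_continuous:
  assumes "smooth_on T S U f"
  shows "continuous_map (prod_topology (subtopology T U) (product_topology (\<lambda>_. T) {..<k})) S
           (\<lambda>(x, v). iter_deriv S f k v x)"
  using assms by (simp add: smooth_on_def)

lemma smooth_on_continuous_fixed:
  assumes "smooth_on T S U f" "v \<in> {..<k} \<rightarrow> topspace T"
  shows "continuous_map (subtopology T U) S (iter_deriv S f k v)"
proof -
  have "continuous_map (subtopology T U) S ((\<lambda>(x, v). iter_deriv S f k v x) \<circ> (\<lambda>x. (x, restrict v {..<k})))"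
    using assms(2) by (intro continuous_map_compose[OF _ smooth_on_continuous[OF assms(1)]])
       (auto simp: continuous_map_paired)
  moreover have "iter_deriv S f k (restrict v {..<k}) = iter_deriv S f k v"
    by (rule iter_deriv_dirs_cong) auto
  ultimately show ?thesis by (simp add: o_def)
qed

lemma smooth_on_continuous_map:
  "smooth_on T S U f \<Longrightarrow> continuous_map (subtopology T U) S f"
  using smooth_on_continuous_fixed[of T S U f "\<lambda>_. undefined" 0] by (simp add: iter_deriv.simps[abs_def])

text \<open>In the statement \<open>Q k\<close> collects the candidates for \<open>k\<close>-th iterated derivatives, as functions of the
directions and the base point. By induction on \<open>k\<close>, the \<open>k\<close>-th derivative of \<open>f\<close> agrees on \<open>U\<close>
with a member of \<open>Q k\<close>, so a formula for higher derivatives never has to be written down.\<close>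

lemma smooth_onI:
  fixes Q :: "nat \<Rightarrow> ((nat \<Rightarrow> 'a::real_vector) \<Rightarrow> 'a \<Rightarrow> 'b::real_vector) \<Rightarrow> bool"
  assumes T: "line_continuous T" "openin T U" and S: "Hausdorff_space S"
    and init: "Q 0 h" "\<And>v x. x \<in> U \<Longrightarrow> h v x = f x"
    and cont: "\<And>k h. Q k h \<Longrightarrow> continuous_map
      (prod_topology (subtopology T U) (product_topology (\<lambda>_. T) {..<k})) S (\<lambda>(x, v). h v x)"
    and deriv: "\<And>k h. Q k h \<Longrightarrow> \<exists>h'. Q (Suc k) h' \<and>
      (\<forall>v\<in>{..<Suc k} \<rightarrow> topspace T. \<forall>x\<in>U. has_dir_deriv S (h v) x (v k) (h' v x))"
  shows "smooth_on T S U f"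
proof -
  have ex: "\<exists>h. Q k h \<and> (\<forall>v\<in>{..<k} \<rightarrow> topspace T. \<forall>x\<in>U. iter_deriv S f k v x = h v x)" for k
  proof (induction k)
    case 0
    show ?case using init by (intro exI[of _ h]) auto
  next
    case (Suc k)
    then obtain h where h: "Q k h" "\<And>v x. v\<in>{..<k} \<rightarrow> topspace T \<Longrightarrow> x \<in> U \<Longrightarrow> iter_deriv S f k v x = h v x"
      by auto
    obtain h' where h': "Q (Suc k) h'"
      "\<And>v x. v\<in>{..<Suc k} \<rightarrow> topspace T \<Longrightarrow> x\<in>U \<Longrightarrow> has_dir_deriv S (h v) x (v k) (h' v x)"
      using deriv[OF h(1)] by auto
    have "iter_deriv S f (Suc k) v x = h' v x" if v: "v\<in>{..<Suc k} \<rightarrow> topspace T" and x: "x \<in> U" for v x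
    proof -
      have "v \<in> {..<k} \<rightarrow> topspace T" "v k \<in> topspace T" using v by auto
      then have "dir_deriv S (iter_deriv S f k v) x (v k) = dir_deriv S (h v) x (v k)"
        using x h(2) by (intro dir_deriv_cong[OF T]) auto
      then show ?thesis using dir_deriv_eq[OF S h'(2)[OF v x]] by simp
    qed
    with h'(1) show ?case by blast
  qed
  show ?thesis unfolding smooth_on_def
  proof (intro allI conjI ballI)
    fix k v x assume v: "v \<in> {..<Suc k} \<rightarrow>\<^sub>E topspace T" and x: "x \<in> U"
    obtain h where h: "Q k h" "\<And>v x. v\<in>{..<k} \<rightarrow> topspace T \<Longrightarrow> x \<in> U \<Longrightarrow> iter_deriv S f k v x = h v x"
      using ex by blast
    obtain h' where h':
      "\<And>v x. v\<in>{..<Suc k} \<rightarrow> topspace T \<Longrightarrow> x\<in>U \<Longrightarrow> has_dir_deriv S (h v) x (v k) (h' v x)"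
      using deriv[OF h(1)] by auto
    have "has_dir_deriv S (iter_deriv S f k v) x (v k) (h' v x)"
      using v x h(2) h'[of v x] has_dir_deriv_cong[OF T x, of "v k" "iter_deriv S f k v" "h v"]
      by (auto simp: PiE_iff Pi_iff)
    then show "\<exists>l. has_dir_deriv S (iter_deriv S f k v) x (v k) l" by blast
  next
    fix k
    obtain h where h: "Q k h" "\<And>v x. v\<in>{..<k} \<rightarrow> topspace T \<Longrightarrow> x \<in> U \<Longrightarrow> iter_deriv S f k v x = h v x"
      using ex by blast
    show "continuous_map (prod_topology (subtopology T U) (product_topology (\<lambda>_. T) {..<k})) S
           (\<lambda>(x, v). iter_deriv S f k v x)"
      by (rule continuous_map_eq[OF cont[OF h(1)]]) (use h(2) in \<open>auto simp: PiE_iff Pi_iff\<close>)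
  qed
qed

lemma smooth_on_cong:
  assumes "line_continuous T" "openin T U" "\<And>x. x \<in> U \<Longrightarrow> f x = g x" "smooth_on T S U f"
  shows "smooth_on T S U g"
  unfolding smooth_on_def
proof (intro allI conjI ballI)
  have eq: "iter_deriv S f k v x = iter_deriv S g k v x" if "v \<in> {..<k} \<rightarrow> topspace T" "x \<in> U" for k v x
    by (rule iter_deriv_cong[OF assms(1,2)]) (use that assms(3) in auto)
  fix k
  show "\<exists>l. has_dir_deriv S (iter_deriv S g k v) x (v k) l"
    if v: "v \<in> {..<Suc k} \<rightarrow>\<^sub>E topspace T" and x: "x \<in> U" for v x
  proof -
    obtain l where "has_dir_deriv S (iter_deriv S f k v) x (v k) l"
      using assms(4) v x unfolding smooth_on_def by blast
    moreover have "v \<in> {..<k} \<rightarrow> topspace T" "v k \<in> topspace T" using v by (auto simp: PiE_iff)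
    ultimately show ?thesis
      using has_dir_deriv_cong[OF assms(1,2) x, of "v k" "iter_deriv S f k v" "iter_deriv S g k v"] eq by auto
  qed
  show "continuous_map (prod_topology (subtopology T U) (product_topology (\<lambda>_. T) {..<k})) S
           (\<lambda>(x, v). iter_deriv S g k v x)"
    by (rule continuous_map_eq[OF smooth_on_continuous[OF assms(4)]]) (use eq in \<open>auto simp: PiE_iff Pi_iff\<close>)
qed

lemma smooth_on_subset:
  assumes "smooth_on T S U f" "V \<subseteq> U"
  shows "smooth_on T S V f"
  unfolding smooth_on_def
proof (intro allI conjI)
  fix k
  show "\<forall>v\<in>{..<Suc k} \<rightarrow>\<^sub>E topspace T. \<forall>x\<in>V. \<exists>l. has_dir_deriv S (iter_deriv S f k v) x (v k) l"
    using assms unfolding smooth_on_def by blast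
  have "prod_topology (subtopology T V) (product_topology (\<lambda>_. T) {..<k}) =
     subtopology (prod_topology (subtopology T U) (product_topology (\<lambda>_. T) {..<k})) (V \<times> UNIV)"
    using assms(2) by (simp add: subtopology_Times subtopology_subtopology inf.absorb2 del: topspace_product_topology)
  then show "continuous_map (prod_topology (subtopology T V) (product_topology (\<lambda>_. T) {..<k})) S
           (\<lambda>(x, v). iter_deriv S f k v x)"
    using continuous_map_from_subtopology[OF smooth_on_continuous[OF assms(1)]] by simp
qed

lemma smooth_on_local:
  assumes U: "U \<subseteq> topspace T"
    and loc: "\<And>x. x \<in> U \<Longrightarrow> \<exists>V. openin T V \<and> x \<in> V \<and> V \<subseteq> U \<and> smooth_on T S V f"
  shows "smooth_on T S U f"
  unfolding smooth_on_def
proof (intro allI conjI)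
  fix k
  show "\<forall>v\<in>{..<Suc k} \<rightarrow>\<^sub>E topspace T. \<forall>x\<in>U. \<exists>l. has_dir_deriv S (iter_deriv S f k v) x (v k) l"
    using loc unfolding smooth_on_def by blast
  let ?X = "prod_topology (subtopology T U) (product_topology (\<lambda>_. T) {..<k})"
  show "continuous_map ?X S (\<lambda>(x, v). iter_deriv S f k v x)"
  proof (rule pasting_lemma[where I = "{V. openin T V \<and> V \<subseteq> U \<and> smooth_on T S V f}"
        and T = "\<lambda>V. V \<times> topspace (product_topology (\<lambda>_. T) {..<k})" and f = "\<lambda>_. (\<lambda>(x, v). iter_deriv S f k v x)"])
    fix V assume V: "V \<in> {V. openin T V \<and> V \<subseteq> U \<and> smooth_on T S V f}"
    then have "openin (subtopology T U) V" by (auto simp: openin_subtopology intro!: exI[of _ V])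
    then show "openin ?X (V \<times> topspace (product_topology (\<lambda>_. T) {..<k}))"
      by (metis openin_prod_Times_iff openin_topspace)
    have "subtopology ?X (V \<times> topspace (product_topology (\<lambda>_. T) {..<k})) =
      prod_topology (subtopology T V) (product_topology (\<lambda>_. T) {..<k})"
      using V by (simp add: subtopology_Times subtopology_subtopology inf.absorb2 del: topspace_product_topology)
    then show "continuous_map (subtopology ?X (V \<times> topspace (product_topology (\<lambda>_. T) {..<k}))) S (\<lambda>(x, v). iter_deriv S f k v x)"
      using V smooth_on_continuous[of T S V f k] by simp
  next
    fix z assume "z \<in> topspace ?X"
    then obtain x v where z: "z = (x, v)" "x \<in> U" "v \<in> topspace (product_topology (\<lambda>_. T) {..<k})"
      by auto
    then obtain V where "openin T V" "x \<in> V" "V \<subseteq> U" "smooth_on T S V f" using loc by blast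
    with z show "\<exists>j. j \<in> {V. openin T V \<and> V \<subseteq> U \<and> smooth_on T S V f} \<and>
      z \<in> j \<times> topspace (product_topology (\<lambda>_. T) {..<k}) \<and>
      (\<lambda>(x, v). iter_deriv S f k v x) z = (\<lambda>(x, v). iter_deriv S f k v x) z" by blast
  qed auto
qed

lemma smooth_on_linear_compose:
  fixes f :: "'a::real_vector \<Rightarrow> 'b::real_vector" and L :: "'b \<Rightarrow> 'c::real_vector"
  assumes T: "line_continuous T" "openin T U" and S': "Hausdorff_space S'" and S: "Hausdorff_space S"
    and L: "linear L" "continuous_map S S' L" and f: "smooth_on T S U f"
  shows "smooth_on T S' U (\<lambda>x. L (f x))"
proof (rule smooth_onI[where Q = "\<lambda>k h. h = (\<lambda>v x. L (iter_deriv S f k v x))"])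
  fix k and h :: "(nat \<Rightarrow> 'a) \<Rightarrow> 'a \<Rightarrow> 'c" assume h: "h = (\<lambda>v x. L (iter_deriv S f k v x))"
  show "continuous_map (prod_topology (subtopology T U) (product_topology (\<lambda>_. T) {..<k})) S' (\<lambda>(x, v). h v x)"
    using continuous_map_compose[OF smooth_on_continuous[OF f] L(2)] by (simp add: o_def h case_prod_unfold)
  show "\<exists>h'. h' = (\<lambda>v x. L (iter_deriv S f (Suc k) v x)) \<and>
     (\<forall>v\<in>{..<Suc k} \<rightarrow> topspace T. \<forall>x\<in>U. has_dir_deriv S' (h v) x (v k) (h' v x))"
  proof (intro exI conjI ballI)
    fix v x assume v: "v \<in> {..<Suc k} \<rightarrow> topspace T" and x: "x \<in> U"
    have "has_dir_deriv S (iter_deriv S f k v) x (v k) (iter_deriv S f (Suc k) v x)"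
      by (rule smooth_on_has_dir_deriv[OF f v x S])
    then have "limitin S' (L \<circ> (\<lambda>t. inverse t *\<^sub>R (iter_deriv S f k v (x + t *\<^sub>R v k) - iter_deriv S f k v x)))
        (L (iter_deriv S f (Suc k) v x)) (at 0)"
      unfolding has_dir_deriv_def by (rule continuous_map_limit[OF L(2)])
    then show "has_dir_deriv S' (h v) x (v k) (L (iter_deriv S f (Suc k) v x))"
      unfolding has_dir_deriv_def h by (simp add: o_def linear_cmul[OF L(1)] linear_diff[OF L(1)])
  qed simp
qed (use assms in auto)

text \<open>Differentiating a partial map means differentiating the full map in directions whose second
component is zero.\<close>

lemma smooth_on_slice:
  assumes T: "line_continuous T" "openin T \<Omega>" and S': "Hausdorff_space S'"
    and c: "c \<in> \<Sigma>" "\<Sigma> \<subseteq> topspace S" "0 \<in> topspace S"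
    and H: "smooth_on (prod_topology T S) S' (\<Omega> \<times> \<Sigma>) H"
  shows "smooth_on T S' \<Omega> (\<lambda>y. H (y, c))"
proof (rule smooth_onI[OF T S', where Q = "\<lambda>k h. h = (\<lambda>v y. iter_deriv S' H k (\<lambda>i. (v i, 0)) (y, c))"
      and h = "\<lambda>v y. H (y, c)"])
  fix k h assume h: "h = (\<lambda>v y. iter_deriv S' H k (\<lambda>i. (v i, 0)) (y, c))"
  let ?X = "prod_topology (subtopology T \<Omega>) (product_topology (\<lambda>_. T) {..<k})"
  have 1: "continuous_map ?X (subtopology (prod_topology T S) (\<Omega> \<times> \<Sigma>)) (\<lambda>z. (fst z, c))"
    unfolding subtopology_Times
    using c by (intro continuous_map_pairedI continuous_map_fst) auto
  have 2: "continuous_map ?X (product_topology (\<lambda>_. prod_topology T S) {..<k}) (\<lambda>z. \<lambda>i\<in>{..<k}. (snd z i, 0))"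
    unfolding continuous_map_componentwise
  proof (intro conjI ballI)
    fix i assume i: "i \<in> {..<k}"
    have "continuous_map ?X T ((\<lambda>v. v i) \<circ> snd)"
      using i by (intro continuous_map_compose[OF continuous_map_snd] continuous_map_product_projection[where X = "\<lambda>_. T"])
    then have "continuous_map ?X (prod_topology T S) (\<lambda>z. (snd z i, 0))"
      using c(3) by (intro continuous_map_pairedI) (auto simp: o_def)
    then show "continuous_map ?X (prod_topology T S) (\<lambda>z. (\<lambda>i\<in>{..<k}. (snd z i, 0)) i)" using i by simp
  qed auto
  have "iter_deriv S' H k (\<lambda>i\<in>{..<k}. (v i, 0)) = iter_deriv S' H k (\<lambda>i. (v i, 0))" for v
    by (rule iter_deriv_dirs_cong) auto
  then show "continuous_map ?X S' (\<lambda>(x, v). h v x)"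
    using continuous_map_compose[OF continuous_map_pairedI[OF 1 2] smooth_on_continuous[OF H]]
    by (simp add: o_def h case_prod_unfold)
  show "\<exists>h'. h' = (\<lambda>v y. iter_deriv S' H (Suc k) (\<lambda>i. (v i, 0)) (y, c)) \<and>
      (\<forall>v\<in>{..<Suc k} \<rightarrow> topspace T. \<forall>x\<in>\<Omega>. has_dir_deriv S' (h v) x (v k) (h' v x))"
  proof (intro exI conjI ballI)
    fix v x assume v: "v\<in>{..<Suc k} \<rightarrow> topspace T" and x: "x\<in>\<Omega>"
    have "has_dir_deriv S' (iter_deriv S' H k (\<lambda>i. (v i, 0))) (x, c) (v k, 0) (iter_deriv S' H (Suc k) (\<lambda>i. (v i, 0)) (x, c))"
      by (rule smooth_on_has_dir_deriv[OF H _ _ S']) (use v x c in \<open>auto simp: Pi_iff\<close>)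
    then show "has_dir_deriv S' (h v) x (v k) (iter_deriv S' H (Suc k) (\<lambda>i. (v i, 0)) (x, c))"
      unfolding has_dir_deriv_def h by simp
  qed simp
qed simp_all

lemma scaleR_fun_apply [simp]: "(c *\<^sub>R f) x = c *\<^sub>R f x"
  by (simp add: scaleR_fun_def)

lemma smooth_on_componentwise:
  fixes f :: "'a::real_vector \<Rightarrow> nat \<Rightarrow> real"
  assumes T: "line_continuous T" "openin T U"
    and f: "\<And>i. i < n \<Longrightarrow> smooth_on T euclideanreal U (\<lambda>x. f x i)"
    and zero: "\<And>x i. x \<in> U \<Longrightarrow> i \<ge> n \<Longrightarrow> f x i = 0"
  shows "smooth_on T (Euclidean_space n) U f"
proof (rule smooth_onI[where Q = "\<lambda>k h. h = (\<lambda>v x i. if i < n then iter_deriv euclideanreal (\<lambda>x. f x i) k v x else 0)"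
      and h = "\<lambda>v x i. if i < n then f x i else 0"])
  fix k and h :: "(nat \<Rightarrow> 'a) \<Rightarrow> 'a \<Rightarrow> nat \<Rightarrow> real"
  assume h: "h = (\<lambda>v x i. if i < n then iter_deriv euclideanreal (\<lambda>x. f x i) k v x else 0)"
  show "continuous_map (prod_topology (subtopology T U) (product_topology (\<lambda>_. T) {..<k})) (Euclidean_space n) (\<lambda>(x, v). h v x)"
    using smooth_on_continuous[OF f] by (simp add: case_prod_unfold h continuous_map_componentwise_Euclidean_space)
  let ?h' = "\<lambda>v x i. if i < n then iter_deriv euclideanreal (\<lambda>x. f x i) (Suc k) v x else 0"
  show "\<exists>h'. h' = ?h' \<and>
     (\<forall>v\<in>{..<Suc k} \<rightarrow> topspace T. \<forall>x\<in>U. has_dir_deriv (Euclidean_space n) (h v) x (v k) (h' v x))"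
  proof (intro exI conjI ballI)
    fix v x assume v: "v \<in> {..<Suc k} \<rightarrow> topspace T" and x: "x \<in> U"
    have "((\<lambda>t. inverse t * (h v (x + t *\<^sub>R v k) i - h v x i)) \<longlongrightarrow> ?h' v x i) (at 0)" for i
    proof (cases "i < n")
      case True
      show ?thesis using smooth_on_has_dir_deriv[OF f[OF True] v x] True by (simp add: h has_dir_deriv_def)
    qed (simp add: h)
    then show "has_dir_deriv (Euclidean_space n) (h v) x (v k) (?h' v x)"
      unfolding has_dir_deriv_def Euclidean_space_def limitin_subtopology limitin_componentwise
      by (auto simp: h)
  qed simp
qed (use assms in \<open>auto simp: Hausdorff_Euclidean_space fun_eq_iff\<close>)

section \<open>Linearity of derivatives and the partial derivative criterion\<close>

text \<open>For values in a normed space the directional derivative is an ordinary derivative along a line,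
which makes the sum, product and chain rules for curves available.\<close>

lemma has_dir_deriv_euclidean_iff:
  fixes f :: "'a::real_vector \<Rightarrow> 'b::real_normed_vector"
  shows "has_dir_deriv euclidean f x v l \<longleftrightarrow> ((\<lambda>t. f (x + t *\<^sub>R v)) has_vector_derivative l) (at 0)"
proof -
  have "((\<lambda>t. inverse t *\<^sub>R (f (x + t *\<^sub>R v) - f x)) \<longlongrightarrow> l) (at 0) \<longleftrightarrow>
    ((\<lambda>t. inverse t *\<^sub>R (f (x + t *\<^sub>R v) - f x) - l) \<longlongrightarrow> 0) (at 0)"
    by (rule LIM_zero_iff[symmetric])
  also have "\<dots> \<longleftrightarrow> ((\<lambda>t. norm (inverse t *\<^sub>R (f (x + t *\<^sub>R v) - f x) - l)) \<longlongrightarrow> 0) (at 0)"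
    by (rule tendsto_norm_zero_iff[symmetric])
  also have "\<dots> \<longleftrightarrow> ((\<lambda>t. norm (f (x + t *\<^sub>R v) - f x - t *\<^sub>R l) / norm t) \<longlongrightarrow> 0) (at 0)"
  proof (rule filterlim_cong[OF refl refl])
    show "\<forall>\<^sub>F t in at 0. norm (inverse t *\<^sub>R (f (x + t *\<^sub>R v) - f x) - l) = norm (f (x + t *\<^sub>R v) - f x - t *\<^sub>R l) / norm t"
      unfolding eventually_at_filter
    proof (rule always_eventually, intro allI impI)
      fix t :: real assume t: "t \<noteq> 0"
      then have "inverse t *\<^sub>R (f (x + t *\<^sub>R v) - f x) - l = inverse t *\<^sub>R (f (x + t *\<^sub>R v) - f x - t *\<^sub>R l)"
        by (simp add: scaleR_diff_right)
      then show "norm (inverse t *\<^sub>R (f (x + t *\<^sub>R v) - f x) - l) = norm (f (x + t *\<^sub>R v) - f x - t *\<^sub>R l) / norm t"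
        by (simp add: divide_inverse mult.commute)
    qed
  qed
  finally show ?thesis
    unfolding has_dir_deriv_def has_vector_derivative_def has_derivative_at
    by (simp add: bounded_linear_scaleR_left)
qed

lemma dir_deriv_scaleR:
  fixes f :: "'a::real_vector \<Rightarrow> 'b::real_normed_vector"
  assumes "has_dir_deriv euclidean f x v l"
  shows "has_dir_deriv euclidean f x (c *\<^sub>R v) (c *\<^sub>R l)"
proof -
  have "((\<lambda>t. t * c) has_vector_derivative c) (at 0)"
    by (auto intro!: derivative_eq_intros)
  from vector_diff_chain_at[OF this, of "\<lambda>t. f (x + t *\<^sub>R v)" l] assms
  show ?thesis unfolding has_dir_deriv_euclidean_iff by (simp add: o_def mult.commute)
qed

text \<open>Additivity in the direction. The difference quotient in direction \<open>v + w\<close> is the quotient in direction \<open>w\<close>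
at \<open>x\<close> plus the quotient in direction \<open>v\<close> at the moving point \<open>x + t w\<close>. The mean value
inequality compares the latter with \<open>g x\<close>, and this needs \<open>g\<close> to be continuous at \<open>x\<close>.\<close>

lemma dir_deriv_add:
  fixes f g :: "'a::real_vector \<Rightarrow> 'b::real_normed_vector"
  assumes T: "locally_convex_space T" and U: "openin T U" and x: "x \<in> U"
    and v: "v \<in> topspace T" and w: "w \<in> topspace T"
    and f: "\<And>y. y \<in> U \<Longrightarrow> has_dir_deriv euclidean f y v (g y)"
    and g: "continuous_map (subtopology T U) euclidean g"
    and m: "has_dir_deriv euclidean f x w m"
  shows "has_dir_deriv euclidean f x (v + w) (g x + m)"
proof -
  have UT: "U \<subseteq> topspace T" using U by (rule openin_subset)
  have "((\<lambda>t. inverse t *\<^sub>R (f (x + t *\<^sub>R w + t *\<^sub>R v) - f (x + t *\<^sub>R w))) \<longlongrightarrow> g x) (at 0)"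
  proof (rule tendstoI)
    fix e :: real assume e: "e > 0"
    \<comment> \<open>The total error of the mean value estimate is half of \<open>e\<close>, which makes the final bound strict.\<close>
    define N where "N = {y \<in> U. dist (g y) (g x) < e / 2}"
    have "openin (subtopology T U) {y \<in> topspace (subtopology T U). g y \<in> ball (g x) (e/2)}"
      by (rule openin_continuous_map_preimage[OF g]) simp
    moreover have "{y \<in> topspace (subtopology T U). g y \<in> ball (g x) (e/2)} = N"
      using UT by (auto simp: N_def dist_commute)
    ultimately have N: "openin T N" using U openin_trans_full by fastforce
    have cont: "continuous_map (prod_topology euclideanreal euclideanreal) T (\<lambda>z. x + fst z *\<^sub>R w + snd z *\<^sub>R v)"
      using x v w UT by (intro lcs_add[OF T] lcs_scaleR[OF T])
        (auto intro!: continuous_intros)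
    have "open {z. x + fst z *\<^sub>R w + snd z *\<^sub>R v \<in> N}"
      using openin_continuous_map_preimage[OF cont N] by (simp add: prod_topology_euclidean)
    moreover have "(0,0) \<in> {z. x + fst z *\<^sub>R w + snd z *\<^sub>R v \<in> N}" using x e by (simp add: N_def)
    ultimately obtain A B where AB: "open A" "open B" "0 \<in> A" "0 \<in> B" "A \<times> B \<subseteq> {z. x + fst z *\<^sub>R w + snd z *\<^sub>R v \<in> N}"
      by (elim open_prod_elim) auto
    then obtain d where d: "d > 0" "ball 0 d \<subseteq> A \<inter> B"
      by (metis Int_iff open_Int open_contains_ball)
    have "dist (inverse t *\<^sub>R (f (x + t *\<^sub>R w + t *\<^sub>R v) - f (x + t *\<^sub>R w))) (g x) < e"
      if t: "dist t 0 < d" "t \<noteq> 0" for t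
    proof -
      define q where "q s = f (x + t *\<^sub>R w + s *\<^sub>R v) - s *\<^sub>R g x" for s
      have inN: "x + t *\<^sub>R w + s *\<^sub>R v \<in> N" if s: "s \<in> closed_segment 0 t" for s
      proof -
        have "norm s \<le> norm t" using segment_bound1[OF s] by simp
        then have "s \<in> ball 0 d" "t \<in> ball 0 d" using t by auto
        then have "(t, s) \<in> A \<times> B" using d by blast
        then show ?thesis using AB(5) by auto
      qed
      have "norm (q t - q 0) \<le> (e / 2) * norm (t - 0)"
      proof (rule differentiable_bound[where f' = "\<lambda>s h. h *\<^sub>R (g (x + t *\<^sub>R w + s *\<^sub>R v) - g x)"])
        show "convex (closed_segment 0 t)" by simp
        fix s assume s: "s \<in> closed_segment 0 t"
        have "has_dir_deriv euclidean f (x + t *\<^sub>R w + s *\<^sub>R v) v (g (x + t *\<^sub>R w + s *\<^sub>R v))"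
          using f inN[OF s] by (auto simp: N_def)
        then have "((\<lambda>h. f (x + t *\<^sub>R w + s *\<^sub>R v + h *\<^sub>R v)) has_vector_derivative g (x + t *\<^sub>R w + s *\<^sub>R v)) (at (s - s))"
          by (simp add: has_dir_deriv_euclidean_iff)
        moreover have "((\<lambda>r. r - s) has_vector_derivative 1) (at s)"
          by (auto intro!: derivative_eq_intros)
        ultimately have "((\<lambda>h. f (x + t *\<^sub>R w + s *\<^sub>R v + h *\<^sub>R v)) \<circ> (\<lambda>r. r - s) has_vector_derivative 1 *\<^sub>R g (x + t *\<^sub>R w + s *\<^sub>R v)) (at s)"
          by (intro vector_diff_chain_at)
        moreover have "(\<lambda>h. f (x + t *\<^sub>R w + s *\<^sub>R v + h *\<^sub>R v)) \<circ> (\<lambda>r. r - s) = (\<lambda>r. f (x + t *\<^sub>R w + r *\<^sub>R v))"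
          by (rule ext) (simp add: add.assoc flip: scaleR_add_left)
        ultimately have "((\<lambda>r. f (x + t *\<^sub>R w + r *\<^sub>R v)) has_vector_derivative g (x + t *\<^sub>R w + s *\<^sub>R v)) (at s)" by simp
        then have "(q has_vector_derivative (g (x + t *\<^sub>R w + s *\<^sub>R v) - g x)) (at s)"
          unfolding q_def by (auto intro!: derivative_eq_intros)
        then show "(q has_derivative (\<lambda>h. h *\<^sub>R (g (x + t *\<^sub>R w + s *\<^sub>R v) - g x))) (at s within closed_segment 0 t)"
          by (simp add: has_vector_derivative_def has_derivative_at_withinI)
        have "norm (g (x + t *\<^sub>R w + s *\<^sub>R v) - g x) \<le> e / 2"
          using inN[OF s] by (simp add: N_def dist_norm)
        then show "onorm (\<lambda>h. h *\<^sub>R (g (x + t *\<^sub>R w + s *\<^sub>R v) - g x)) \<le> e / 2"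
          by (intro onorm_le) (simp only: norm_scaleR real_norm_def mult.commute[of "e/2"], rule mult_left_mono, auto)
      qed auto
      moreover have "q t - q 0 = t *\<^sub>R (inverse t *\<^sub>R (f (x + t *\<^sub>R w + t *\<^sub>R v) - f (x + t *\<^sub>R w)) - g x)"
        using t by (simp add: q_def scaleR_diff_right)
      ultimately have "\<bar>t\<bar> * norm (inverse t *\<^sub>R (f (x + t *\<^sub>R w + t *\<^sub>R v) - f (x + t *\<^sub>R w)) - g x) \<le> \<bar>t\<bar> * (e/2)"
        by (simp add: mult.commute)
      then have "norm (inverse t *\<^sub>R (f (x + t *\<^sub>R w + t *\<^sub>R v) - f (x + t *\<^sub>R w)) - g x) \<le> e/2"
        using t by simp
      then show ?thesis using e by (simp add: dist_norm)
    qed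
    then show "\<forall>\<^sub>F t in at 0. dist (inverse t *\<^sub>R (f (x + t *\<^sub>R w + t *\<^sub>R v) - f (x + t *\<^sub>R w))) (g x) < e"
      unfolding eventually_at using d(1) by auto
  qed
  moreover have "((\<lambda>t. inverse t *\<^sub>R (f (x + t *\<^sub>R w) - f x)) \<longlongrightarrow> m) (at 0)"
    using m by (simp add: has_dir_deriv_def)
  ultimately have "((\<lambda>t. inverse t *\<^sub>R (f (x + t *\<^sub>R w + t *\<^sub>R v) - f (x + t *\<^sub>R w)) +
      inverse t *\<^sub>R (f (x + t *\<^sub>R w) - f x)) \<longlongrightarrow> g x + m) (at 0)"
    by (rule tendsto_add)
  moreover have "inverse t *\<^sub>R (f (x + t *\<^sub>R w + t *\<^sub>R v) - f (x + t *\<^sub>R w)) +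
      inverse t *\<^sub>R (f (x + t *\<^sub>R w) - f x) = inverse t *\<^sub>R (f (x + t *\<^sub>R (v + w)) - f x)" for t
    by (simp add: scaleR_add_right algebra_simps flip: scaleR_add_right)
  ultimately show ?thesis by (simp add: has_dir_deriv_def)
qed

lemma has_dir_deriv_euclidean_sum:
  fixes f :: "'i \<Rightarrow> 'a::real_vector \<Rightarrow> 'b::real_normed_vector"
  assumes "\<And>i. i \<in> I \<Longrightarrow> has_dir_deriv euclidean (f i) x v (l i)"
  shows "has_dir_deriv euclidean (\<lambda>x. \<Sum>i\<in>I. f i x) x v (\<Sum>i\<in>I. l i)"
  using assms unfolding has_dir_deriv_euclidean_iff by (intro has_vector_derivative_sum) auto

lemma has_dir_deriv_euclidean_scale:
  fixes f :: "'a::real_vector \<Rightarrow> 'b::real_normed_vector"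
  assumes "has_dir_deriv euclidean f x v l"
  shows "has_dir_deriv euclidean (\<lambda>x. c *\<^sub>R f x) x v (c *\<^sub>R l)"
  using assms unfolding has_dir_deriv_euclidean_iff
  by (auto intro!: derivative_eq_intros)

lemma iter_deriv_scaled_diff:
  fixes f g :: "'a::real_vector \<Rightarrow> 'b::real_normed_vector"
  assumes T: "line_continuous T" "openin T U"
    and f: "smooth_on T euclidean U f" and g: "smooth_on T euclidean U g"
    and v: "v \<in> {..<k} \<rightarrow> topspace T" and x: "x \<in> U"
  shows "iter_deriv euclidean (\<lambda>x. c *\<^sub>R (f x - g x)) k v x =
    c *\<^sub>R (iter_deriv euclidean f k v x - iter_deriv euclidean g k v x)"
  using v x
proof (induction k arbitrary: x)
  case (Suc k)
  have v: "v \<in> {..<k} \<rightarrow> topspace T" "v k \<in> topspace T" using Suc.prems by (auto simp: Pi_iff)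
  have "dir_deriv euclidean (iter_deriv euclidean (\<lambda>x. c *\<^sub>R (f x - g x)) k v) x (v k) =
    dir_deriv euclidean (\<lambda>x. c *\<^sub>R (iter_deriv euclidean f k v x - iter_deriv euclidean g k v x)) x (v k)"
    by (rule dir_deriv_cong[OF T Suc.prems(2) v(2)]) (rule Suc.IH[OF v(1)])
  also have "\<dots> = c *\<^sub>R (iter_deriv euclidean f (Suc k) v x - iter_deriv euclidean g (Suc k) v x)"
  proof (rule dir_deriv_eq[OF Hausdorff_space_euclidean], rule has_dir_deriv_euclidean_scale)
    show "has_dir_deriv euclidean (\<lambda>x. iter_deriv euclidean f k v x - iter_deriv euclidean g k v x) x (v k)
      (iter_deriv euclidean f (Suc k) v x - iter_deriv euclidean g (Suc k) v x)"
      using smooth_on_has_dir_deriv[OF f Suc.prems Hausdorff_space_euclidean]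
        smooth_on_has_dir_deriv[OF g Suc.prems Hausdorff_space_euclidean]
      unfolding has_dir_deriv_euclidean_iff by (rule has_vector_derivative_diff)
  qed
  finally show ?case by simp
qed simp

definition basis_vec :: "nat \<Rightarrow> nat \<Rightarrow> real"
  where "basis_vec i = (\<lambda>j. if j = i then 1 else 0)"

lemma basis_vec_in: "i < n \<Longrightarrow> basis_vec i \<in> topspace (Euclidean_space n)"
  by (auto simp: basis_vec_def topspace_Euclidean_space)

lemma sum_fun_apply: "(\<Sum>i\<in>I. f i) x = (\<Sum>i\<in>I. f i x)"
  by (induction I rule: infinite_finite_induct) auto

lemma Euclidean_basis_expansion:
  assumes "v \<in> topspace (Euclidean_space n)"
  shows "v = (\<Sum>i<n. v i *\<^sub>R basis_vec i)"
proof
  fix j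
  have "(\<Sum>i<n. v i *\<^sub>R basis_vec i) j = (\<Sum>i<n. if i = j then v i else 0)"
    unfolding sum_fun_apply by (rule sum.cong) (auto simp: basis_vec_def)
  also have "\<dots> = v j" using assms by (auto simp: topspace_Euclidean_space)
  finally show "v j = (\<Sum>i<n. v i *\<^sub>R basis_vec i) j" by simp
qed

lemma continuous_map_Euclidean_component:
  "continuous_map (Euclidean_space n) euclideanreal (\<lambda>x. x i)"
  unfolding Euclidean_space_def
  by (intro continuous_map_from_subtopology continuous_map_product_projection) auto

lemma dir_deriv_from_partials:
  fixes f :: "(nat \<Rightarrow> real) \<Rightarrow> 'b::real_normed_vector"
  assumes E: "locally_convex_space (Euclidean_space n)" and U: "openin (Euclidean_space n) U"
    and f: "\<And>i y. i < n \<Longrightarrow> y \<in> U \<Longrightarrow> has_dir_deriv euclidean f y (basis_vec i) (g i y)"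
    and g: "\<And>i. i < n \<Longrightarrow> continuous_map (subtopology (Euclidean_space n) U) euclidean (g i)"
    and x: "x \<in> U" and v: "v \<in> topspace (Euclidean_space n)"
  shows "has_dir_deriv euclidean f x v (\<Sum>i<n. v i *\<^sub>R g i x)"
proof -
  have sub: "subspace (topspace (Euclidean_space n))" using E by (rule lcs_subspace)
  have "j \<le> n \<Longrightarrow> has_dir_deriv euclidean f x (\<Sum>i<j. v i *\<^sub>R basis_vec i) (\<Sum>i<j. v i *\<^sub>R g i x)" for j
  proof (induction j)
    case 0
    have "has_dir_deriv euclidean f x 0 0" by (simp only: has_dir_deriv_def scaleR_zero_right add_0_right diff_self limitin_const)
    then show ?case by (simp only: lessThan_0 sum.empty)
  next
    case (Suc j)
    have "has_dir_deriv euclidean f x (v j *\<^sub>R basis_vec j + (\<Sum>i<j. v i *\<^sub>R basis_vec i))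
       (v j *\<^sub>R g j x + (\<Sum>i<j. v i *\<^sub>R g i x))"
    proof (rule dir_deriv_add[OF E U x])
      show "v j *\<^sub>R basis_vec j \<in> topspace (Euclidean_space n)"
        using Suc.prems by (intro subspace_scale[OF sub] basis_vec_in) auto
      show "(\<Sum>i<j. v i *\<^sub>R basis_vec i) \<in> topspace (Euclidean_space n)"
        using Suc.prems by (intro subspace_sum[OF sub] subspace_scale[OF sub] basis_vec_in) auto
      show "has_dir_deriv euclidean f y (v j *\<^sub>R basis_vec j) (v j *\<^sub>R g j y)" if "y \<in> U" for y
        using Suc.prems that by (intro dir_deriv_scaleR f) auto
      show "continuous_map (subtopology (Euclidean_space n) U) euclidean (\<lambda>y. v j *\<^sub>R g j y)"
        using g[of j] Suc.prems by (simp add: continuous_map_atin tendsto_scaleR)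
    qed (use Suc in auto)
    then show ?case by (simp only: sum.lessThan_Suc add.commute)
  qed
  from this[of n] show ?thesis using Euclidean_basis_expansion[OF v] by simp
qed

text \<open>The higher derivatives of a function with partial derivatives in \<open>A\<close>: polynomials in the
components of the directions with coefficients in \<open>A\<close>.\<close>

inductive polynomial_jet :: "nat \<Rightarrow> ((nat \<Rightarrow> real) \<Rightarrow> 'b::real_normed_vector) set \<Rightarrow> nat \<Rightarrow>
    ((nat \<Rightarrow> nat \<Rightarrow> real) \<Rightarrow> (nat \<Rightarrow> real) \<Rightarrow> 'b) \<Rightarrow> bool"
  for n A k where
  base: "g \<in> A \<Longrightarrow> polynomial_jet n A k (\<lambda>v x. g x)"
| coeff: "polynomial_jet n A k h \<Longrightarrow> i < k \<Longrightarrow> polynomial_jet n A k (\<lambda>v x. v i j *\<^sub>R h v x)"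
| sum: "(\<And>j. j < m \<Longrightarrow> polynomial_jet n A k (H j)) \<Longrightarrow> polynomial_jet n A k (\<lambda>v x. \<Sum>j<(m::nat). H j v x)"

lemma continuous_map_scaleR:
  fixes f :: "'x \<Rightarrow> 'b::real_normed_vector"
  shows "continuous_map X euclideanreal c \<Longrightarrow> continuous_map X euclidean f \<Longrightarrow> continuous_map X euclidean (\<lambda>x. c x *\<^sub>R f x)"
  by (simp add: continuous_map_atin tendsto_scaleR)

text \<open>In finitely many variables it suffices to differentiate in the basis directions: continuous partial derivatives
give all directional derivatives as linear combinations, so that the
joint continuity in point and directions comes for free.\<close>

lemma smooth_on_partialsI:
  fixes f :: "(nat \<Rightarrow> real) \<Rightarrow> 'b::real_normed_vector"
  assumes E: "locally_convex_space (Euclidean_space n)" and U: "openin (Euclidean_space n) U" and f: "f \<in> A"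
    and cont: "\<And>h. h \<in> A \<Longrightarrow> continuous_map (subtopology (Euclidean_space n) U) euclidean h"
    and part: "\<And>h i. h \<in> A \<Longrightarrow> i < n \<Longrightarrow>
      \<exists>g\<in>A. \<forall>x\<in>U. has_dir_deriv euclidean h x (basis_vec i) (g x)"
  shows "smooth_on (Euclidean_space n) euclidean U f"
proof (rule smooth_onI[where Q = "polynomial_jet n A" and h = "\<lambda>v. f"])
  let ?E = "Euclidean_space n"
  fix k h assume Q: "polynomial_jet n A k h"
  let ?X = "prod_topology (subtopology ?E U) (product_topology (\<lambda>_. ?E) {..<k})"
  show "continuous_map ?X euclidean (\<lambda>(x, v). h v x)"
    using Q
  proof induction
    case (base g)
    have "continuous_map ?X euclidean (g \<circ> fst)"
      by (rule continuous_map_compose[OF continuous_map_fst cont[OF base]])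
    then show ?case by (simp add: o_def case_prod_unfold)
  next
    case (coeff h i j)
    have "continuous_map ?X euclideanreal ((\<lambda>x. x j) \<circ> ((\<lambda>v. v i) \<circ> snd))"
      using coeff(2) by (intro continuous_map_compose[OF _ continuous_map_Euclidean_component[of n]]
         continuous_map_compose[OF continuous_map_snd] continuous_map_product_projection[where X = "\<lambda>_. ?E"]) auto
    from continuous_map_scaleR[OF this coeff(3)] show ?case
      by (simp add: o_def case_prod_unfold)
  next
    case (sum m H)
    have "continuous_map ?X euclidean (\<lambda>z. \<Sum>j<m. (\<lambda>(x,v). H j v x) z)"
      by (rule continuous_map_sum) (use sum in auto)
    then show ?case by (simp add: case_prod_unfold)
  qed
  show "\<exists>h'. polynomial_jet n A (Suc k) h' \<and>
      (\<forall>v\<in>{..<Suc k} \<rightarrow> topspace ?E. \<forall>x\<in>U. has_dir_deriv euclidean (h v) x (v k) (h' v x))"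
    using Q
  proof induction
    case (base g)
    then obtain G where G: "\<And>i. i < n \<Longrightarrow> G i \<in> A"
       "\<And>i x. i < n \<Longrightarrow> x \<in> U \<Longrightarrow> has_dir_deriv euclidean g x (basis_vec i) (G i x)"
      using part by metis
    have "polynomial_jet n A (Suc k) (\<lambda>v x. \<Sum>i<n. v k i *\<^sub>R G i x)"
      using G(1) by (intro polynomial_jet.intros) auto
    moreover have "has_dir_deriv euclidean g x (v k) (\<Sum>i<n. v k i *\<^sub>R G i x)"
      if "v\<in>{..<Suc k} \<rightarrow> topspace ?E" "x \<in> U" for v x
      using that G cont by (intro dir_deriv_from_partials[OF E U]) (auto simp: Pi_iff)
    ultimately show ?case by blast
  next
    case (coeff h i j)
    then obtain h' where h': "polynomial_jet n A (Suc k) h'"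
      "\<And>v x. v\<in>{..<Suc k} \<rightarrow> topspace ?E \<Longrightarrow> x\<in>U \<Longrightarrow> has_dir_deriv euclidean (h v) x (v k) (h' v x)"
      by blast
    then show ?case using coeff(2)
      by (intro exI[of _ "\<lambda>v x. v i j *\<^sub>R h' v x"]) (auto intro!: polynomial_jet.intros has_dir_deriv_euclidean_scale)
  next
    case (sum m H)
    then obtain H' where "\<And>j. j < m \<Longrightarrow> polynomial_jet n A (Suc k) (H' j)"
      "\<And>j v x. j < m \<Longrightarrow> v\<in>{..<Suc k} \<rightarrow> topspace ?E \<Longrightarrow> x\<in>U \<Longrightarrow> has_dir_deriv euclidean (H j v) x (v k) (H' j v x)"
      by metis
    then show ?case
      by (intro exI[of _ "\<lambda>v x. \<Sum>j<m. H' j v x"]) (auto intro!: polynomial_jet.intros has_dir_deriv_euclidean_sum)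
  qed
qed (use assms in \<open>auto intro: line_continuous_lcs polynomial_jet.base\<close>)

lemma smooth_on_linear_last:
  fixes f :: "(nat \<Rightarrow> real) \<Rightarrow> 'b::real_normed_vector"
  assumes E: "locally_convex_space (Euclidean_space n)" and U: "openin (Euclidean_space n) U"
    and f: "smooth_on (Euclidean_space n) euclidean U f"
    and v: "v \<in> {..<Suc k} \<rightarrow> topspace (Euclidean_space n)" and x: "x \<in> U"
  shows "iter_deriv euclidean f (Suc k) v x =
    (\<Sum>j<n. v k j *\<^sub>R iter_deriv euclidean f (Suc k) (v(k := basis_vec j)) x)"
proof -
  let ?E = "Euclidean_space n"
  have upd: "v(k := basis_vec j) \<in> {..<Suc k} \<rightarrow> topspace ?E" if "j < n" for j
    using v basis_vec_in[OF that] by (auto simp: Pi_iff)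
  have "has_dir_deriv euclidean (iter_deriv euclidean f k v) x (v k)
     (\<Sum>j<n. v k j *\<^sub>R iter_deriv euclidean f (Suc k) (v(k := basis_vec j)) x)"
  proof (rule dir_deriv_from_partials[OF E U _ _ x])
    fix i y assume i: "i < n" and y: "y \<in> U"
    have "iter_deriv euclidean f k (v(k := basis_vec i)) = iter_deriv euclidean f k v"
      by (rule iter_deriv_dirs_cong) auto
    then show "has_dir_deriv euclidean (iter_deriv euclidean f k v) y (basis_vec i) (iter_deriv euclidean f (Suc k) (v(k := basis_vec i)) y)"
      using smooth_on_has_dir_deriv[OF f upd[OF i] y] by simp
  next
    fix i assume "i < n"
    show "continuous_map (subtopology ?E U) euclidean (\<lambda>x. iter_deriv euclidean f (Suc k) (v(k := basis_vec i)) x)"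
      by (rule smooth_on_continuous_fixed[OF f upd]) fact
  qed (use v in auto)
  then show ?thesis by (simp add: dir_deriv_eq)
qed

text \<open>Iterated derivatives are linear in each direction, not only in the last one: differentiating
the expansion in slot \<open>p\<close> further does not touch the coefficients.\<close>

lemma smooth_on_slot_expansion:
  fixes f :: "(nat \<Rightarrow> real) \<Rightarrow> 'b::real_normed_vector"
  assumes E: "locally_convex_space (Euclidean_space n)" and U: "openin (Euclidean_space n) U"
    and f: "smooth_on (Euclidean_space n) euclidean U f"
    and p: "p < k" and v: "v \<in> {..<k} \<rightarrow> topspace (Euclidean_space n)" and x: "x \<in> U"
  shows "iter_deriv euclidean f k v x =
    (\<Sum>j<n. v p j *\<^sub>R iter_deriv euclidean f k (v(p := basis_vec j)) x)"
  using p v x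
proof (induction k arbitrary: x)
  case (Suc k)
  let ?E = "Euclidean_space n"
  show ?case
  proof (cases "p = k")
    case True
    show ?thesis unfolding True by (rule smooth_on_linear_last[OF E U f Suc.prems(2,3)])
  next
    case False
    then have p: "p < k" using Suc.prems by auto
    have v: "v \<in> {..<k} \<rightarrow> topspace ?E" using Suc.prems by (auto simp: Pi_iff)
    have "has_dir_deriv euclidean (\<lambda>y. \<Sum>j<n. v p j *\<^sub>R iter_deriv euclidean f k (v(p := basis_vec j)) y) x (v k)
      (\<Sum>j<n. v p j *\<^sub>R iter_deriv euclidean f (Suc k) (v(p := basis_vec j)) x)"
    proof (intro has_dir_deriv_euclidean_sum has_dir_deriv_euclidean_scale)
      fix j assume "j \<in> {..<n}"
      then have "v(p := basis_vec j) \<in> {..<Suc k} \<rightarrow> topspace ?E"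
        using Suc.prems basis_vec_in[of j n] by (auto simp: Pi_iff)
      from smooth_on_has_dir_deriv[OF f this Suc.prems(3)] False
      show "has_dir_deriv euclidean (iter_deriv euclidean f k (v(p := basis_vec j))) x (v k) (iter_deriv euclidean f (Suc k) (v(p := basis_vec j)) x)"
        by simp
    qed
    moreover have "has_dir_deriv euclidean (iter_deriv euclidean f k v) x (v k) l \<longleftrightarrow>
       has_dir_deriv euclidean (\<lambda>y. \<Sum>j<n. v p j *\<^sub>R iter_deriv euclidean f k (v(p := basis_vec j)) y) x (v k) l" for l
      using Suc.prems(2) by (intro has_dir_deriv_cong[OF line_continuous_lcs[OF E] U Suc.prems(3) _ Suc.IH[OF p v]])
        (auto simp: Pi_iff)
    ultimately have "has_dir_deriv euclidean (iter_deriv euclidean f k v) x (v k)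
      (\<Sum>j<n. v p j *\<^sub>R iter_deriv euclidean f (Suc k) (v(p := basis_vec j)) x)" by blast
    from dir_deriv_eq[OF Hausdorff_space_euclidean this] have "dir_deriv euclidean (iter_deriv euclidean f k v) x (v k) =
      (\<Sum>j<n. v p j *\<^sub>R iter_deriv euclidean f (Suc k) (v(p := basis_vec j)) x)" by blast
    then show ?thesis by (rule trans[OF iter_deriv.simps(2)])
  qed
qed simp

section \<open>Algebraic operations on smooth functions of finitely many variables\<close>

text \<open>The classical flat functions. The powers of \<open>t\<close> in the denominator make the family closed under
differentiation up to linear combinations.\<close>

definition flat :: "nat \<Rightarrow> real \<Rightarrow> real"
  where "flat m t = (if t > 0 then exp (- (1 / t)) / t ^ m else 0)"

lemma flat_pos: "t > 0 \<Longrightarrow> flat m t > 0"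
  and flat_zero: "t \<le> 0 \<Longrightarrow> flat m t = 0"
  and flat_nonneg: "flat m t \<ge> 0"
  by (auto simp: flat_def)

lemma flat_tendsto_0: "(flat m \<longlongrightarrow> 0) (at 0)"
proof -
  have "((\<lambda>t::real. (inverse t) ^ m / exp (inverse t)) \<longlongrightarrow> 0) (at_right 0)"
    by (rule filterlim_compose[OF tendsto_power_div_exp_0 filterlim_inverse_at_top_right])
  moreover have "\<forall>\<^sub>F t in at_right 0. (inverse t) ^ m / exp (inverse t) = flat m t"
    unfolding eventually_at_filter
    by (rule always_eventually) (auto simp: flat_def field_simps exp_minus)
  ultimately have 1: "(flat m \<longlongrightarrow> 0) (at_right 0)" by (rule Lim_transform_eventually)
  have "\<forall>\<^sub>F t in at_left 0. 0 = flat m t"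
    unfolding eventually_at_filter by (rule always_eventually) (auto simp: flat_def)
  then have "(flat m \<longlongrightarrow> 0) (at_left 0)"
    by (rule Lim_transform_eventually[rotated]) simp
  with 1 show ?thesis by (simp add: filterlim_at_split)
qed

lemma flat_has_derivative:
  "(flat m has_real_derivative (flat (m + 2) t - real m * flat (m + 1) t)) (at t)"
proof -
  consider "t > 0" | "t < 0" | "t = 0" by linarith
  then show ?thesis
  proof cases
    case 1
    have "((\<lambda>t. exp (- inverse t) * inverse t ^ m) has_real_derivative
       exp (- inverse t) * (inverse t)\<^sup>2 * inverse t ^ m - exp (- inverse t) * (real m * inverse t ^ (m - 1) * (inverse t)\<^sup>2)) (at t)"
      using 1 by (auto intro!: derivative_eq_intros simp: power2_eq_square)
    moreover have "real m * inverse t ^ (m - 1) * (inverse t)\<^sup>2 = real m * inverse t ^ (m + 1)"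
      by (cases m) (auto simp: power2_eq_square)
    moreover have "flat (m + 2) t - real m * flat (m + 1) t = exp (- inverse t) * (inverse t)\<^sup>2 * inverse t ^ m - exp (- inverse t) * (real m * inverse t ^ (m + 1))"
      using 1 by (simp add: flat_def divide_inverse power_inverse power2_eq_square mult_ac)
    ultimately have "((\<lambda>t. exp (- inverse t) * inverse t ^ m) has_real_derivative flat (m + 2) t - real m * flat (m + 1) t) (at t)"
      by (simp only:)
    then show ?thesis
      by (rule has_field_derivative_transform_within_open[where S="{0<..}"])
         (use 1 in \<open>auto simp: flat_def divide_inverse power_inverse\<close>)
  next
    case 2
    have "((\<lambda>t. 0) has_real_derivative 0) (at t)" by simp
    then have "(flat m has_real_derivative 0) (at t)"
      by (rule has_field_derivative_transform_within_open[where S="{..<0}"]) (use 2 in \<open>auto simp: flat_def\<close>)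
    then show ?thesis using 2 by (simp add: flat_def)
  next
    case 3
    \<comment> \<open>The difference quotient at \<open>0\<close> is \<open>flat (Suc m)\<close>, so flatness of the whole family gives the derivative.\<close>
    have "((\<lambda>h. (flat m (0 + h) - flat m 0) / h) \<longlongrightarrow> 0) (at 0)"
      by (rule Lim_transform_eventually[OF flat_tendsto_0[of "Suc m"]], unfold eventually_at_filter)
         (rule always_eventually, auto simp: flat_def)
    then show ?thesis using 3 by (simp add: DERIV_def flat_def)
  qed
qed

lemma flat_continuous: "continuous_on UNIV (flat m)"
  by (meson DERIV_continuous_on flat_has_derivative has_field_derivative_at_within)

text \<open>Closing the smooth functions under the operations used below produces a set that is visibly closed
under partial derivatives. By the criterion for partial derivatives its members are smooth,
which settles all these closure properties at once.\<close>

inductive smooth_algebra :: "nat \<Rightarrow> (nat \<Rightarrow> real) set \<Rightarrow> ((nat \<Rightarrow> real) \<Rightarrow> complex) \<Rightarrow> bool"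
  for n U where
  base: "smooth_on (Euclidean_space n) euclidean U f \<Longrightarrow> v \<in> {..<k} \<rightarrow> topspace (Euclidean_space n) \<Longrightarrow>
    smooth_algebra n U (iter_deriv euclidean f k v)"
| const: "smooth_algebra n U (\<lambda>x. c)"
| add: "smooth_algebra n U f \<Longrightarrow> smooth_algebra n U g \<Longrightarrow> smooth_algebra n U (\<lambda>x. f x + g x)"
| mult: "smooth_algebra n U f \<Longrightarrow> smooth_algebra n U g \<Longrightarrow> smooth_algebra n U (\<lambda>x. f x * g x)"
| cnj: "smooth_algebra n U f \<Longrightarrow> smooth_algebra n U (\<lambda>x. cnj (f x))"
| inverse: "smooth_algebra n U f \<Longrightarrow> (\<And>x. x \<in> U \<Longrightarrow> f x \<noteq> 0) \<Longrightarrow> smooth_algebra n U (\<lambda>x. inverse (f x))"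
| flat: "smooth_algebra n U f \<Longrightarrow> smooth_algebra n U (\<lambda>x. complex_of_real (flat m (Re (f x))))"

lemma smooth_algebra_base:
  "smooth_on (Euclidean_space n) euclidean U f \<Longrightarrow> smooth_algebra n U f"
  using smooth_algebra.base[of n U f "\<lambda>_. undefined" 0] by (simp add: iter_deriv.simps[abs_def])

lemma continuous_map_euclidean_compose:
  "continuous_map X euclidean f \<Longrightarrow> continuous_on UNIV h \<Longrightarrow> continuous_map X euclidean (\<lambda>x. h (f x))"
  using continuous_map_compose[of X euclidean f euclidean h] by (simp add: o_def)

lemma smooth_algebra_continuous:
  assumes "smooth_algebra n U f"
  shows "continuous_map (subtopology (Euclidean_space n) U) euclidean f"
  using assms
proof induction
  case (base f v k)
  then show ?case by (rule smooth_on_continuous_fixed)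
next
  case (inverse f)
  then show ?case by (simp add: continuous_map_atin tendsto_inverse)
next
  case (flat f m)
  have "continuous_on UNIV (\<lambda>z. complex_of_real (flat m (Re z)))"
    by (intro continuous_on_of_real continuous_on_compose2[OF flat_continuous] continuous_intros) auto
  from continuous_map_euclidean_compose[OF flat.IH this] show ?case .
next
  case (cnj f)
  show ?case by (rule continuous_map_euclidean_compose[OF cnj.IH]) (intro continuous_intros)
qed (auto simp: continuous_map_atin intro: tendsto_add tendsto_mult)

lemma smooth_algebra_deriv:
  assumes "smooth_algebra n U f" and w: "w \<in> topspace (Euclidean_space n)"
  shows "\<exists>g. smooth_algebra n U g \<and> (\<forall>x\<in>U. has_dir_deriv euclidean f x w (g x))"
  using assms(1)
proof induction
  case (base f v k)
  have v: "v(k := w) \<in> {..<Suc k} \<rightarrow> topspace (Euclidean_space n)" using base w by (auto simp: Pi_iff)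
  have "iter_deriv euclidean f k (v(k := w)) = iter_deriv euclidean f k v"
    by (rule iter_deriv_dirs_cong) auto
  then have "has_dir_deriv euclidean (iter_deriv euclidean f k v) x w (iter_deriv euclidean f (Suc k) (v(k := w)) x)"
    if "x \<in> U" for x
    using smooth_on_has_dir_deriv[OF base(1) v that] by simp
  then show ?case using smooth_algebra.base[OF base(1) v] by blast
next
  case (const c)
  show ?case by (intro exI[of _ "\<lambda>x. 0"]) (auto intro: smooth_algebra.const simp: has_dir_deriv_def)
next
  case (add f g)
  then obtain f' g' where *: "smooth_algebra n U f'" "\<And>x. x \<in> U \<Longrightarrow> has_dir_deriv euclidean f x w (f' x)"
    "smooth_algebra n U g'" "\<And>x. x \<in> U \<Longrightarrow> has_dir_deriv euclidean g x w (g' x)" by blast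
  show ?case
    by (rule exI[of _ "\<lambda>x. f' x + g' x"])
       (use * in \<open>auto intro!: smooth_algebra.add has_vector_derivative_add simp: has_dir_deriv_euclidean_iff\<close>)
next
  case (mult f g)
  then obtain f' g' where *: "smooth_algebra n U f'" "\<And>x. x \<in> U \<Longrightarrow> has_dir_deriv euclidean f x w (f' x)"
    "smooth_algebra n U g'" "\<And>x. x \<in> U \<Longrightarrow> has_dir_deriv euclidean g x w (g' x)" by blast
  have "has_dir_deriv euclidean (\<lambda>x. f x * g x) x w (f x * g' x + f' x * g x)" if "x \<in> U" for x
    using *(2,4)[OF that] has_vector_derivative_mult[of "\<lambda>t. f (x + t *\<^sub>R w)" "f' x" 0 UNIV "\<lambda>t. g (x + t *\<^sub>R w)" "g' x"]
    unfolding has_dir_deriv_euclidean_iff by simp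
  moreover have "smooth_algebra n U (\<lambda>x. f x * g' x + f' x * g x)"
    using mult * by (intro smooth_algebra.add smooth_algebra.mult)
  ultimately show ?case by blast
next
  case (cnj f)
  then obtain f' where *: "smooth_algebra n U f'" "\<And>x. x \<in> U \<Longrightarrow> has_dir_deriv euclidean f x w (f' x)" by blast
  show ?case
    by (rule exI[of _ "\<lambda>x. cnj (f' x)"])
      (use * in \<open>auto intro!: smooth_algebra.cnj has_vector_derivative_cnj simp: has_dir_deriv_euclidean_iff\<close>)
next
  case (inverse f)
  then obtain f' where *: "smooth_algebra n U f'" "\<And>x. x \<in> U \<Longrightarrow> has_dir_deriv euclidean f x w (f' x)" by blast
  have "has_dir_deriv euclidean (\<lambda>x. inverse (f x)) x w ((-1) * (inverse (f x) * f' x * inverse (f x)))" if x: "x \<in> U" for x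
  proof -
    have "((\<lambda>t. f (x + t *\<^sub>R w)) has_derivative (\<lambda>h. h *\<^sub>R f' x)) (at 0)"
      using *(2)[OF x] by (simp add: has_dir_deriv_euclidean_iff has_vector_derivative_def)
    from Deriv.has_derivative_inverse[OF _ this] inverse(2)[OF x]
    show ?thesis by (simp add: has_dir_deriv_euclidean_iff has_vector_derivative_def)
  qed
  moreover have "smooth_algebra n U (\<lambda>x. (-1) * (inverse (f x) * f' x * inverse (f x)))"
    using inverse * by (intro smooth_algebra.intros)
  ultimately show ?case by blast
next
  case (flat f m)
  then obtain f' where *: "smooth_algebra n U f'" "\<And>x. x \<in> U \<Longrightarrow> has_dir_deriv euclidean f x w (f' x)" by blast
  let ?r = "\<lambda>x. (f' x + cnj (f' x)) * (1/2)"
  let ?g = "\<lambda>x. (complex_of_real (flat (m + 2) (Re (f x))) + (- of_nat m) * complex_of_real (flat (m + 1) (Re (f x)))) * ?r x"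
  have "has_dir_deriv euclidean (\<lambda>x. complex_of_real (flat m (Re (f x)))) x w (?g x)" if x: "x \<in> U" for x
  proof -
    have "((\<lambda>t. Re (f (x + t *\<^sub>R w))) has_vector_derivative Re (f' x)) (at 0)"
      using *(2)[OF x] unfolding has_dir_deriv_euclidean_iff by (rule bounded_linear.has_vector_derivative[OF bounded_linear_Re])
    then have "((\<lambda>t. Re (f (x + t *\<^sub>R w))) has_real_derivative Re (f' x)) (at 0)"
      by (simp add: has_real_derivative_iff_has_vector_derivative)
    from DERIV_chain2[OF flat_has_derivative this, of m]
    have "((\<lambda>t. complex_of_real (flat m (Re (f (x + t *\<^sub>R w))))) has_vector_derivative
       of_real ((flat (m + 2) (Re (f x)) - real m * flat (m + 1) (Re (f x))) * Re (f' x))) (at 0)"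
      by (intro has_vector_derivative_of_real) (simp add: has_real_derivative_iff_has_vector_derivative)
    moreover have "of_real ((flat (m + 2) (Re (f x)) - real m * flat (m + 1) (Re (f x))) * Re (f' x)) = ?g x"
      unfolding complex_add_cnj by simp
    ultimately show ?thesis unfolding has_dir_deriv_euclidean_iff by (simp only:)
  qed
  moreover have "smooth_algebra n U ?g"
    using flat * by (intro smooth_algebra.intros)
  ultimately show ?case by blast
qed

lemma smooth_algebra_smooth_on:
  assumes "locally_convex_space (Euclidean_space n)" "openin (Euclidean_space n) U" "smooth_algebra n U f"
  shows "smooth_on (Euclidean_space n) euclidean U f"
proof (rule smooth_on_partialsI[OF assms(1,2), of f "Collect (smooth_algebra n U)"])
  fix h i assume "h \<in> Collect (smooth_algebra n U)" "i < n"
  then show "\<exists>g\<in>Collect (smooth_algebra n U). \<forall>x\<in>U. has_dir_deriv euclidean h x (basis_vec i) (g x)"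
    using smooth_algebra_deriv[OF _ basis_vec_in, of n U h i] by auto
qed (use assms smooth_algebra_continuous in auto)

lemma smooth_algebra_sum:
  assumes "\<And>i. i < (m::nat) \<Longrightarrow> smooth_algebra n U (f i)"
  shows "smooth_algebra n U (\<lambda>x. \<Sum>i<m. f i x)"
  using assms
proof (induction m)
  case 0
  show ?case by (simp add: smooth_algebra.const)
next
  case (Suc m)
  then have "smooth_algebra n U (\<lambda>x. (\<Sum>i<m. f i x) + f m x)"
    by (intro smooth_algebra.add) auto
  then show ?case by simp
qed

section \<open>Charts\<close>

text \<open>The conditions on a single chart, separated from the compatibility of charts. They hold
for product charts and are all that is needed to glue continuous maps.\<close>

definition chart :: "('p, 'v::real_vector) manifold \<Rightarrow> 'p set \<Rightarrow> ('p \<Rightarrow> 'v) \<Rightarrow> bool"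
  where "chart M U \<phi> \<longleftrightarrow> openin (man_top M) U \<and> openin (man_model M) (\<phi> ` U) \<and>
    homeomorphic_map (subtopology (man_top M) U) (subtopology (man_model M) (\<phi> ` U)) \<phi>"

lemma smooth_manifold_chart:
  "smooth_manifold M \<Longrightarrow> (U, \<phi>) \<in> man_atlas M \<Longrightarrow> chart M U \<phi>"
  by (auto simp: smooth_manifold_def chart_def)

lemma chart_inj: "chart M U \<phi> \<Longrightarrow> inj_on \<phi> U"
  unfolding chart_def homeomorphic_map_def
  by (metis topspace_subtopology_subset openin_subset)

lemma chart_subset: "chart M U \<phi> \<Longrightarrow> U \<subseteq> points M"
  by (auto simp: chart_def dest: openin_subset)

lemma chart_inv [simp]: "chart M U \<phi> \<Longrightarrow> p \<in> U \<Longrightarrow> inv_into U \<phi> (\<phi> p) = p"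
  by (simp add: chart_inj)

lemma chart_continuous: "chart M U \<phi> \<Longrightarrow> continuous_map (subtopology (man_top M) U) (man_model M) \<phi>"
  unfolding chart_def homeomorphic_map_maps homeomorphic_maps_def
  by (auto simp: continuous_map_in_subtopology)

lemma chart_homeomorphic_maps:
  assumes "chart M U \<phi>"
  shows "homeomorphic_maps (subtopology (man_top M) U) (subtopology (man_model M) (\<phi> ` U)) \<phi> (inv_into U \<phi>)"
proof -
  obtain g where g: "homeomorphic_maps (subtopology (man_top M) U) (subtopology (man_model M) (\<phi> ` U)) \<phi> g"
    using assms by (auto simp: chart_def homeomorphic_map_maps)
  have U: "topspace (subtopology (man_top M) U) = U"
    using chart_subset[OF assms] by auto
  have "continuous_map (subtopology (man_model M) (\<phi> ` U)) (subtopology (man_top M) U) g"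
    using g by (simp add: homeomorphic_maps_def)
  moreover have "g y = inv_into U \<phi> y" if "y \<in> topspace (subtopology (man_model M) (\<phi> ` U))" for y
    using g that U chart_inv[OF assms] unfolding homeomorphic_maps_def by auto
  ultimately have "continuous_map (subtopology (man_model M) (\<phi> ` U)) (subtopology (man_top M) U) (inv_into U \<phi>)"
    by (rule continuous_map_eq)
  then show ?thesis using g U chart_inv[OF assms] unfolding homeomorphic_maps_def by auto
qed

lemma chart_inv_continuous:
  assumes "chart M U \<phi>"
  shows "continuous_map (subtopology (man_model M) (\<phi> ` U)) (man_top M) (inv_into U \<phi>)"
  using chart_homeomorphic_maps[OF assms] by (auto simp: homeomorphic_maps_def continuous_map_in_subtopology)

lemma chart_image_open:
  assumes c: "chart M U \<phi>" and W: "openin (man_top M) W"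
  shows "openin (man_model M) (\<phi> ` (U \<inter> W))"
proof -
  have "openin (subtopology (man_model M) (\<phi> ` U)) {y \<in> topspace (subtopology (man_model M) (\<phi> ` U)). inv_into U \<phi> y \<in> W}"
    by (rule openin_continuous_map_preimage[OF chart_inv_continuous[OF c] W])
  moreover have "topspace (subtopology (man_model M) (\<phi> ` U)) = \<phi> ` U"
    using c openin_subset unfolding chart_def by fastforce
  moreover have "{y \<in> \<phi> ` U. inv_into U \<phi> y \<in> W} = \<phi> ` (U \<inter> W)"
    using chart_inv[OF c] by auto
  ultimately have "openin (subtopology (man_model M) (\<phi> ` U)) (\<phi> ` (U \<inter> W))" by (simp only:)
  then show ?thesis using c unfolding chart_def by (blast intro: openin_trans_full)
qed

lemma chart_prod:
  assumes M: "chart M U \<phi>" and N: "chart N V \<psi>"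
  shows "chart (prod_manifold M N) (U \<times> V) (map_prod \<phi> \<psi>)"
proof -
  have im: "map_prod \<phi> \<psi> ` (U \<times> V) = \<phi> ` U \<times> \<psi> ` V" by auto
  have "homeomorphic_maps (prod_topology (subtopology (man_top M) U) (subtopology (man_top N) V))
     (prod_topology (subtopology (man_model M) (\<phi> ` U)) (subtopology (man_model N) (\<psi> ` V)))
     (\<lambda>(x,y). (\<phi> x, \<psi> y)) (\<lambda>(x,y). (inv_into U \<phi> x, inv_into V \<psi> y))"
    unfolding homeomorphic_maps_prod using chart_homeomorphic_maps[OF M] chart_homeomorphic_maps[OF N] by simp
  moreover have "(\<lambda>(x,y). (\<phi> x, \<psi> y)) = map_prod \<phi> \<psi>" by auto
  ultimately have "homeomorphic_map (subtopology (man_top (prod_manifold M N)) (U \<times> V))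
    (subtopology (man_model (prod_manifold M N)) (map_prod \<phi> \<psi> ` (U \<times> V))) (map_prod \<phi> \<psi>)"
    unfolding im by (auto simp: homeomorphic_map_maps prod_manifold_def subtopology_Times)
  then show ?thesis using M N im by (auto simp: chart_def prod_manifold_def openin_prod_Times_iff)
qed

lemma inv_into_map_prod:
  assumes "inj_on \<phi> U" "inj_on \<psi> V" "x \<in> \<phi> ` U" "y \<in> \<psi> ` V"
  shows "inv_into (U \<times> V) (map_prod \<phi> \<psi>) (x, y) = (inv_into U \<phi> x, inv_into V \<psi> y)"
proof -
  obtain p q where "p \<in> U" "q \<in> V" "x = \<phi> p" "y = \<psi> q" using assms by auto
  then show ?thesis
    using inv_into_f_f[of "map_prod \<phi> \<psi>" "U \<times> V" "(p, q)"] assms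
    by (simp add: map_prod_inj_on inv_into_f_f)
qed

text \<open>For maps into a locally convex space continuity need not be checked separately: it is the
zeroth part of smoothness in charts.\<close>

lemma smooth_map_lcsI:
  assumes charts: "\<And>U \<phi>. (U, \<phi>) \<in> man_atlas M \<Longrightarrow> chart M U \<phi>"
    and cover: "points M \<subseteq> (\<Union>(U, \<phi>)\<in>man_atlas M. U)"
    and smooth: "\<And>U \<phi>. (U, \<phi>) \<in> man_atlas M \<Longrightarrow> smooth_on (man_model M) S (\<phi> ` U) (f \<circ> inv_into U \<phi>)"
  shows "smooth_map M (lcs_manifold S) f"
proof -
  have cont: "continuous_map (man_top M) S f"
  proof (rule pasting_lemma[where I = "man_atlas M" and T = fst and f = "\<lambda>_. f"])
    fix c assume "c \<in> man_atlas M"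
    then obtain U \<phi> where c: "c = (U, \<phi>)" "(U, \<phi>) \<in> man_atlas M" by (cases c) auto
    have ch: "chart M U \<phi>" using charts c by blast
    then show "openin (man_top M) (fst c)" using c by (simp add: chart_def)
    have "continuous_map (subtopology (man_top M) U) (subtopology (man_model M) (\<phi> ` U)) \<phi>"
      using chart_homeomorphic_maps[OF ch] by (simp add: homeomorphic_maps_def)
    from continuous_map_compose[OF this smooth_on_continuous_map[OF smooth[OF c(2)]]]
    have "continuous_map (subtopology (man_top M) U) S f"
      by (rule continuous_map_eq) (use ch in auto)
    then show "continuous_map (subtopology (man_top M) (fst c)) S f" using c by simp
  next
    fix p assume "p \<in> topspace (man_top M)"
    then obtain U \<phi> where "(U, \<phi>) \<in> man_atlas M" "p \<in> U" using cover by auto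
    then show "\<exists>j. j \<in> man_atlas M \<and> p \<in> fst j \<and> f p = f p" by force
  qed auto
  have im: "U \<inter> f -` topspace S = U" if "(U, \<phi>) \<in> man_atlas M" for U \<phi>
    using cont chart_subset[OF charts[OF that]] by (auto simp: continuous_map_def)
  show ?thesis
    unfolding smooth_map_def using cont smooth im by (auto simp: lcs_manifold_def)
qed

lemma smooth_map_lcsD:
  assumes "smooth_map M (lcs_manifold S) f" "(U, \<phi>) \<in> man_atlas M" "U \<subseteq> points M"
  shows "smooth_on (man_model M) S (\<phi> ` U) (f \<circ> inv_into U \<phi>)"
proof -
  have "continuous_map (man_top M) S f" using assms by (simp add: smooth_map_def lcs_manifold_def)
  then have "U \<inter> f -` topspace S = U" using assms(3) by (auto simp: continuous_map_def)
  moreover have "smooth_on (man_model M) S (\<phi> ` (U \<inter> f -` topspace S)) (f \<circ> inv_into U \<phi>)"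
    using assms by (auto simp: smooth_map_def lcs_manifold_def)
  ultimately show ?thesis by simp
qed

section \<open>Euclidean balls\<close>

definition sqdist :: "nat \<Rightarrow> (nat \<Rightarrow> real) \<Rightarrow> (nat \<Rightarrow> real) \<Rightarrow> real"
  where "sqdist n x y = (\<Sum>i<n. (y i - x i)\<^sup>2)"

lemma sqdist_component: "i < n \<Longrightarrow> (y i - x i)\<^sup>2 \<le> sqdist n x y"
  unfolding sqdist_def by (rule member_le_sum) auto

lemma sqdist_continuous: "continuous_map (Euclidean_space n) euclideanreal (sqdist n x)"
proof -
  have "continuous_map (Euclidean_space n) euclideanreal (\<lambda>y. (y i - x i)\<^sup>2)" for i
    by (rule continuous_map_real_pow, rule continuous_map_diff, rule continuous_map_Euclidean_component, simp)
  then have "continuous_map (Euclidean_space n) euclideanreal (\<lambda>y. \<Sum>i<n. (y i - x i)\<^sup>2)"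
    by (intro continuous_map_sum) simp_all
  then show ?thesis unfolding sqdist_def[abs_def] .
qed

lemma sqdist_ball_subset:
  assumes x: "x \<in> topspace (Euclidean_space n)" and V: "openin (Euclidean_space n) V" "x \<in> V"
  shows "\<exists>r>0. \<forall>y\<in>topspace (Euclidean_space n). sqdist n x y \<le> r \<longrightarrow> y \<in> V"
proof -
  obtain O' where O': "openin (powertop_real UNIV) O'" "V = O' \<inter> {x. \<forall>i\<ge>n. x i = 0}"
    using V(1) by (auto simp: Euclidean_space_def openin_subtopology)
  have "x \<in> O'" using V(2) O'(2) by simp
  from product_topology_open_contains_basis[OF O'(1) this] obtain X where
    X: "x \<in> (\<Pi>\<^sub>E i\<in>UNIV. X i)" "\<And>i. openin euclideanreal (X i)" "finite {i. X i \<noteq> topspace euclideanreal}" "(\<Pi>\<^sub>E i\<in>UNIV. X i) \<subseteq> O'"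
    by blast
  have X: "\<And>i. x i \<in> X i" "\<And>i. open (X i)" "finite {i. X i \<noteq> UNIV}" "\<And>y. (\<And>i. y i \<in> X i) \<Longrightarrow> y \<in> O'"
    using X(1-3) by (auto simp: PiE_iff intro!: subsetD[OF X(4)])
  have "\<exists>e>0. ball (x i) e \<subseteq> X i" for i using X(1,2) open_contains_ball by blast
  then obtain e where e: "\<And>i. e i > 0" "\<And>i. ball (x i) (e i) \<subseteq> X i" by metis
  \<comment> \<open>The extra \<open>1\<close> keeps the minimum defined when all factors of the box are the whole line.\<close>
  define d where "d = Min (insert 1 (e ` {i. X i \<noteq> UNIV}))"
  have d: "d > 0" using e X(3) by (simp add: d_def)
  have "y \<in> V" if y: "y \<in> topspace (Euclidean_space n)" and le: "sqdist n x y \<le> (d / 2)\<^sup>2" for y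
  proof -
    have "y i \<in> X i" for i
    proof (cases "X i = UNIV")
      case False
      then have di: "d \<le> e i" using X(3) unfolding d_def by (intro Min_le) auto
      have "\<bar>y i - x i\<bar> \<le> d / 2"
      proof (cases "i < n")
        case True
        then have "(y i - x i)\<^sup>2 \<le> (d / 2)\<^sup>2" using sqdist_component le by (meson order_trans)
        then show ?thesis using d by (simp add: abs_le_square_iff[symmetric])
      next
        case False
        then show ?thesis using x y d by (simp add: topspace_Euclidean_space)
      qed
      then have "y i \<in> ball (x i) (e i)" using d di by (simp add: dist_real_def abs_minus_commute)
      then show ?thesis using e by blast
    qed simp
    then show ?thesis using X(4) y O'(2) by (auto simp: topspace_Euclidean_space)
  qed
  then show ?thesis using d by (intro exI[of _ "(d/2)\<^sup>2"]) auto
qed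

lemma sqdist_ball_compact:
  assumes x: "x \<in> topspace (Euclidean_space n)" and r: "r \<ge> 0"
  shows "compactin (Euclidean_space n) {y \<in> topspace (Euclidean_space n). sqdist n x y \<le> r}"
proof -
  let ?B = "\<Pi>\<^sub>E i\<in>UNIV. if i < n then {x i - sqrt r..x i + sqrt r} else {0}"
  have "compactin (powertop_real UNIV) ?B" unfolding compactin_PiE by auto
  moreover have "?B \<subseteq> {x. \<forall>i\<ge>n. x i = 0}"
  proof
    fix y assume "y \<in> ?B"
    then have "\<And>i. y i \<in> (if i < n then {x i - sqrt r..x i + sqrt r} else {0})" by (simp add: PiE_iff)
    then have "\<And>i. \<not> i < n \<Longrightarrow> y i \<in> {0}" by (metis (full_types))
    then show "y \<in> {x. \<forall>i\<ge>n. x i = 0}" by auto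
  qed
  ultimately have B: "compactin (Euclidean_space n) ?B"
    by (simp add: Euclidean_space_def compactin_subtopology)
  show ?thesis
  proof (rule closed_compactin[OF B])
    show "{y \<in> topspace (Euclidean_space n). sqdist n x y \<le> r} \<subseteq> ?B"
    proof
      fix y assume y: "y \<in> {y \<in> topspace (Euclidean_space n). sqdist n x y \<le> r}"
      have "y i \<in> (if i < n then {x i - sqrt r..x i + sqrt r} else {0})" for i
      proof (cases "i < n")
        case True
        then have "(y i - x i)\<^sup>2 \<le> r" using sqdist_component y by (smt (verit) mem_Collect_eq)
        then have "\<bar>y i - x i\<bar> \<le> sqrt r" by (simp add: real_le_rsqrt)
        then show ?thesis using True by (auto simp: abs_le_iff)
      next
        case False
        then show ?thesis using y by (simp add: topspace_Euclidean_space)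
      qed
      then show "y \<in> ?B" by (simp add: PiE_iff)
    qed
    have "closedin (Euclidean_space n) {y \<in> topspace (Euclidean_space n). sqdist n x y \<in> {..r}}"
      by (rule closedin_continuous_map_preimage[OF sqdist_continuous]) simp
    then show "closedin (Euclidean_space n) {y \<in> topspace (Euclidean_space n). sqdist n x y \<le> r}" by simp
  qed
qed

section \<open>Smooth functions on a finite-dimensional manifold\<close>

locale finite_dim_manifold =
  fixes n :: nat and P :: "('p, nat \<Rightarrow> real) manifold"
  assumes fin_dim: "fin_dim_manifold n P"
begin

abbreviation "E \<equiv> Euclidean_space n"

lemma smooth_P: "smooth_manifold P" and model [simp]: "man_model P = E"
  using fin_dim by (auto simp: fin_dim_manifold_def)

lemma lcs_E: "locally_convex_space E"
  using smooth_P by (simp add: smooth_manifold_def)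

lemma lines_E: "line_continuous E"
  by (rule line_continuous_lcs[OF lcs_E])

lemma Hausdorff_P: "Hausdorff_space (man_top P)"
  using smooth_P by (simp add: smooth_manifold_def)

lemma chartP: "(U, \<phi>) \<in> man_atlas P \<Longrightarrow> chart P U \<phi>"
  by (rule smooth_manifold_chart[OF smooth_P])

lemma coverP: "p \<in> points P \<Longrightarrow> \<exists>U \<phi>. (U, \<phi>) \<in> man_atlas P \<and> p \<in> U"
  using smooth_P unfolding smooth_manifold_def by blast

lemma chartP_image_open: "(U, \<phi>) \<in> man_atlas P \<Longrightarrow> openin (man_top P) W \<Longrightarrow> openin E (\<phi> ` (U \<inter> W))"
  using chart_image_open[OF chartP] by simp

lemma chartP_open: "(U, \<phi>) \<in> man_atlas P \<Longrightarrow> openin E (\<phi> ` U)"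
  using chartP by (fastforce simp: chart_def)

lemma smooth_functions_smooth_on:
  assumes "f \<in> smooth_functions P" "(U, \<phi>) \<in> man_atlas P"
  shows "smooth_on E euclidean (\<phi> ` U) (f \<circ> inv_into U \<phi>)"
  using assms smooth_map_lcsD[of P euclidean f U \<phi>] chart_subset[OF chartP[OF assms(2)]]
  by (simp add: smooth_functions_def)

lemma smooth_functions_zero: "f \<in> smooth_functions P \<Longrightarrow> p \<notin> points P \<Longrightarrow> f p = 0"
  by (simp add: smooth_functions_def)

text \<open>Local certificate of smoothness: near each point the function agrees in every chart with a member
of the algebra of smooth expressions.\<close>

lemma smooth_functionsI_local:
  assumes zero: "\<And>p. p \<notin> points P \<Longrightarrow> f p = 0"
    and loc: "\<And>p. p \<in> points P \<Longrightarrow> \<exists>N. openin (man_top P) N \<and> p \<in> N \<and>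
      (\<forall>(V, \<psi>)\<in>man_atlas P. \<exists>h. smooth_algebra n (\<psi> ` (V \<inter> N)) h \<and> (\<forall>q\<in>V \<inter> N. f q = h (\<psi> q)))"
  shows "f \<in> smooth_functions P"
proof -
  have "smooth_map P (lcs_manifold euclidean) f"
  proof (rule smooth_map_lcsI)
    show "points P \<subseteq> (\<Union>(U, \<phi>)\<in>man_atlas P. U)" using coverP by blast
    fix V \<psi> assume V: "(V, \<psi>) \<in> man_atlas P"
    then show "chart P V \<psi>" by (rule chartP)
    show "smooth_on (man_model P) euclidean (\<psi> ` V) (f \<circ> inv_into V \<psi>)"
    proof (rule smooth_on_local)
      show "\<psi> ` V \<subseteq> topspace (man_model P)" using chartP_open[OF V] openin_subset by simp
      fix x assume "x \<in> \<psi> ` V"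
      then obtain p where p: "p \<in> V" "x = \<psi> p" by auto
      then have "p \<in> points P" using chart_subset[OF chartP[OF V]] by auto
      from loc[OF this] obtain N h where N: "openin (man_top P) N" "p \<in> N"
        and h: "smooth_algebra n (\<psi> ` (V \<inter> N)) h" "\<And>q. q \<in> V \<inter> N \<Longrightarrow> f q = h (\<psi> q)"
        using V by blast
      have o: "openin E (\<psi> ` (V \<inter> N))" by (rule chartP_image_open[OF V N(1)])
      have "smooth_on E euclidean (\<psi> ` (V \<inter> N)) (f \<circ> inv_into V \<psi>)"
      proof (rule smooth_on_cong[OF lines_E o _ smooth_algebra_smooth_on[OF lcs_E o h(1)]])
        fix y assume "y \<in> \<psi> ` (V \<inter> N)"
        then show "h y = (f \<circ> inv_into V \<psi>) y" using h(2) chart_inv[OF chartP[OF V]] by auto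
      qed
      then show "\<exists>O'. openin (man_model P) O' \<and> x \<in> O' \<and> O' \<subseteq> \<psi> ` V \<and> smooth_on (man_model P) euclidean O' (f \<circ> inv_into V \<psi>)"
        using o p N by (intro exI[of _ "\<psi> ` (V \<inter> N)"]) auto
    qed
  qed
  then show ?thesis using zero by (simp add: smooth_functions_def)
qed

lemma smooth_functionsI:
  assumes zero: "\<And>p. p \<notin> points P \<Longrightarrow> f p = 0"
    and alg: "\<And>U \<phi>. (U, \<phi>) \<in> man_atlas P \<Longrightarrow> \<exists>h. smooth_algebra n (\<phi> ` U) h \<and> (\<forall>p\<in>U. f p = h (\<phi> p))"
  shows "f \<in> smooth_functions P"
proof (rule smooth_functionsI_local[OF zero])
  fix p assume "p \<in> points P"
  have "\<exists>h. smooth_algebra n (\<psi> ` (V \<inter> points P)) h \<and> (\<forall>q\<in>V \<inter> points P. f q = h (\<psi> q))"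
    if "(V, \<psi>) \<in> man_atlas P" for V \<psi>
    using alg[OF that] chart_subset[OF chartP[OF that]] by (simp add: inf.absorb1)
  then show "\<exists>N. openin (man_top P) N \<and> p \<in> N \<and> (\<forall>(V, \<psi>)\<in>man_atlas P.
      \<exists>h. smooth_algebra n (\<psi> ` (V \<inter> N)) h \<and> (\<forall>q\<in>V \<inter> N. f q = h (\<psi> q)))"
    using \<open>p \<in> points P\<close> by (intro exI[of _ "points P"]) auto
qed

lemma smooth_functions_smooth_algebra:
  assumes "f \<in> smooth_functions P" "(U, \<phi>) \<in> man_atlas P"
  shows "smooth_algebra n (\<phi> ` U) (\<lambda>x. f (inv_into U \<phi> x))"
  using smooth_algebra_base[OF smooth_functions_smooth_on[OF assms]] by (simp add: o_def)

lemma smooth_functions_add: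
  assumes "f \<in> smooth_functions P" "g \<in> smooth_functions P"
  shows "(\<lambda>p. f p + g p) \<in> smooth_functions P"
proof (rule smooth_functionsI)
  fix U \<phi> assume U: "(U, \<phi>) \<in> man_atlas P"
  show "\<exists>h. smooth_algebra n (\<phi> ` U) h \<and> (\<forall>p\<in>U. f p + g p = h (\<phi> p))"
    using chart_inv[OF chartP[OF U]] smooth_functions_smooth_algebra[OF assms(1) U] smooth_functions_smooth_algebra[OF assms(2) U]
    by (intro exI[of _ "\<lambda>x. f (inv_into U \<phi> x) + g (inv_into U \<phi> x)"] conjI smooth_algebra.add) auto
qed (simp add: assms smooth_functions_zero)

lemma smooth_functions_mult:
  assumes "f \<in> smooth_functions P" "g \<in> smooth_functions P"
  shows "(\<lambda>p. f p * g p) \<in> smooth_functions P"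
proof (rule smooth_functionsI)
  fix U \<phi> assume U: "(U, \<phi>) \<in> man_atlas P"
  show "\<exists>h. smooth_algebra n (\<phi> ` U) h \<and> (\<forall>p\<in>U. f p * g p = h (\<phi> p))"
    using chart_inv[OF chartP[OF U]] smooth_functions_smooth_algebra[OF assms(1) U] smooth_functions_smooth_algebra[OF assms(2) U]
    by (intro exI[of _ "\<lambda>x. f (inv_into U \<phi> x) * g (inv_into U \<phi> x)"] conjI smooth_algebra.mult) auto
qed (simp add: assms smooth_functions_zero)

lemma smooth_functions_cnj:
  assumes "f \<in> smooth_functions P"
  shows "(\<lambda>p. cnj (f p)) \<in> smooth_functions P"
proof (rule smooth_functionsI)
  fix U \<phi> assume U: "(U, \<phi>) \<in> man_atlas P"
  show "\<exists>h. smooth_algebra n (\<phi> ` U) h \<and> (\<forall>p\<in>U. cnj (f p) = h (\<phi> p))"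
    using chart_inv[OF chartP[OF U]] smooth_functions_smooth_algebra[OF assms(1) U]
    by (intro exI[of _ "\<lambda>x. cnj (f (inv_into U \<phi> x))"] conjI smooth_algebra.cnj) auto
qed (simp add: assms smooth_functions_zero)

lemma smooth_functions_const: "(\<lambda>p. if p \<in> points P then c else 0) \<in> smooth_functions P"
proof (rule smooth_functionsI)
  fix U \<phi> assume U: "(U, \<phi>) \<in> man_atlas P"
  show "\<exists>h. smooth_algebra n (\<phi> ` U) h \<and> (\<forall>p\<in>U. (if p \<in> points P then c else 0) = h (\<phi> p))"
    using chart_subset[OF chartP[OF U]] by (intro exI[of _ "\<lambda>x. c"] conjI smooth_algebra.const) auto
qed auto

lemma smooth_functions_scale:
  assumes "f \<in> smooth_functions P"
  shows "(\<lambda>p. c * f p) \<in> smooth_functions P"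
proof -
  have "(\<lambda>p. (if p \<in> points P then c else 0) * f p) \<in> smooth_functions P"
    by (rule smooth_functions_mult[OF smooth_functions_const assms])
  moreover have "(\<lambda>p. (if p \<in> points P then c else 0) * f p) = (\<lambda>p. c * f p)"
    using smooth_functions_zero[OF assms] by auto
  ultimately show ?thesis by simp
qed

lemma smooth_functions_inverse:
  assumes "f \<in> smooth_functions P" "\<And>p. p \<in> points P \<Longrightarrow> f p \<noteq> 0"
  shows "(\<lambda>p. if p \<in> points P then inverse (f p) else 0) \<in> smooth_functions P"
proof (rule smooth_functionsI)
  fix U \<phi> assume U: "(U, \<phi>) \<in> man_atlas P"
  show "\<exists>h. smooth_algebra n (\<phi> ` U) h \<and> (\<forall>p\<in>U. (if p \<in> points P then inverse (f p) else 0) = h (\<phi> p))"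
    using chart_inv[OF chartP[OF U]] smooth_functions_smooth_algebra[OF assms(1) U] assms(2) chart_subset[OF chartP[OF U]] chart_inv[OF chartP[OF U]]
    by (intro exI[of _ "\<lambda>x. inverse (f (inv_into U \<phi> x))"] conjI smooth_algebra.inverse) auto
qed auto

lemma smooth_functions_flat:
  assumes "f \<in> smooth_functions P"
  shows "(\<lambda>p. if p \<in> points P then complex_of_real (flat 0 (c - Re (f p))) else 0) \<in> smooth_functions P"
proof (rule smooth_functionsI)
  fix U \<phi> assume U: "(U, \<phi>) \<in> man_atlas P"
  have "smooth_algebra n (\<phi> ` U) (\<lambda>x. complex_of_real (flat 0 (Re (complex_of_real c + (- 1) * f (inv_into U \<phi> x)))))"
    by (intro smooth_algebra.intros(2-7) smooth_functions_smooth_algebra[OF assms U])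
  then show "\<exists>h. smooth_algebra n (\<phi> ` U) h \<and> (\<forall>p\<in>U. (if p \<in> points P then complex_of_real (flat 0 (c - Re (f p))) else 0) = h (\<phi> p))"
    using chart_subset[OF chartP[OF U]] chart_inv[OF chartP[OF U]]
    by (intro exI[of _ "\<lambda>x. complex_of_real (flat 0 (Re (complex_of_real c + (- 1) * f (inv_into U \<phi> x))))"]) auto
qed auto

section \<open>Cut-off functions\<close>

text \<open>The coordinates of one chart, read in another, are components of a transition map.\<close>

lemma coordinate_algebra:
  assumes "(U, \<phi>) \<in> man_atlas P" "(V, \<psi>) \<in> man_atlas P"
  shows "smooth_algebra n (\<psi> ` (V \<inter> U)) (\<lambda>y. complex_of_real (\<phi> (inv_into V \<psi> y) i))"
proof (rule smooth_algebra_base)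
  have o: "openin E (\<psi> ` (V \<inter> U))"
    using chartP_image_open[OF assms(2)] chartP[OF assms(1)] by (simp add: chart_def)
  have "smooth_on E E (\<psi> ` (V \<inter> U)) (\<phi> \<circ> inv_into V \<psi>)"
    using smooth_P assms unfolding smooth_manifold_def by fastforce
  from smooth_on_linear_compose[OF lines_E o _ _ _ _ this, where L = "\<lambda>x. complex_of_real (x i)" and S' = euclidean]
  show "smooth_on E euclidean (\<psi> ` (V \<inter> U)) (\<lambda>y. complex_of_real (\<phi> (inv_into V \<psi> y) i))"
    using continuous_map_euclidean_compose[OF continuous_map_Euclidean_component, of complex_of_real n i]
    by (auto simp: Hausdorff_Euclidean_space linear_iff scaleR_conv_of_real intro: continuous_intros)
qed

text \<open>With \<open>s\<close> the squared distance from \<open>p0\<close> in a chart, the quotient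
\<open>flat 0 (r - s) / (flat 0 (r - s) + flat 0 (s - r / 2))\<close> is \<open>1\<close> for \<open>s \<le> r / 2\<close> and \<open>0\<close> for \<open>s \<ge> r\<close>.
The extension by zero is smooth because the closed ball \<open>K\<close> is compact, hence closed in the Hausdorff space
\<open>P\<close>, so that the function vanishes on the open complement of \<open>K\<close>.\<close>

lemma cutoff_exists:
  assumes W: "openin (man_top P) W" and p0: "p0 \<in> W"
  shows "\<exists>\<theta> N K. \<theta> \<in> smooth_functions P \<and> openin (man_top P) N \<and> p0 \<in> N \<and> closedin (man_top P) K \<and>
    N \<subseteq> K \<and> K \<subseteq> W \<and> (\<forall>p\<in>N. \<theta> p = 1) \<and> (\<forall>p. p \<notin> K \<longrightarrow> \<theta> p = 0)"
proof -
  have "p0 \<in> points P" using W p0 openin_subset by blast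
  then obtain U \<phi> where U: "(U, \<phi>) \<in> man_atlas P" "p0 \<in> U" using coverP by blast
  note ch = chartP[OF U(1)]
  note inv = chart_inv[OF ch]
  define x0 where "x0 = \<phi> p0"
  have o: "openin E (\<phi> ` (U \<inter> W))" by (rule chartP_image_open[OF U(1) W])
  have x0: "x0 \<in> \<phi> ` (U \<inter> W)" using U p0 by (auto simp: x0_def)
  then have x0E: "x0 \<in> topspace E" using o openin_subset by blast
  obtain r where r: "r > 0" "\<And>y. y \<in> topspace E \<Longrightarrow> sqdist n x0 y \<le> r \<Longrightarrow> y \<in> \<phi> ` (U \<inter> W)"
    using sqdist_ball_subset[OF x0E o x0] by blast
  define s where "s p = sqdist n x0 (\<phi> p)" for p
  define N where "N = {p \<in> U. s p < r / 2}"
  define K where "K = {p \<in> U. s p \<le> r}"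
  define \<theta> where "\<theta> p = (if p \<in> U then complex_of_real (flat 0 (r - s p) / (flat 0 (r - s p) + flat 0 (s p - r / 2))) else 0)" for p
  have \<phi>E: "\<phi> p \<in> topspace E" if "p \<in> U" for p using chartP_open[OF U(1)] openin_subset that by blast
  have KW: "K \<subseteq> W"
  proof
    fix p assume p: "p \<in> K"
    then have "\<phi> p \<in> \<phi> ` (U \<inter> W)" using r(2)[of "\<phi> p"] \<phi>E by (auto simp: K_def s_def)
    then obtain q where q: "q \<in> U" "q \<in> W" "\<phi> p = \<phi> q" by auto
    then have "p = q" using inv[of p] inv[of q] p by (simp add: K_def)
    then show "p \<in> W" using q by simp
  qed
  have K_im: "K = inv_into U \<phi> ` {y \<in> topspace E. sqdist n x0 y \<le> r}"
  proof
    show "K \<subseteq> inv_into U \<phi> ` {y \<in> topspace E. sqdist n x0 y \<le> r}"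
    proof
      fix p assume "p \<in> K"
      then have "p = inv_into U \<phi> (\<phi> p)" "\<phi> p \<in> {y \<in> topspace E. sqdist n x0 y \<le> r}"
        using inv \<phi>E by (auto simp: K_def s_def)
      then show "p \<in> inv_into U \<phi> ` {y \<in> topspace E. sqdist n x0 y \<le> r}" by (rule image_eqI)
    qed
    show "inv_into U \<phi> ` {y \<in> topspace E. sqdist n x0 y \<le> r} \<subseteq> K"
    proof (rule image_subsetI)
      fix x assume x: "x \<in> {y \<in> topspace E. sqdist n x0 y \<le> r}"
      then obtain p where "p \<in> U" "x = \<phi> p" using r(2)[of x] by auto
      then show "inv_into U \<phi> x \<in> K" using x inv[of p] by (simp add: K_def s_def)
    qed
  qed
  have "compactin (subtopology E (\<phi> ` U)) {y \<in> topspace E. sqdist n x0 y \<le> r}"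
    using sqdist_ball_compact[OF x0E, of r] r by (auto simp: compactin_subtopology)
  from image_compactin[OF this] chart_inv_continuous[OF ch]
  have "compactin (man_top P) K" unfolding K_im by simp
  then have K: "closedin (man_top P) K" using Hausdorff_P by (rule compactin_imp_closedin[rotated])
  have "continuous_map (subtopology (man_top P) U) euclideanreal (sqdist n x0 \<circ> \<phi>)"
    by (rule continuous_map_compose[OF chart_continuous[OF ch]]) (simp add: sqdist_continuous)
  then have "continuous_map (subtopology (man_top P) U) euclideanreal s"
    by (simp add: o_def s_def[abs_def])
  then have "openin (subtopology (man_top P) U) {p \<in> topspace (subtopology (man_top P) U). s p \<in> {..<r/2}}"
    by (rule openin_continuous_map_preimage) simp
  moreover have "{p \<in> topspace (subtopology (man_top P) U). s p \<in> {..<r/2}} = N"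
    using chart_subset[OF ch] by (auto simp: N_def)
  ultimately have N: "openin (man_top P) N"
    using ch unfolding chart_def by (auto intro: openin_trans_full)
  have den: "flat 0 (r - s p) + flat 0 (s p - r / 2) \<noteq> 0" for p
  proof -
    have "r - s p > 0 \<or> s p - r / 2 > 0" using r by auto
    then show ?thesis using flat_pos[of _ 0] flat_nonneg[of 0] by (smt (verit))
  qed
  have "\<theta> \<in> smooth_functions P"
  proof (rule smooth_functionsI_local)
    show "\<theta> p = 0" if "p \<notin> points P" for p using that chart_subset[OF ch] by (auto simp: \<theta>_def)
    fix p assume p: "p \<in> points P"
    show "\<exists>N. openin (man_top P) N \<and> p \<in> N \<and>
      (\<forall>(V, \<psi>)\<in>man_atlas P. \<exists>h. smooth_algebra n (\<psi> ` (V \<inter> N)) h \<and> (\<forall>q\<in>V \<inter> N. \<theta> q = h (\<psi> q)))"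
    proof (cases "p \<in> U")
      case True
      have "\<exists>h. smooth_algebra n (\<psi> ` (V \<inter> U)) h \<and> (\<forall>q\<in>V \<inter> U. \<theta> q = h (\<psi> q))"
        if V: "(V, \<psi>) \<in> man_atlas P" for V \<psi>
      proof -
        \<comment> \<open>\<open>S\<close> is the squared distance \<open>s\<close> read in the chart \<open>\<psi>\<close>.\<close>
        define S where "S y = (\<Sum>i<n. (complex_of_real (\<phi> (inv_into V \<psi> y) i) + complex_of_real (- x0 i)) *
          (complex_of_real (\<phi> (inv_into V \<psi> y) i) + complex_of_real (- x0 i)))" for y
        have S: "smooth_algebra n (\<psi> ` (V \<inter> U)) S"
          unfolding S_def by (intro smooth_algebra_sum smooth_algebra.add smooth_algebra.mult coordinate_algebra[OF U(1) V] smooth_algebra.const)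
        have S_eq: "S (\<psi> q) = complex_of_real (s q)" if "q \<in> V" for q
          using chart_inv[OF chartP[OF V] that] by (simp add: S_def s_def sqdist_def power2_eq_square)
        define h where "h y = complex_of_real (flat 0 (Re (complex_of_real r + (- 1) * S y))) *
          inverse (complex_of_real (flat 0 (Re (complex_of_real r + (- 1) * S y))) +
            complex_of_real (flat 0 (Re (S y + complex_of_real (- r / 2)))))" for y
        have "smooth_algebra n (\<psi> ` (V \<inter> U)) h"
          unfolding h_def
        proof (intro smooth_algebra.mult smooth_algebra.inverse smooth_algebra.flat smooth_algebra.add smooth_algebra.const S)
          fix y assume "y \<in> \<psi> ` (V \<inter> U)"
          then obtain q where q: "q \<in> V" "y = \<psi> q" by auto
          have "Re (complex_of_real r + - 1 * S y) = r - s q" "Re (S y + complex_of_real (- r / 2)) = s q - r / 2"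
            unfolding q(2) S_eq[OF q(1)] by simp_all
          then show "complex_of_real (flat 0 (Re (complex_of_real r + - 1 * S y))) + complex_of_real (flat 0 (Re (S y + complex_of_real (- r / 2)))) \<noteq> 0"
            using den[of q] by (simp only: of_real_add[symmetric] of_real_eq_0_iff not_False_eq_True)
        qed
        moreover have "\<theta> q = h (\<psi> q)" if q: "q \<in> V \<inter> U" for q
        proof -
          have "Re (complex_of_real r + - 1 * S (\<psi> q)) = r - s q" "Re (S (\<psi> q) + complex_of_real (- r / 2)) = s q - r / 2"
            using q S_eq[of q] by simp_all
          then show ?thesis using q
            by (simp only: \<theta>_def h_def divide_inverse of_real_mult of_real_inverse of_real_add if_True IntD2)
        qed
        ultimately show ?thesis by blast
      qed
      then show ?thesis using True ch by (intro exI[of _ U]) (auto simp: chart_def)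
    next
      case False
      have "\<theta> q = 0" if "q \<notin> K" for q
        using that by (auto simp: \<theta>_def K_def flat_zero)
      then have "\<exists>h. smooth_algebra n (\<psi> ` (V \<inter> (points P - K))) h \<and> (\<forall>q\<in>V \<inter> (points P - K). \<theta> q = h (\<psi> q))" for V \<psi>
        by (intro exI[of _ "\<lambda>_. 0"]) (auto intro: smooth_algebra.const)
      then show ?thesis using False p K by (intro exI[of _ "points P - K"]) (auto simp: K_def)
    qed
  qed
  moreover have "\<theta> p = 1" if "p \<in> N" for p
    using that den[of p] by (simp add: \<theta>_def N_def flat_zero)
  moreover have "\<theta> p = 0" if "p \<notin> K" for p
    using that by (auto simp: \<theta>_def K_def flat_zero)
  moreover have "p0 \<in> N" using U r by (simp add: N_def s_def x0_def sqdist_def)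
  moreover have "N \<subseteq> K" using r by (auto simp: N_def K_def)
  ultimately show ?thesis using N K KW by blast
qed

text \<open>Globally defined smooth functions that agree near \<open>p0\<close> with the coordinates of a chart. They
allow smoothness of a map into \<open>P\<close> to be tested by composing with elements of the algebra.\<close>

lemma cutoff_coordinate:
  assumes U: "(U, \<phi>) \<in> man_atlas P" and p0: "p0 \<in> U"
  shows "\<exists>f N. openin (man_top P) N \<and> p0 \<in> N \<and> N \<subseteq> U \<and>
    (\<forall>i. f i \<in> smooth_functions P \<and> (\<forall>p\<in>N. f i p = complex_of_real (\<phi> p i)))"
proof -
  have ch: "chart P U \<phi>" by (rule chartP[OF U])
  then have "openin (man_top P) U" by (simp add: chart_def)
  from cutoff_exists[OF this p0]
  obtain \<theta> N K where \<theta>: "\<theta> \<in> smooth_functions P" and N: "openin (man_top P) N" "p0 \<in> N"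
    and K: "closedin (man_top P) K" "N \<subseteq> K" "K \<subseteq> U" and \<theta>1: "\<And>p. p \<in> N \<Longrightarrow> \<theta> p = 1" and \<theta>0: "\<And>p. p \<notin> K \<Longrightarrow> \<theta> p = 0"
    by blast
  define f where "f i p = (if p \<in> U then \<theta> p * complex_of_real (\<phi> p i) else 0)" for i p
  have "f i \<in> smooth_functions P" for i
  proof (rule smooth_functionsI_local)
    show "f i p = 0" if "p \<notin> points P" for p using that chart_subset[OF ch] by (auto simp: f_def)
    fix p assume p: "p \<in> points P"
    show "\<exists>N. openin (man_top P) N \<and> p \<in> N \<and>
      (\<forall>(V, \<psi>)\<in>man_atlas P. \<exists>h. smooth_algebra n (\<psi> ` (V \<inter> N)) h \<and> (\<forall>q\<in>V \<inter> N. f i q = h (\<psi> q)))"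
    proof (cases "p \<in> U")
      case True
      have "\<exists>h. smooth_algebra n (\<psi> ` (V \<inter> U)) h \<and> (\<forall>q\<in>V \<inter> U. f i q = h (\<psi> q))"
        if V: "(V, \<psi>) \<in> man_atlas P" for V \<psi>
      proof -
        have "smooth_on E euclidean (\<psi> ` (V \<inter> U)) (\<theta> \<circ> inv_into V \<psi>)"
          by (rule smooth_on_subset[OF smooth_functions_smooth_on[OF \<theta> V]]) auto
        then have "smooth_algebra n (\<psi> ` (V \<inter> U)) (\<lambda>y. (\<theta> \<circ> inv_into V \<psi>) y * complex_of_real (\<phi> (inv_into V \<psi> y) i))"
          by (intro smooth_algebra.mult coordinate_algebra[OF U V] smooth_algebra_base)
        then show ?thesis using chart_inv[OF chartP[OF V]]
          by (intro exI[of _ "\<lambda>y. (\<theta> \<circ> inv_into V \<psi>) y * complex_of_real (\<phi> (inv_into V \<psi> y) i)"]) (simp add: f_def)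
      qed
      then show ?thesis using True ch by (intro exI[of _ U]) (auto simp: chart_def)
    next
      case False
      have "\<exists>h. smooth_algebra n (\<psi> ` (V \<inter> (points P - K))) h \<and> (\<forall>q\<in>V \<inter> (points P - K). f i q = h (\<psi> q))" for V \<psi>
        using \<theta>0 by (intro exI[of _ "\<lambda>_. 0"]) (auto intro: smooth_algebra.const simp: f_def)
      then show ?thesis using False p K by (intro exI[of _ "points P - K"]) auto
    qed
  qed
  then show ?thesis using N K \<theta>1 by (intro exI[of _ f] exI[of _ N]) (auto simp: f_def subset_iff)
qed

lemma topspace_smooth_compact_open [simp]: "topspace (smooth_compact_open P) = smooth_functions P"
  unfolding smooth_compact_open_def topology_generated_by_topspace by blast

lemma carrier_C_infinity [simp]: "alg_carrier (C_infinity P) = smooth_functions P"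
  by (simp add: C_infinity_def)

text \<open>A cut-off function that is \<open>1\<close> at \<open>p\<close> and supported away from \<open>q\<close> separates the two points.\<close>

lemma delta_inj: "inj_on (delta P) (points P)"
proof (rule inj_onI, rule ccontr)
  fix p q assume pq: "p \<in> points P" "q \<in> points P" "delta P p = delta P q" "p \<noteq> q"
  then obtain W where W: "openin (man_top P) W" "p \<in> W" "q \<notin> W"
    using Hausdorff_P unfolding Hausdorff_space_def by (metis disjnt_iff)
  obtain \<theta> N K where \<theta>: "\<theta> \<in> smooth_functions P" and N: "p \<in> N" "N \<subseteq> K" "K \<subseteq> W"
      "\<forall>p\<in>N. \<theta> p = 1" "\<forall>p. p \<notin> K \<longrightarrow> \<theta> p = 0"
    using cutoff_exists[OF W(1,2)] by blast
  have "\<theta> p = 1" "\<theta> q = 0" using N W by auto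
  then show False using pq(3) \<theta> by (auto simp: delta_def restrict_def fun_eq_iff dest!: spec[of _ \<theta>])
qed

section \<open>Continuous characters are point evaluations\<close>

definition functions_vanishing_near :: "'p set \<Rightarrow> ('p \<Rightarrow> complex) set"
  where "functions_vanishing_near L =
    {f \<in> smooth_functions P. \<exists>N. openin (man_top P) N \<and> L \<subseteq> N \<and> (\<forall>p\<in>N. f p = 0)}"

lemma functions_vanishing_near_mono:
  "L \<subseteq> L' \<Longrightarrow> functions_vanishing_near L' \<subseteq> functions_vanishing_near L"
proof
  fix f assume L: "L \<subseteq> L'" and "f \<in> functions_vanishing_near L'"
  then obtain N where "f \<in> smooth_functions P" "openin (man_top P) N" "L' \<subseteq> N" "\<forall>p\<in>N. f p = 0"
    by (auto simp: functions_vanishing_near_def)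
  with L have "f \<in> smooth_functions P \<and> (\<exists>N. openin (man_top P) N \<and> L \<subseteq> N \<and> (\<forall>p\<in>N. f p = 0))"
    by (intro conjI exI[of _ N]) auto
  then show "f \<in> functions_vanishing_near L" by (simp add: functions_vanishing_near_def)
qed

text \<open>A subbasic neighbourhood constrains a function only on one compact subset of a chart, where the derivatives
of a function vanishing nearby are zero. Finite intersections correspond to finite unions of compact sets.\<close>

lemma neighbourhood_of_zero_contains_vanishing_near:
  assumes W: "openin (smooth_compact_open P) W" and zero: "(\<lambda>_. 0) \<in> W"
  shows "\<exists>L. compactin (man_top P) L \<and> functions_vanishing_near L \<subseteq> W"
  using openin_topology_generated_by[OF W[unfolded smooth_compact_open_def]] zero
proof induction
  case (Int a b)
  then obtain L L' where L: "compactin (man_top P) L" "functions_vanishing_near L \<subseteq> a"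
    and L': "compactin (man_top P) L'" "functions_vanishing_near L' \<subseteq> b" by auto
  show ?case
  proof (intro exI[of _ "L \<union> L'"] conjI)
    show "compactin (man_top P) (L \<union> L')" using L(1) L'(1) by (rule compactin_Un)
    show "functions_vanishing_near (L \<union> L') \<subseteq> a \<inter> b"
      using functions_vanishing_near_mono[of L "L \<union> L'"] functions_vanishing_near_mono[of L' "L \<union> L'"] L(2) L'(2)
      by (meson Int_greatest Un_upper1 Un_upper2 subset_trans)
  qed
next
  case (UN K)
  then obtain k where k: "k \<in> K" "(\<lambda>_. 0) \<in> k" by auto
  from UN.IH[OF this] k(1) show ?case by (meson Union_upper subset_trans)
next
  case (Basis s)
  from Basis.hyps consider "s = smooth_functions P" | f U \<phi> K k v \<epsilon> where
    "s = {g \<in> smooth_functions P. \<forall>x\<in>K.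
        cmod (iter_deriv euclidean (g \<circ> inv_into U \<phi>) k v x
            - iter_deriv euclidean (f \<circ> inv_into U \<phi>) k v x) < \<epsilon>}" "(U, \<phi>) \<in> man_atlas P"
      "compactin (man_model P) K" "K \<subseteq> \<phi> ` U" "v \<in> {..<k} \<rightarrow>\<^sub>E topspace (man_model P)"
    by (elim insertE CollectE exE conjE) (rule that(1), assumption, rule that(2), assumption+)
  then show ?case
  proof cases
    case 1
    then show ?thesis by (intro exI[of _ "{}"]) (simp add: functions_vanishing_near_def)
  next
    case 2
    note ch = chartP[OF 2(2)]
    have "compactin (subtopology E (\<phi> ` U)) K" using 2(3,4) by (simp add: compactin_subtopology)
    then have L: "compactin (man_top P) (inv_into U \<phi> ` K)"
      using image_compactin chart_inv_continuous[OF ch] by simp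
    have gs: "g \<in> s" if g: "g \<in> smooth_functions P" and N: "openin (man_top P) N" "inv_into U \<phi> ` K \<subseteq> N"
        and g0: "\<And>p. p \<in> N \<Longrightarrow> g p = 0" for g N
    proof -
      have "iter_deriv euclidean (g \<circ> inv_into U \<phi>) k v x = iter_deriv euclidean ((\<lambda>_. 0) \<circ> inv_into U \<phi>) k v x"
        if x: "x \<in> K" for x
      proof (rule iter_deriv_cong[OF lines_E chartP_image_open[OF 2(2) N(1)]])
        show "v \<in> {..<k} \<rightarrow> topspace E" using 2(5) by (auto simp: PiE_iff)
        obtain p where p: "p \<in> U" "x = \<phi> p" using x 2(4) by auto
        then have "p \<in> N" using N(2) x chart_inv[OF ch] by force
        then show "x \<in> \<phi> ` (U \<inter> N)" using p by auto
        fix y assume "y \<in> \<phi> ` (U \<inter> N)"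
        then show "(g \<circ> inv_into U \<phi>) y = ((\<lambda>_. 0) \<circ> inv_into U \<phi>) y"
          using g0 chart_inv[OF ch] by auto
      qed auto
      then show ?thesis using Basis.prems g unfolding 2(1) by simp
    qed
    then have "functions_vanishing_near (inv_into U \<phi> ` K) \<subseteq> s"
      unfolding functions_vanishing_near_def by auto
    then show ?thesis using L by (intro exI[of _ "inv_into U \<phi> ` K"] conjI)
  qed
qed simp

text \<open>A unital character cannot vanish on an invertible element; the proof constructs one in the kernel
if no point of the compact set \<open>L\<close> represents the character.\<close>

lemma continuous_character_is_evaluation:
  fixes \<eta> :: "('p \<Rightarrow> complex) \<Rightarrow> complex"
  assumes add: "\<And>f g. f \<in> smooth_functions P \<Longrightarrow> g \<in> smooth_functions P \<Longrightarrow> \<eta> (\<lambda>p. f p + g p) = \<eta> f + \<eta> g"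
    and mult: "\<And>f g. f \<in> smooth_functions P \<Longrightarrow> g \<in> smooth_functions P \<Longrightarrow> \<eta> (\<lambda>p. f p * g p) = \<eta> f * \<eta> g"
    and scale: "\<And>c f. f \<in> smooth_functions P \<Longrightarrow> \<eta> (\<lambda>p. c * f p) = c * \<eta> f"
    and one: "\<eta> (\<lambda>p. if p \<in> points P then 1 else 0) = 1"
    and cont: "continuous_map (smooth_compact_open P) euclidean \<eta>"
  shows "\<exists>p\<in>points P. \<forall>f\<in>smooth_functions P. \<eta> f = f p"
proof -
  let ?one = "\<lambda>p. if p \<in> points P then 1 else (0::complex)"
  have one_smooth: "?one \<in> smooth_functions P" by (rule smooth_functions_const)
  note scale_smooth = smooth_functions_scale
  have zero_smooth: "(\<lambda>_. 0) \<in> smooth_functions P" using scale_smooth[OF one_smooth, of 0] by simp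
  have zero: "\<eta> (\<lambda>_. 0) = 0" using scale[OF one_smooth, of 0] by simp
  have "openin (smooth_compact_open P) {f \<in> topspace (smooth_compact_open P). \<eta> f \<in> ball 0 1}"
    by (rule openin_continuous_map_preimage[OF cont]) simp
  moreover have "(\<lambda>_. 0) \<in> {f \<in> topspace (smooth_compact_open P). \<eta> f \<in> ball 0 1}"
    using zero zero_smooth by simp
  ultimately obtain L where L: "compactin (man_top P) L"
    and L_sub: "functions_vanishing_near L \<subseteq> {f \<in> topspace (smooth_compact_open P). \<eta> f \<in> ball 0 1}"
    using neighbourhood_of_zero_contains_vanishing_near by blast
  have L_small: "cmod (\<eta> f) < 1" if "f \<in> functions_vanishing_near L" for f
    using subsetD[OF L_sub that] by simp
  \<comment> \<open>Smallness on all scalar multiples forces the value \<open>0\<close>.\<close>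
  have supp: "\<eta> f = 0" if f: "f\<in>smooth_functions P" "openin (man_top P) N" "L \<subseteq> N" "\<And>p. p\<in>N \<Longrightarrow> f p = 0" for f N
  proof (rule ccontr)
    assume nz: "\<eta> f \<noteq> 0"
    have "cmod (\<eta> (\<lambda>p. inverse (\<eta> f) * f p)) < 1"
      using scale_smooth[OF f(1)] f(2-4) by (intro L_small) (auto simp: functions_vanishing_near_def)
    then show False using nz by (simp add: scale[OF f(1)])
  qed
  have "\<exists>p\<in>L. \<forall>f\<in>smooth_functions P. \<eta> f = 0 \<longrightarrow> f p = 0"
  proof (rule ccontr)
    assume "\<not> ?thesis"
    then obtain F where F: "\<And>p. p \<in> L \<Longrightarrow> F p \<in> smooth_functions P" "\<And>p. p \<in> L \<Longrightarrow> \<eta> (F p) = 0" "\<And>p. p \<in> L \<Longrightarrow> F p p \<noteq> 0"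
      by metis
    have cont_sf: "continuous_map (man_top P) euclidean f" if "f \<in> smooth_functions P" for f
      using that by (simp add: smooth_functions_def smooth_map_def lcs_manifold_def)
    have LP: "L \<subseteq> points P" using L by (rule compactin_subset_topspace)
    define V where "V p = {q \<in> points P. F p q \<in> - {0}}" for p
    have V: "openin (man_top P) (V p)" if "p \<in> L" for p
      unfolding V_def by (rule openin_continuous_map_preimage[OF cont_sf[OF F(1)[OF that]]]) auto
    have "L \<subseteq> \<Union>(V ` L)" using F(3) LP by (auto simp: V_def)
    with compactinD[OF L, of "V ` L"] V obtain \<F> where \<F>: "finite \<F>" "\<F> \<subseteq> V ` L" "L \<subseteq> \<Union>\<F>"
      by blast
    from finite_subset_image[OF \<F>(1,2)] obtain A where A: "finite A" "A \<subseteq> L" "L \<subseteq> \<Union>(V ` A)"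
      using \<F>(3) by auto
    have ex: "\<exists>h\<in>smooth_functions P. \<eta> h = 0 \<and> (\<forall>q. Re (h q) \<ge> 0 \<and> Im (h q) = 0) \<and> (\<forall>q\<in>\<Union>(V ` A). Re (h q) > 0)"
      using A(1,2)
    proof (induction A rule: finite_induct)
      case empty
      show ?case by (rule bexI[OF _ zero_smooth]) (simp add: zero)
    next
      case (insert a A)
      then have "A \<subseteq> L" by simp
      from insert.IH[OF this] obtain h where h: "h\<in>smooth_functions P" "\<eta> h = 0" "\<And>q. Re (h q) \<ge> 0" "\<And>q. Im (h q) = 0" "\<And>q. q\<in>\<Union>(V ` A) \<Longrightarrow> Re (h q) > 0"
        by blast
      have aL: "a \<in> L" using insert.prems by auto
      let ?g = "\<lambda>p. cnj (F a p) * F a p"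
      have g: "?g \<in> smooth_functions P" by (intro smooth_functions_mult smooth_functions_cnj F(1)[OF aL])
      have g0: "\<eta> ?g = 0" using mult[OF smooth_functions_cnj[OF F(1)[OF aL]] F(1)[OF aL]] F(2)[OF aL] by simp
      have gq: "?g q = complex_of_real ((cmod (F a q))\<^sup>2)" for q
        using complex_norm_square[of "F a q"] by (simp add: mult.commute)
      show ?case
      proof (rule bexI[OF _ smooth_functions_add[OF h(1) g]], intro conjI allI ballI)
        show "\<eta> (\<lambda>p. h p + ?g p) = 0" using add[OF h(1) g] h(2) g0 by simp
        show "0 \<le> Re (h q + ?g q)" for q unfolding gq using h(3)[of q] by simp
        show "Im (h q + ?g q) = 0" for q unfolding gq using h(4)[of q] by simp
        fix q assume "q \<in> \<Union>(V ` insert a A)"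
        then consider "q \<in> V a" | "q \<in> \<Union>(V ` A)" by auto
        then show "0 < Re (h q + ?g q)"
        proof cases
          case 1
          then have "(cmod (F a q))\<^sup>2 > 0" by (simp add: V_def)
          then show ?thesis unfolding gq using h(3)[of q] by (simp only: plus_complex.sel Re_complex_of_real add_nonneg_pos)
        next
          case 2
          then show ?thesis unfolding gq using h(5)[of q] by (simp add: add_pos_nonneg)
        qed
      qed
    qed
    then obtain h where h: "h\<in>smooth_functions P" "\<eta> h = 0" "\<And>q. Re (h q) \<ge> 0" "\<And>q. Im (h q) = 0" "\<And>q. q\<in>\<Union>(V ` A) \<Longrightarrow> Re (h q) > 0"
      by blast
    have h_cont: "continuous_map (man_top P) euclideanreal (\<lambda>q. Re (h q))"
      by (rule continuous_map_euclidean_compose[OF cont_sf[OF h(1)]]) (intro continuous_intros)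
    have "\<exists>c>0. \<forall>q\<in>L. c < Re (h q)"
    proof (cases "L = {}")
      case True
      then show ?thesis by (intro exI[of _ 1]) auto
    next
      case False
      have "compactin euclideanreal ((\<lambda>q. Re (h q)) ` L)" by (rule image_compactin[OF L h_cont])
      then have "compact ((\<lambda>q. Re (h q)) ` L)" by simp
      from compact_attains_inf[OF this] False obtain q where q: "q \<in> L" "\<And>p. p \<in> L \<Longrightarrow> Re (h q) \<le> Re (h p)"
        by auto
      have "Re (h q) > 0" using q(1) A(3) h(5) by blast
      then show ?thesis using q by (intro exI[of _ "Re (h q) / 2"]) force
    qed
    then obtain c where c: "c > 0" "\<And>q. q \<in> L \<Longrightarrow> c < Re (h q)" by blast
    \<comment> \<open>\<open>\<rho>\<close> vanishes where \<open>h > c\<close>, hence near \<open>L\<close>, and is positive where \<open>h < c\<close>.\<close>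
    define \<rho> where "\<rho> p = (if p \<in> points P then complex_of_real (flat 0 (c - Re (h p))) else 0)" for p
    have \<rho>: "\<rho> \<in> smooth_functions P" unfolding \<rho>_def[abs_def] by (rule smooth_functions_flat[OF h(1)])
    have "openin (man_top P) {q \<in> points P. Re (h q) \<in> {c<..}}"
      by (rule openin_continuous_map_preimage[OF h_cont]) simp
    then have \<rho>0: "\<eta> \<rho> = 0"
      by (rule supp[OF \<rho>]) (use c LP in \<open>auto simp: \<rho>_def flat_zero\<close>)
    define u where "u p = h p + \<rho> p" for p
    have u: "u \<in> smooth_functions P" unfolding u_def[abs_def] by (rule smooth_functions_add[OF h(1) \<rho>])
    have u0: "\<eta> u = 0" unfolding u_def[abs_def] using add[OF h(1) \<rho>] h(2) \<rho>0 by simp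
    have unz: "u p \<noteq> 0" if "p \<in> points P" for p
    proof -
      have "Re (u p) > 0"
      proof (cases "Re (h p) < c")
        case True
        then have "flat 0 (c - Re (h p)) > 0" by (intro flat_pos) simp
        then show ?thesis using that h(3)[of p] by (simp add: u_def \<rho>_def)
      next
        case False
        then show ?thesis using that c(1) flat_nonneg[of 0 "c - Re (h p)"] by (simp add: u_def \<rho>_def)
      qed
      then show ?thesis by auto
    qed
    let ?w = "\<lambda>p. if p \<in> points P then inverse (u p) else 0"
    have w: "?w \<in> smooth_functions P" by (rule smooth_functions_inverse[OF u unz])
    have "(\<lambda>p. u p * ?w p) = ?one" using unz by auto
    then show False using mult[OF u w] u0 one by simp
  qed
  then obtain p where p: "p \<in> L" "\<And>f. f\<in>smooth_functions P \<Longrightarrow> \<eta> f = 0 \<Longrightarrow> f p = 0" by blast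
  have pP: "p \<in> points P" using p(1) compactin_subset_topspace[OF L] by blast
  have "\<eta> f = f p" if f: "f \<in> smooth_functions P" for f
  proof -
    \<comment> \<open>Subtracting its value from \<open>f\<close> puts it into the kernel.\<close>
    let ?g = "\<lambda>q. f q + (- \<eta> f) * ?one q"
    have c1: "(\<lambda>q. (- \<eta> f) * ?one q) \<in> smooth_functions P" by (rule scale_smooth[OF one_smooth])
    have "\<eta> ?g = \<eta> f + (- \<eta> f) * \<eta> ?one"
      unfolding add[OF f c1] scale[OF one_smooth] ..
    then have "\<eta> ?g = 0" using one by simp
    from p(2)[OF smooth_functions_add[OF f c1] this] show ?thesis using pP by simp
  qed
  then show ?thesis using pP by blast
qed

section \<open>Smoothness of evaluation\<close>

abbreviation "C \<equiv> smooth_compact_open P"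

text \<open>On a compact neighbourhood \<open>K\<close> of \<open>x0\<close> the derivative of \<open>f\<close> is uniformly close to that of
\<open>f0\<close>, by definition of the topology, and the derivative of \<open>f0\<close> is continuous.\<close>

lemma evaluation_continuous_fixed_dirs:
  assumes U: "(U, \<phi>) \<in> man_atlas P" and v: "v \<in> {..<k} \<rightarrow> topspace E"
  shows "continuous_map (prod_topology (subtopology E (\<phi> ` U)) C) euclidean
    (\<lambda>(x, f). iter_deriv euclidean (f \<circ> inv_into U \<phi>) k v x)"
  unfolding continuous_map_eq_topcontinuous_at
proof
  let ?D = "\<lambda>(x, f). iter_deriv euclidean (f \<circ> inv_into U \<phi>) k v x"
  let ?X = "prod_topology (subtopology E (\<phi> ` U)) C"
  have UE: "\<phi> ` U \<subseteq> topspace E" using chartP_open[OF U] openin_subset by blast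
  fix z assume "z \<in> topspace ?X"
  then obtain x0 f0 where z: "z = (x0, f0)" "x0 \<in> \<phi> ` U" "f0 \<in> smooth_functions P" by auto
  show "topcontinuous_at ?X euclidean ?D z"
    unfolding topcontinuous_at_def
  proof (intro conjI allI impI)
    fix B assume "openin euclidean B \<and> ?D z \<in> B"
    then obtain e where e: "e > 0" "ball (?D z) e \<subseteq> B" by (metis open_contains_ball open_openin)
    obtain r where r: "r > 0" "\<And>y. y \<in> topspace E \<Longrightarrow> sqdist n x0 y \<le> r \<Longrightarrow> y \<in> \<phi> ` U"
      using sqdist_ball_subset[OF _ chartP_open[OF U] z(2)] UE z(2) by blast
    define K where "K = {y \<in> topspace E. sqdist n x0 y \<le> r}"
    have K: "compactin E K" unfolding K_def using sqdist_ball_compact UE z(2) r by auto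
    have KU: "K \<subseteq> \<phi> ` U" using r by (auto simp: K_def)
    define S where "S = {g \<in> smooth_functions P. \<forall>x\<in>K. cmod (iter_deriv euclidean (g \<circ> inv_into U \<phi>) k (restrict v {..<k}) x
            - iter_deriv euclidean (f0 \<circ> inv_into U \<phi>) k (restrict v {..<k}) x) < e / 2}"
    have rv: "restrict v {..<k} \<in> {..<k} \<rightarrow>\<^sub>E topspace (man_model P)" using v by auto
    have "openin C S"
      unfolding smooth_compact_open_def S_def
      by (rule topology_generated_by_Basis, rule insertI2, rule CollectI, intro exI conjI, rule refl)
        (use z(3) U K KU rv e(1) in simp_all)
    have iv: "iter_deriv euclidean (g \<circ> inv_into U \<phi>) k (restrict v {..<k}) = iter_deriv euclidean (g \<circ> inv_into U \<phi>) k v" for g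
      by (rule iter_deriv_dirs_cong) auto
    let ?d = "iter_deriv euclidean (f0 \<circ> inv_into U \<phi>) k v"
    have d: "continuous_map (subtopology E (\<phi> ` U)) euclidean ?d"
      by (rule smooth_on_continuous_fixed[OF smooth_functions_smooth_on[OF z(3) U] v])
    define A where "A = {y \<in> topspace (subtopology E (\<phi> ` U)). ?d y \<in> ball (?d x0) (e / 2)}"
    have A: "openin (subtopology E (\<phi> ` U)) A" unfolding A_def by (rule openin_continuous_map_preimage[OF d]) simp
    define R where "R = {y \<in> topspace (subtopology E (\<phi> ` U)). sqdist n x0 y \<in> {..<r}}"
    have R: "openin (subtopology E (\<phi> ` U)) R" unfolding R_def
      by (rule openin_continuous_map_preimage[OF continuous_map_from_subtopology[OF sqdist_continuous]]) simp
    show "\<exists>W. openin ?X W \<and> z \<in> W \<and> (\<forall>y\<in>W. ?D y \<in> B)"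
    proof (intro exI[of _ "(A \<inter> R) \<times> S"] conjI ballI)
      show "openin ?X ((A \<inter> R) \<times> S)" using A R \<open>openin C S\<close> by (simp add: openin_prod_Times_iff openin_Int)
      show "z \<in> (A \<inter> R) \<times> S" using z UE e(1) r(1) by (auto simp: A_def R_def S_def sqdist_def)
      fix y assume "y \<in> (A \<inter> R) \<times> S"
      then obtain x f where y: "y = (x, f)" "x \<in> A" "x \<in> R" "f \<in> S" by auto
      have "x \<in> K" using y(3) by (auto simp: K_def R_def)
      then have "cmod (iter_deriv euclidean (f \<circ> inv_into U \<phi>) k v x - ?d x) < e / 2"
        using y(4) unfolding S_def iv by blast
      moreover have "cmod (?d x - ?d x0) < e / 2" using y(2) by (simp add: A_def dist_norm norm_minus_commute)
      ultimately have "cmod (iter_deriv euclidean (f \<circ> inv_into U \<phi>) k v x - ?d x0) < e"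
        using norm_triangle_lt[of "iter_deriv euclidean (f \<circ> inv_into U \<phi>) k v x - ?d x" "?d x - ?d x0" e] by simp
      then have "?D y \<in> ball (?D z) e" by (simp add: y z dist_norm norm_minus_commute)
      then show "?D y \<in> B" using e by blast
    qed
  qed (use z UE in auto)
qed

text \<open>The topology controls derivatives only for fixed directions. The directions are therefore
released one at a time, starting from the last: the expansion of a free slot in the basis reduces it to
fixed directions with coefficients that depend continuously on the free one.\<close>

lemma evaluation_continuous:
  assumes U: "(U, \<phi>) \<in> man_atlas P"
  shows "continuous_map (prod_topology (prod_topology (subtopology E (\<phi> ` U)) (product_topology (\<lambda>_. E) {..<m})) C) euclidean
    (\<lambda>((x, v), f). iter_deriv euclidean (f \<circ> inv_into U \<phi>) m v x)"
proof -
  let ?X = "prod_topology (prod_topology (subtopology E (\<phi> ` U)) (product_topology (\<lambda>_. E) {..<m})) C"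
  \<comment> \<open>The first \<open>m - q\<close> directions are fixed to \<open>w\<close>, the remaining \<open>q\<close> are free.\<close>
  have "q \<le> m \<Longrightarrow> w \<in> {..<m - q} \<rightarrow> topspace E \<Longrightarrow> continuous_map ?X euclidean
    (\<lambda>((x, v), f). iter_deriv euclidean (f \<circ> inv_into U \<phi>) m (\<lambda>i. if i < m - q then w i else v i) x)" for q w
  proof (induction q arbitrary: w)
    case 0
    have "continuous_map ?X (prod_topology (subtopology E (\<phi> ` U)) C) (\<lambda>z. (fst (fst z), snd z))"
      by (intro continuous_map_pairedI continuous_map_snd continuous_map_compose[OF continuous_map_fst continuous_map_fst, unfolded o_def])
    from continuous_map_compose[OF this evaluation_continuous_fixed_dirs[OF U]] 0
    have "continuous_map ?X euclidean (\<lambda>z. iter_deriv euclidean (snd z \<circ> inv_into U \<phi>) m w (fst (fst z)))"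
      by (simp add: o_def)
    moreover have "iter_deriv euclidean f m (\<lambda>i. if i < m - 0 then w i else v i) = iter_deriv euclidean f m w" for f :: "(nat \<Rightarrow> real) \<Rightarrow> complex" and v
      by (rule iter_deriv_dirs_cong) auto
    ultimately show ?case by (simp only: case_prod_unfold)
  next
    case (Suc q)
    define p where "p = m - Suc q"
    have p: "p < m" "m - q = Suc p" using Suc.prems by (auto simp: p_def)
    have wj: "w(p := basis_vec j) \<in> {..<m - q} \<rightarrow> topspace E" if "j < n" for j
      using Suc.prems(2) basis_vec_in[OF that] unfolding p(2) p_def by (auto simp: Pi_iff less_Suc_eq)
    let ?v = "\<lambda>v i. if i < p then w i else v i"
    have "continuous_map ?X euclidean (\<lambda>z. \<Sum>j<n. snd (fst z) p j *\<^sub>R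
      (\<lambda>((x, v), f). iter_deriv euclidean (f \<circ> inv_into U \<phi>) m (\<lambda>i. if i < m - q then (w(p := basis_vec j)) i else v i) x) z)"
    proof (intro continuous_map_sum continuous_map_scaleR)
      fix j assume j: "j \<in> {..<n}"
      show "continuous_map ?X euclidean (\<lambda>((x, v), f). iter_deriv euclidean (f \<circ> inv_into U \<phi>) m (\<lambda>i. if i < m - q then (w(p := basis_vec j)) i else v i) x)"
        by (rule Suc.IH[OF _ wj]) (use Suc.prems(1) j in simp_all)
      have "continuous_map ?X euclideanreal ((\<lambda>x. x j) \<circ> ((\<lambda>v. v p) \<circ> (snd \<circ> fst)))"
        using p by (intro continuous_map_compose[OF _ continuous_map_Euclidean_component[of n]]
          continuous_map_compose[OF _ continuous_map_product_projection[where X = "\<lambda>_. E" and I = "{..<m}"]]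
          continuous_map_compose[OF continuous_map_fst continuous_map_snd]) auto
      then show "continuous_map ?X euclideanreal (\<lambda>z. snd (fst z) p j)" by (simp add: o_def)
    qed simp
    then show ?case
    proof (rule continuous_map_eq)
      fix z assume "z \<in> topspace ?X"
      then obtain x v f where z: "z = ((x, v), f)" "x \<in> \<phi> ` U" "v \<in> {..<m} \<rightarrow> topspace E" "f \<in> smooth_functions P"
        by (auto simp: PiE_iff)
      have vv: "?v v \<in> {..<m} \<rightarrow> topspace E" using z(3) Suc.prems(2) by (auto simp: Pi_iff p_def)
      have eq: "(?v v)(p := basis_vec j) = (\<lambda>i. if i < m - q then (w(p := basis_vec j)) i else v i)" for j
        by (rule ext) (auto simp: p(2) less_Suc_eq)
      have "iter_deriv euclidean (f \<circ> inv_into U \<phi>) m (?v v) x =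
        (\<Sum>j<n. ?v v p j *\<^sub>R iter_deriv euclidean (f \<circ> inv_into U \<phi>) m ((?v v)(p := basis_vec j)) x)"
        by (rule smooth_on_slot_expansion[OF lcs_E chartP_open[OF U] smooth_functions_smooth_on[OF z(4) U] p(1) vv z(2)])
      then show "(\<Sum>j<n. snd (fst z) p j *\<^sub>R
        (\<lambda>((x, v), f). iter_deriv euclidean (f \<circ> inv_into U \<phi>) m (\<lambda>i. if i < m - q then (w(p := basis_vec j)) i else v i) x) z) =
        (\<lambda>((x, v), f). iter_deriv euclidean (f \<circ> inv_into U \<phi>) m (\<lambda>i. if i < m - Suc q then w i else v i) x) z"
        unfolding eq by (simp add: z(1) p_def)
    qed
  qed
  from this[of m "\<lambda>_. undefined"] show ?thesis by simp
qed

lemma continuous_map_reindex: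
  fixes p :: "'z \<Rightarrow> 'w"
  assumes "set as \<subseteq> {..<k}" "continuous_map Z T p"
  shows "continuous_map (prod_topology X (product_topology (\<lambda>_. Z) {..<k})) (product_topology (\<lambda>_. T) {..<length as})
    (\<lambda>w. \<lambda>i\<in>{..<length as}. p (snd w (as ! i)))"
  unfolding continuous_map_componentwise
proof (intro conjI ballI)
  fix i assume "i \<in> {..<length as}"
  then have "as ! i \<in> {..<k}" using assms(1) nth_mem by blast
  then have "continuous_map (prod_topology X (product_topology (\<lambda>_. Z) {..<k})) T (p \<circ> ((\<lambda>v. v (as ! i)) \<circ> snd))"
    by (intro continuous_map_compose[OF _ assms(2)] continuous_map_compose[OF continuous_map_snd]
      continuous_map_product_projection[where X = "\<lambda>_. Z"])
  then show "continuous_map (prod_topology X (product_topology (\<lambda>_. Z) {..<k})) T (\<lambda>w. (\<lambda>i\<in>{..<length as}. p (snd w (as ! i))) i)"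
    using \<open>i \<in> _\<close> by (simp add: o_def)
qed auto

text \<open>The directions \<open>u i\<close> live in the product; those with index in \<open>bs\<close> differentiate \<open>F\<close> through their
second components, those with index in \<open>as\<close> differentiate the resulting function on \<open>P\<close> through their
first components.\<close>

definition evaluation_term ::
  "('e::real_vector \<Rightarrow> 'p \<Rightarrow> complex) \<Rightarrow> 'p set \<Rightarrow> ('p \<Rightarrow> nat \<Rightarrow> real) \<Rightarrow> nat list \<Rightarrow> nat list \<Rightarrow>
    (nat \<Rightarrow> (nat \<Rightarrow> real) \<times> 'e) \<Rightarrow> (nat \<Rightarrow> real) \<times> 'e \<Rightarrow> complex"
  where "evaluation_term F U \<phi> as bs u z =
    iter_deriv euclidean (iter_deriv C F (length bs) (\<lambda>i. snd (u (bs ! i))) (snd z) \<circ> inv_into U \<phi>)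
      (length as) (\<lambda>i. fst (u (as ! i))) (fst z)"

inductive evaluation_jet ::
  "('e::real_vector \<Rightarrow> 'p \<Rightarrow> complex) \<Rightarrow> 'p set \<Rightarrow> ('p \<Rightarrow> nat \<Rightarrow> real) \<Rightarrow> nat \<Rightarrow>
    ((nat \<Rightarrow> (nat \<Rightarrow> real) \<times> 'e) \<Rightarrow> (nat \<Rightarrow> real) \<times> 'e \<Rightarrow> complex) \<Rightarrow> bool"
  for F U \<phi> k where
  "term": "set as \<subseteq> {..<k} \<Longrightarrow> set bs \<subseteq> {..<k} \<Longrightarrow> evaluation_jet F U \<phi> k (evaluation_term F U \<phi> as bs)"
| add: "evaluation_jet F U \<phi> k h \<Longrightarrow> evaluation_jet F U \<phi> k h' \<Longrightarrow> evaluation_jet F U \<phi> k (\<lambda>u z. h u z + h' u z)"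

lemma evaluation_term_continuous:
  fixes F :: "'e::real_vector \<Rightarrow> 'p \<Rightarrow> complex"
  assumes U: "(U, \<phi>) \<in> man_atlas P" and F: "smooth_on T C \<Omega> F"
    and as: "set as \<subseteq> {..<k}" "set bs \<subseteq> {..<k}"
  shows "continuous_map (prod_topology (subtopology (prod_topology E T) (\<phi> ` U \<times> \<Omega>)) (product_topology (\<lambda>_. prod_topology E T) {..<k}))
    euclidean (\<lambda>(z, u). evaluation_term F U \<phi> as bs u z)"
proof -
  let ?Y = "prod_topology (subtopology E (\<phi> ` U)) (subtopology T \<Omega>)"
  let ?X = "prod_topology ?Y (product_topology (\<lambda>_. prod_topology E T) {..<k})"
  have X: "prod_topology (subtopology (prod_topology E T) (\<phi> ` U \<times> \<Omega>)) (product_topology (\<lambda>_. prod_topology E T) {..<k}) = ?X"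
    by (simp add: subtopology_Times)
  have x: "continuous_map ?X (subtopology E (\<phi> ` U)) (\<lambda>w. fst (fst w))"
    using continuous_map_compose[OF continuous_map_fst continuous_map_fst] by (simp add: o_def)
  have y: "continuous_map ?X (subtopology T \<Omega>) (\<lambda>w. snd (fst w))"
    using continuous_map_compose[OF continuous_map_fst continuous_map_snd] by (simp add: o_def)
  have a: "continuous_map ?X (product_topology (\<lambda>_. E) {..<length as}) (\<lambda>w. \<lambda>i\<in>{..<length as}. fst (snd w (as ! i)))"
    by (rule continuous_map_reindex[OF as(1) continuous_map_fst])
  have b: "continuous_map ?X (product_topology (\<lambda>_. T) {..<length bs}) (\<lambda>w. \<lambda>i\<in>{..<length bs}. snd (snd w (bs ! i)))"
    by (rule continuous_map_reindex[OF as(2) continuous_map_snd])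
  have f: "continuous_map ?X C (\<lambda>w. iter_deriv C F (length bs) (\<lambda>i\<in>{..<length bs}. snd (snd w (bs ! i))) (snd (fst w)))"
    using continuous_map_compose[OF continuous_map_pairedI[OF y b] smooth_on_continuous[OF F]] by (simp add: o_def)
  have e: "continuous_map ?X euclidean (\<lambda>w. iter_deriv euclidean
     (iter_deriv C F (length bs) (\<lambda>i\<in>{..<length bs}. snd (snd w (bs ! i))) (snd (fst w)) \<circ> inv_into U \<phi>)
      (length as) (\<lambda>i\<in>{..<length as}. fst (snd w (as ! i))) (fst (fst w)))"
    using continuous_map_compose[OF continuous_map_pairedI[OF continuous_map_pairedI[OF x a] f] evaluation_continuous[OF U]]
    by (simp add: o_def)
  have "iter_deriv C F (length bs) (\<lambda>i\<in>{..<length bs}. snd (u (bs ! i))) = iter_deriv C F (length bs) (\<lambda>i. snd (u (bs ! i)))"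
    for u :: "nat \<Rightarrow> (nat \<Rightarrow> real) \<times> 'e"
    by (rule iter_deriv_dirs_cong) auto
  moreover have "iter_deriv euclidean g (length as) (\<lambda>i\<in>{..<length as}. fst (u (as ! i))) = iter_deriv euclidean g (length as) (\<lambda>i. fst (u (as ! i)))"
    for u :: "nat \<Rightarrow> (nat \<Rightarrow> real) \<times> 'e" and g :: "(nat \<Rightarrow> real) \<Rightarrow> complex"
    by (rule iter_deriv_dirs_cong) auto
  ultimately show ?thesis using e unfolding X evaluation_term_def case_prod_unfold by (simp only:)
qed

text \<open>Product rule for the pairing of a function with a point. Subtracting and adding the value of \<open>F y\<close>
at the moving point splits the difference quotient in two. One part is a difference quotient of
\<open>F\<close> evaluated at a moving point, and it converges by the joint continuity of evaluation; the other
is a difference quotient of a single smooth function on \<open>P\<close>.\<close>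

lemma evaluation_term_deriv:
  fixes F :: "'e::real_vector \<Rightarrow> 'p \<Rightarrow> complex"
  assumes C: "locally_convex_space C" and T: "line_continuous T" "openin T \<Omega>"
    and U: "(U, \<phi>) \<in> man_atlas P" and F: "smooth_on T C \<Omega> F"
    and as: "set as \<subseteq> {..<k}" "set bs \<subseteq> {..<k}"
    and u: "u \<in> {..<Suc k} \<rightarrow> topspace (prod_topology E T)" and z: "z \<in> \<phi> ` U \<times> \<Omega>"
  shows "has_dir_deriv euclidean (evaluation_term F U \<phi> as bs u) z (u k)
    (evaluation_term F U \<phi> as (bs @ [k]) u z + evaluation_term F U \<phi> (as @ [k]) bs u z)"
proof -
  obtain x y where xy: "z = (x, y)" "x \<in> \<phi> ` U" "y \<in> \<Omega>" using z by auto
  obtain a b where ab: "u k = (a, b)" by (cases "u k")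
  have "u i \<in> topspace E \<times> topspace T" if "i < Suc k" for i using u that by (auto simp: Pi_iff)
  then have uE: "fst (u i) \<in> topspace E" and uT: "snd (u i) \<in> topspace T" if "i < Suc k" for i
    using that by (auto simp: mem_Times_iff)
  \<comment> \<open>Both lists are prolonged by \<open>k\<close> so that the last direction is that of the new derivative.\<close>
  define \<alpha> where "\<alpha> i = fst (u ((as @ [k]) ! i))" for i
  define \<beta> where "\<beta> i = snd (u ((bs @ [k]) ! i))" for i
  have nth: "(as @ [k]) ! i < Suc k" if "i < Suc (length as)" for i
    using as(1) nth_mem[of i "as @ [k]"] that by auto
  have nth': "(bs @ [k]) ! i < Suc k" if "i < Suc (length bs)" for i
    using as(2) nth_mem[of i "bs @ [k]"] that by auto
  have \<alpha>: "\<alpha> \<in> {..<Suc (length as)} \<rightarrow> topspace E" "\<alpha> (length as) = a"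
    using uE nth ab by (auto simp: \<alpha>_def)
  have \<beta>: "\<beta> \<in> {..<Suc (length bs)} \<rightarrow> topspace T" "\<beta> (length bs) = b"
    using uT nth' ab by (auto simp: \<beta>_def)
  have \<alpha>': "\<alpha> \<in> {..<length as} \<rightarrow> topspace E" and a: "a \<in> topspace E" using \<alpha> by (auto simp: Pi_iff)
  have \<beta>': "\<beta> \<in> {..<length bs} \<rightarrow> topspace T" and b: "b \<in> topspace T" using \<beta> by (auto simp: Pi_iff)
  define G where "G y = iter_deriv C F (length bs) \<beta> y" for y
  define G' where "G' = iter_deriv C F (Suc (length bs)) \<beta> y"
  define D where "D f x = iter_deriv euclidean (f \<circ> inv_into U \<phi>) (length as) \<alpha> x" for f :: "'p \<Rightarrow> complex" and x
  have a_cong: "iter_deriv euclidean f (length as) (\<lambda>i. fst (u (as ! i))) = iter_deriv euclidean f (length as) \<alpha>" for f :: "(nat \<Rightarrow> real) \<Rightarrow> complex"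
    by (rule iter_deriv_dirs_cong) (simp add: \<alpha>_def nth_append)
  have b_cong: "iter_deriv C F (length bs) (\<lambda>i. snd (u (bs ! i))) = iter_deriv C F (length bs) \<beta>"
    by (rule iter_deriv_dirs_cong) (simp add: \<beta>_def nth_append)
  have t0: "evaluation_term F U \<phi> as bs u w = D (G (snd w)) (fst w)" for w
    unfolding evaluation_term_def a_cong b_cong D_def G_def ..
  have t1: "evaluation_term F U \<phi> as (bs @ [k]) u z = D G' x"
    unfolding evaluation_term_def a_cong D_def G'_def xy(1) by (simp add: \<beta>_def[abs_def])
  have t2: "evaluation_term F U \<phi> (as @ [k]) bs u z = iter_deriv euclidean (G y \<circ> inv_into U \<phi>) (Suc (length as)) \<alpha> x"
    unfolding evaluation_term_def b_cong G_def xy(1) by (simp add: \<alpha>_def[abs_def])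
  have HC: "Hausdorff_space C" using C by (simp add: locally_convex_space_def)
  have dG: "has_dir_deriv C G y b G'"
    using smooth_on_has_dir_deriv[OF F \<beta>(1) xy(3) HC] unfolding G_def[abs_def] G'_def \<beta>(2) .
  have G: "G w \<in> smooth_functions P" if "w \<in> \<Omega>" for w
  proof -
    have "continuous_map (subtopology T \<Omega>) C G"
      unfolding G_def[abs_def] by (rule smooth_on_continuous_fixed[OF F \<beta>'])
    then show ?thesis using that T(2) openin_subset by (fastforce simp: continuous_map_def)
  qed
  have sm: "smooth_on E euclidean (\<phi> ` U) (f \<circ> inv_into U \<phi>)" if "f \<in> smooth_functions P" for f
    by (rule smooth_functions_smooth_on[OF that U])
  have evx: "\<forall>\<^sub>F t in at 0. x + t *\<^sub>R a \<in> \<phi> ` U"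
    by (rule line_continuous_eventually[OF lines_E chartP_open[OF U] xy(2) a])
  have evy: "\<forall>\<^sub>F t in at 0. y + t *\<^sub>R b \<in> \<Omega>"
    by (rule line_continuous_eventually[OF T xy(3) b])
  define q where "q t = inverse t *\<^sub>R (G (y + t *\<^sub>R b) - G y)" for t
  have qlim: "limitin C q G' (at 0)" using dG unfolding has_dir_deriv_def q_def[abs_def] .
  have xlim: "limitin (subtopology E (\<phi> ` U)) (\<lambda>t. x + t *\<^sub>R a) x (at 0)"
    unfolding limitin_subtopology
  proof (intro conjI xy(2) evx)
    show "limitin E (\<lambda>t. x + t *\<^sub>R a) x (at 0)"
      unfolding limitin_def
    proof (intro conjI allI impI)
      show "x \<in> topspace E" using xy(2) chartP_open[OF U] openin_subset by blast
      fix V assume "openin E V \<and> x \<in> V"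
      then show "\<forall>\<^sub>F t in at 0. x + t *\<^sub>R a \<in> V" using line_continuous_eventually[OF lines_E _ _ a] by blast
    qed
  qed
  have "limitin (prod_topology (subtopology E (\<phi> ` U)) C) (\<lambda>t. (x + t *\<^sub>R a, q t)) (x, G') (at 0)"
    unfolding limitin_pairwise using xlim qlim by (simp add: o_def)
  from continuous_map_limit[OF evaluation_continuous_fixed_dirs[OF U \<alpha>'] this]
  have lim1: "((\<lambda>t. D (q t) (x + t *\<^sub>R a)) \<longlongrightarrow> D G' x) (at 0)"
    by (simp add: o_def D_def)
  have "has_dir_deriv euclidean (D (G y)) x a (iter_deriv euclidean (G y \<circ> inv_into U \<phi>) (Suc (length as)) \<alpha> x)"
    using smooth_on_has_dir_deriv[OF sm[OF G[OF xy(3)]] \<alpha>(1) xy(2) Hausdorff_space_euclidean] unfolding D_def[abs_def] \<alpha>(2) .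
  then have lim2: "((\<lambda>t. inverse t *\<^sub>R (D (G y) (x + t *\<^sub>R a) - D (G y) x)) \<longlongrightarrow>
     iter_deriv euclidean (G y \<circ> inv_into U \<phi>) (Suc (length as)) \<alpha> x) (at 0)"
    by (simp add: has_dir_deriv_def)
  have "\<forall>\<^sub>F t in at 0. D (q t) (x + t *\<^sub>R a) + inverse t *\<^sub>R (D (G y) (x + t *\<^sub>R a) - D (G y) x) =
     inverse t *\<^sub>R (evaluation_term F U \<phi> as bs u (z + t *\<^sub>R u k) - evaluation_term F U \<phi> as bs u z)"
    using evx evy
  proof eventually_elim
    case (elim t)
    have "q t \<circ> inv_into U \<phi> = (\<lambda>x. inverse t *\<^sub>R ((G (y + t *\<^sub>R b) \<circ> inv_into U \<phi>) x - (G y \<circ> inv_into U \<phi>) x))"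
      by (simp add: q_def fun_eq_iff)
    then have "D (q t) (x + t *\<^sub>R a) = inverse t *\<^sub>R (D (G (y + t *\<^sub>R b)) (x + t *\<^sub>R a) - D (G y) (x + t *\<^sub>R a))"
      unfolding D_def
      using iter_deriv_scaled_diff[OF lines_E chartP_open[OF U] sm[OF G[OF elim(2)]] sm[OF G[OF xy(3)]] \<alpha>' elim(1)] by simp
    then show ?case
      unfolding t0 xy(1) ab by (simp add: scaleR_add_right[symmetric])
  qed
  from Lim_transform_eventually[OF tendsto_add[OF lim1 lim2] this]
  show ?thesis unfolding t1 t2 has_dir_deriv_def by simp
qed

text \<open>One half of the exponential law for the function space. The family of sums of evaluation terms is closed
under differentiation by the product rule above.\<close>

lemma evaluation_smooth:
  fixes F :: "'e::real_vector \<Rightarrow> 'p \<Rightarrow> complex"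
  assumes C: "locally_convex_space C" and T: "line_continuous T" "openin T \<Omega>"
    and U: "(U, \<phi>) \<in> man_atlas P" and F: "smooth_on T C \<Omega> F"
  shows "smooth_on (prod_topology E T) euclidean (\<phi> ` U \<times> \<Omega>) (\<lambda>(x, y). F y (inv_into U \<phi> x))"
proof (rule smooth_onI[where Q = "evaluation_jet F U \<phi>" and h = "evaluation_term F U \<phi> [] []"])
  show "line_continuous (prod_topology E T)" by (rule line_continuous_prod[OF lines_E T(1)])
  show "openin (prod_topology E T) (\<phi> ` U \<times> \<Omega>)" using T(2) chartP_open[OF U] by (simp add: openin_prod_Times_iff)
  show "evaluation_jet F U \<phi> 0 (evaluation_term F U \<phi> [] [])" by (rule evaluation_jet.term) auto
  show "evaluation_term F U \<phi> [] [] v x = (case x of (x, y) \<Rightarrow> F y (inv_into U \<phi> x))" for v x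
    by (simp add: evaluation_term_def case_prod_unfold)
next
  fix k h assume "evaluation_jet F U \<phi> k h"
  then show "continuous_map (prod_topology (subtopology (prod_topology E T) (\<phi> ` U \<times> \<Omega>)) (product_topology (\<lambda>_. prod_topology E T) {..<k}))
    euclidean (\<lambda>(x, v). h v x)"
  proof induction
    case ("term" as bs)
    then show ?case by (rule evaluation_term_continuous[OF U F])
  next
    case (add h h')
    from continuous_map_add[OF add.IH] show ?case by (simp add: case_prod_unfold)
  qed
next
  fix k h assume "evaluation_jet F U \<phi> k h"
  then show "\<exists>h'. evaluation_jet F U \<phi> (Suc k) h' \<and>
     (\<forall>v\<in>{..<Suc k} \<rightarrow> topspace (prod_topology E T). \<forall>x\<in>\<phi> ` U \<times> \<Omega>. has_dir_deriv euclidean (h v) x (v k) (h' v x))"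
  proof induction
    case ("term" as bs)
    let ?h' = "\<lambda>u z. evaluation_term F U \<phi> as (bs @ [k]) u z + evaluation_term F U \<phi> (as @ [k]) bs u z"
    have "evaluation_jet F U \<phi> (Suc k) ?h'"
      using "term" by (intro evaluation_jet.add evaluation_jet.term) auto
    then show ?case
      using evaluation_term_deriv[OF C T U F "term"] by (intro exI[of _ ?h'] conjI ballI)
  next
    case (add h1 h2)
    then obtain h1' h2' where 1: "evaluation_jet F U \<phi> (Suc k) h1'"
      "\<forall>v\<in>{..<Suc k} \<rightarrow> topspace (prod_topology E T). \<forall>x\<in>\<phi> ` U \<times> \<Omega>. has_dir_deriv euclidean (h1 v) x (v k) (h1' v x)"
      and 2: "evaluation_jet F U \<phi> (Suc k) h2'"
      "\<forall>v\<in>{..<Suc k} \<rightarrow> topspace (prod_topology E T). \<forall>x\<in>\<phi> ` U \<times> \<Omega>. has_dir_deriv euclidean (h2 v) x (v k) (h2' v x)"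
      by blast
    show ?case
    proof (intro exI[of _ "\<lambda>u z. h1' u z + h2' u z"] conjI ballI)
      show "evaluation_jet F U \<phi> (Suc k) (\<lambda>u z. h1' u z + h2' u z)" by (rule evaluation_jet.add[OF 1(1) 2(1)])
      fix v x assume v: "v\<in>{..<Suc k} \<rightarrow> topspace (prod_topology E T)" and x: "x\<in>\<phi> ` U \<times> \<Omega>"
      show "has_dir_deriv euclidean (\<lambda>z. h1 v z + h2 v z) x (v k) (h1' v x + h2' v x)"
        using bspec[OF bspec[OF 1(2) v] x] bspec[OF bspec[OF 2(2) v] x]
        unfolding has_dir_deriv_euclidean_iff by (rule has_vector_derivative_add)
    qed
  qed
qed simp

end

section \<open>The induced action\<close>

locale smooth_action_on_functions = finite_dim_manifold n P
  for n :: nat and P :: "('p, nat \<Rightarrow> real) manifold" +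
  fixes G :: "('g, 'e::real_vector) lie_group"
    and \<alpha> :: "'g \<Rightarrow> ('p \<Rightarrow> complex) \<Rightarrow> ('p \<Rightarrow> complex)"
  assumes lie: "is_lie_group G"
    and dyn: "smooth_dynamical_system (C_infinity P) G \<alpha>"
begin

abbreviation "S \<equiv> smooth_functions P"

abbreviation "LG \<equiv> lie_manifold G"

abbreviation "TG \<equiv> man_model LG"

lemma alg_top_C [simp]: "alg_top (C_infinity P) = C"
  by (simp add: C_infinity_def)

lemma lcs_C: "locally_convex_space C"
  using dyn by (simp add: smooth_dynamical_system_def locally_convex_algebra_def)

lemma Hausdorff_C: "Hausdorff_space C"
  using lcs_C by (simp add: locally_convex_space_def)

lemma smooth_LG: "smooth_manifold LG" and points_LG [simp]: "points LG = carrier G" and group_G: "group G"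
  using lie by (auto simp: is_lie_group_def)

lemma lcs_TG: "locally_convex_space TG"
  using smooth_LG by (simp add: smooth_manifold_def)

lemma action_hom: "\<alpha> \<in> hom G (Alg_Aut (C_infinity P))"
  using dyn by (simp add: smooth_dynamical_system_def)

lemma action_alg_auto: "g \<in> carrier G \<Longrightarrow> \<alpha> g \<in> alg_auto (C_infinity P)"
  using hom_in_carrier[OF action_hom, of g] by (simp add: Alg_Aut_def)

lemma action_Bij: "g \<in> carrier G \<Longrightarrow> \<alpha> g \<in> Bij S"
  using action_alg_auto by (simp add: alg_auto_def)

lemma action_bij: "g \<in> carrier G \<Longrightarrow> bij_betw (\<alpha> g) S S"
  using action_Bij by (simp add: Bij_def)

lemma action_closed: "g \<in> carrier G \<Longrightarrow> f \<in> S \<Longrightarrow> \<alpha> g f \<in> S"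
  using action_bij bij_betwE by blast

lemma action_mult: "g \<in> carrier G \<Longrightarrow> h \<in> carrier G \<Longrightarrow> f \<in> S \<Longrightarrow> \<alpha> (g \<otimes>\<^bsub>G\<^esub> h) f = \<alpha> g (\<alpha> h f)"
  using hom_mult[OF action_hom, of g h] by (simp add: Alg_Aut_def BijGroup_def action_Bij compose_def)

text \<open>Taken from multiplicativity: an injective idempotent map is the identity.\<close>

lemma action_one: "f \<in> S \<Longrightarrow> \<alpha> \<one>\<^bsub>G\<^esub> f = f"
proof -
  assume f: "f \<in> S"
  interpret group G by (rule group_G)
  have "\<alpha> \<one>\<^bsub>G\<^esub> (\<alpha> \<one>\<^bsub>G\<^esub> f) = \<alpha> \<one>\<^bsub>G\<^esub> f"
    using action_mult[of "\<one>\<^bsub>G\<^esub>" "\<one>\<^bsub>G\<^esub>" f] f by simp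
  moreover have "inj_on (\<alpha> \<one>\<^bsub>G\<^esub>) S" using action_bij[of "\<one>\<^bsub>G\<^esub>"] by (simp add: bij_betw_def)
  ultimately show ?thesis using f action_closed[of "\<one>\<^bsub>G\<^esub>" f] by (auto dest: inj_onD)
qed

lemma action_smooth_map:
  "smooth_map (prod_manifold LG (lcs_manifold C)) (lcs_manifold C) (\<lambda>(g, a). \<alpha> g a)"
  using dyn by (simp add: smooth_dynamical_system_def)

lemma action_continuous:
  assumes "g \<in> carrier G"
  shows "continuous_map C C (\<alpha> g)"
proof -
  have "continuous_map (prod_topology (man_top LG) C) C (\<lambda>(g, a). \<alpha> g a)"
    using action_smooth_map by (simp add: smooth_map_def prod_manifold_def lcs_manifold_def)
  moreover have "continuous_map C (prod_topology (man_top LG) C) (\<lambda>a. (g, a))"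
    using assms by (intro continuous_map_pairedI) (auto simp: continuous_map_id[unfolded id_def])
  ultimately have "continuous_map C C ((\<lambda>(g, a). \<alpha> g a) \<circ> (\<lambda>a. (g, a)))" by (rule continuous_map_compose[rotated])
  then show ?thesis by (simp add: o_def)
qed

lemma evaluation_at_point_continuous:
  assumes "p \<in> points P"
  shows "continuous_map C euclidean (\<lambda>f. f p)"
proof -
  obtain U \<phi> where U: "(U, \<phi>) \<in> man_atlas P" "p \<in> U" using coverP assms by blast
  have 1: "continuous_map (prod_topology (subtopology E (\<phi> ` U)) C) euclidean (\<lambda>(x, f). f (inv_into U \<phi> x))"
    using evaluation_continuous_fixed_dirs[OF U(1), of "\<lambda>_. undefined" 0] by simp
  have "\<phi> p \<in> topspace (subtopology E (\<phi> ` U))" using U(2) chartP_open[OF U(1)] openin_subset by fastforce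
  then have 2: "continuous_map C (prod_topology (subtopology E (\<phi> ` U)) C) (\<lambda>f. (\<phi> p, f))"
    by (intro continuous_map_pairedI) (simp_all only: continuous_map_const continuous_map_id[unfolded id_def] simp_thms)
  show ?thesis using continuous_map_compose[OF 2 1] chart_inv[OF chartP[OF U(1)] U(2)] by (simp add: o_def)
qed

lemma act_char_apply: "f \<in> S \<Longrightarrow> g \<in> carrier G \<Longrightarrow> act_char P \<alpha> (delta P p) g f = \<alpha> g f p"
  using action_closed by (simp add: act_char_def compose_def delta_def)

lemma C_infinity_simps [simp]:
  "alg_scale (C_infinity P) c f = (\<lambda>p. c * f p)" "alg_mult (C_infinity P) f h = (\<lambda>p. f p * h p)"
  "alg_one (C_infinity P) = (\<lambda>p. if p \<in> points P then 1 else 0)"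
  by (simp_all add: C_infinity_def)

lemma action_algebra_hom:
  assumes "g \<in> carrier G"
  shows "\<forall>f\<in>S. \<forall>h\<in>S. \<alpha> g (f + h) = \<alpha> g f + \<alpha> g h \<and> \<alpha> g (\<lambda>p. f p * h p) = (\<lambda>p. \<alpha> g f p * \<alpha> g h p)"
    and "\<forall>c. \<forall>f\<in>S. \<alpha> g (\<lambda>p. c * f p) = (\<lambda>p. c * \<alpha> g f p)"
    and "\<alpha> g (\<lambda>p. if p \<in> points P then 1 else 0) = (\<lambda>p. if p \<in> points P then 1 else 0)"
proof -
  note * = action_alg_auto[OF assms, unfolded alg_auto_def mem_Collect_eq carrier_C_infinity C_infinity_simps]
  show "\<forall>f\<in>S. \<forall>h\<in>S. \<alpha> g (f + h) = \<alpha> g f + \<alpha> g h \<and> \<alpha> g (\<lambda>p. f p * h p) = (\<lambda>p. \<alpha> g f p * \<alpha> g h p)"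
    by (rule *[THEN conjunct2, THEN conjunct1])
  show "\<forall>c. \<forall>f\<in>S. \<alpha> g (\<lambda>p. c * f p) = (\<lambda>p. c * \<alpha> g f p)"
    by (rule *[THEN conjunct2, THEN conjunct2, THEN conjunct1])
  show "\<alpha> g (\<lambda>p. if p \<in> points P then 1 else 0) = (\<lambda>p. if p \<in> points P then 1 else 0)"
    by (rule *[THEN conjunct2, THEN conjunct2, THEN conjunct2])
qed

lemma action_add: "g \<in> carrier G \<Longrightarrow> f \<in> S \<Longrightarrow> h \<in> S \<Longrightarrow> \<alpha> g (\<lambda>p. f p + h p) = (\<lambda>p. \<alpha> g f p + \<alpha> g h p)"
  by (rule action_algebra_hom(1)[THEN bspec, THEN bspec, THEN conjunct1, unfolded plus_fun_def])

lemma action_times: "g \<in> carrier G \<Longrightarrow> f \<in> S \<Longrightarrow> h \<in> S \<Longrightarrow> \<alpha> g (\<lambda>p. f p * h p) = (\<lambda>p. \<alpha> g f p * \<alpha> g h p)"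
  by (rule action_algebra_hom(1)[THEN bspec, THEN bspec, THEN conjunct2])

lemma action_scale: "g \<in> carrier G \<Longrightarrow> f \<in> S \<Longrightarrow> \<alpha> g (\<lambda>p. c * f p) = (\<lambda>p. c * \<alpha> g f p)"
  by (rule action_algebra_hom(2)[THEN spec, THEN bspec])

lemmas action_unit = action_algebra_hom(3)

lemma smooth_add_closed: "f \<in> S \<Longrightarrow> h \<in> S \<Longrightarrow> f + h \<in> S"
  using smooth_functions_add by (simp add: plus_fun_def)

lemma act_char_character:
  assumes p: "p \<in> points P" and g: "g \<in> carrier G"
  shows "act_char P \<alpha> (delta P p) g \<in> characters (C_infinity P)"
  unfolding characters_def mem_Collect_eq carrier_C_infinity C_infinity_simps
proof (intro conjI ballI allI)
  show "act_char P \<alpha> (delta P p) g \<in> extensional S" by (simp add: act_char_def compose_def)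
  fix f h assume f: "f \<in> S" and h: "h \<in> S"
  show "act_char P \<alpha> (delta P p) g (f + h) = act_char P \<alpha> (delta P p) g f + act_char P \<alpha> (delta P p) g h"
    using action_add[OF g f h] act_char_apply[OF smooth_add_closed[OF f h] g] act_char_apply[OF f g] act_char_apply[OF h g]
    by (simp add: plus_fun_def)
  show "act_char P \<alpha> (delta P p) g (\<lambda>p. f p * h p) = act_char P \<alpha> (delta P p) g f * act_char P \<alpha> (delta P p) g h"
    using action_times[OF g f h] act_char_apply[OF smooth_functions_mult[OF f h] g] act_char_apply[OF f g] act_char_apply[OF h g]
    by simp
next
  fix c f assume f: "f \<in> S"
  show "act_char P \<alpha> (delta P p) g (\<lambda>p. c * f p) = c * act_char P \<alpha> (delta P p) g f"
    using action_scale[OF g f] act_char_apply[OF smooth_functions_scale[OF f] g] act_char_apply[OF f g] by simp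
next
  show "\<exists>f\<in>S. act_char P \<alpha> (delta P p) g f \<noteq> 0"
    using p action_unit[OF g] act_char_apply[OF smooth_functions_const g]
    by (intro bexI[OF _ smooth_functions_const[of 1]]) simp
qed

text \<open>The characters in question are continuous, because \<open>\<alpha> g\<close> and evaluation at \<open>p\<close> are.\<close>

lemma act_char_is_delta:
  assumes p: "p \<in> points P" and g: "g \<in> carrier G"
  shows "\<exists>q\<in>points P. delta P q = act_char P \<alpha> (delta P p) g"
proof -
  have "\<exists>q\<in>points P. \<forall>f\<in>S. \<alpha> g f p = f q"
  proof (rule continuous_character_is_evaluation)
    show "continuous_map C euclidean (\<lambda>f. \<alpha> g f p)"
      using continuous_map_compose[OF action_continuous[OF g] evaluation_at_point_continuous[OF p]] by (simp add: o_def)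
  qed (simp_all add: action_add[OF g] action_times[OF g] action_scale[OF g] action_unit[OF g] p)
  then obtain q where q: "q \<in> points P" "\<And>f. f \<in> S \<Longrightarrow> \<alpha> g f p = f q" by blast
  have "delta P q = act_char P \<alpha> (delta P p) g"
  proof
    fix f
    show "delta P q f = act_char P \<alpha> (delta P p) g f"
      using act_char_apply[OF _ g, of f p] q(2)[of f]
      by (cases "f \<in> S") (auto simp: delta_def act_char_def compose_def)
  qed
  then show ?thesis using q by blast
qed

abbreviation "\<sigma> \<equiv> induced_action P \<alpha>"

lemma
  assumes p: "p \<in> points P" and g: "g \<in> carrier G"
  shows induced_closed: "\<sigma> p g \<in> points P"
    and delta_induced: "delta P (\<sigma> p g) = act_char P \<alpha> (delta P p) g"
proof -
  obtain q where q: "q \<in> points P" "delta P q = act_char P \<alpha> (delta P p) g"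
    using act_char_is_delta[OF p g] by blast
  have "\<sigma> p g = q"
    unfolding induced_action_def q(2)[symmetric] by (rule the_inv_into_f_f[OF delta_inj q(1)])
  with q show "\<sigma> p g \<in> points P" "delta P (\<sigma> p g) = act_char P \<alpha> (delta P p) g" by simp_all
qed

lemma induced_apply: "p \<in> points P \<Longrightarrow> g \<in> carrier G \<Longrightarrow> f \<in> S \<Longrightarrow> f (\<sigma> p g) = \<alpha> g f p"
  using fun_cong[OF delta_induced, of p g f] act_char_apply[of f g p] by (simp add: delta_def)

lemma points_eqI:
  assumes "p \<in> points P" "q \<in> points P" "\<And>f. f \<in> S \<Longrightarrow> f p = f q"
  shows "p = q"
proof (rule inj_onD[OF delta_inj _ assms(1,2)])
  show "delta P p = delta P q"
    unfolding delta_def by (rule restrict_ext) (simp add: assms(3))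
qed

lemma induced_one:
  assumes p: "p \<in> points P"
  shows "\<sigma> p \<one>\<^bsub>G\<^esub> = p"
proof (rule points_eqI[OF _ p])
  have one: "\<one>\<^bsub>G\<^esub> \<in> carrier G" by (rule monoid.one_closed[OF group.is_monoid[OF group_G]])
  show "\<sigma> p \<one>\<^bsub>G\<^esub> \<in> points P" by (rule induced_closed[OF p one])
  show "f (\<sigma> p \<one>\<^bsub>G\<^esub>) = f p" if "f \<in> S" for f
    using induced_apply[OF p one that] action_one[OF that] by simp
qed

lemma induced_mult:
  assumes p: "p \<in> points P" and g: "g \<in> carrier G" and h: "h \<in> carrier G"
  shows "\<sigma> (\<sigma> p g) h = \<sigma> p (g \<otimes>\<^bsub>G\<^esub> h)"
proof (rule points_eqI)
  have gh: "g \<otimes>\<^bsub>G\<^esub> h \<in> carrier G" by (rule monoid.m_closed[OF group.is_monoid[OF group_G] g h])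
  show "\<sigma> (\<sigma> p g) h \<in> points P" "\<sigma> p (g \<otimes>\<^bsub>G\<^esub> h) \<in> points P"
    by (intro induced_closed p g h gh)+
  fix f assume f: "f \<in> S"
  have "f (\<sigma> (\<sigma> p g) h) = \<alpha> h f (\<sigma> p g)" by (rule induced_apply[OF induced_closed[OF p g] h f])
  also have "\<dots> = \<alpha> g (\<alpha> h f) p" by (rule induced_apply[OF p g action_closed[OF h f]])
  also have "\<dots> = f (\<sigma> p (g \<otimes>\<^bsub>G\<^esub> h))" using induced_apply[OF p gh f] action_mult[OF g h f] by simp
  finally show "f (\<sigma> (\<sigma> p g) h) = f (\<sigma> p (g \<otimes>\<^bsub>G\<^esub> h))" .
qed

lemma orbit_map_smooth_on:
  assumes V: "(V, \<psi>) \<in> man_atlas LG" and f: "f \<in> S"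
  shows "smooth_on TG C (\<psi> ` V) (\<lambda>y. \<alpha> (inv_into V \<psi> y) f)"
proof -
  have ch: "chart LG V \<psi>" by (rule smooth_manifold_chart[OF smooth_LG V])
  let ?A = "prod_manifold LG (lcs_manifold C)"
  have "(V \<times> topspace C, map_prod \<psi> id) \<in> man_atlas ?A"
    using V by (auto simp: prod_manifold_def lcs_manifold_def)
  moreover have "map_prod \<psi> id ` (V \<times> S) = \<psi> ` V \<times> S" by (rule map_prod_surj_on) auto
  ultimately
  have "smooth_on (prod_topology TG C) C (\<psi> ` V \<times> S) ((\<lambda>(g, a). \<alpha> g a) \<circ> inv_into (V \<times> S) (map_prod \<psi> id))"
    using smooth_map_lcsD[OF action_smooth_map, of "V \<times> S" "map_prod \<psi> id"] Sigma_mono[OF chart_subset[OF ch] subset_refl[of S]]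
    by (simp add: prod_manifold_def lcs_manifold_def)
  note joint = this
  have "smooth_on TG C (\<psi> ` V) (\<lambda>y. ((\<lambda>(g, a). \<alpha> g a) \<circ> inv_into (V \<times> S) (map_prod \<psi> id)) (y, f))"
  proof (rule smooth_on_slice[OF line_continuous_lcs[OF lcs_TG] _ Hausdorff_C f _ _ joint])
    show "openin TG (\<psi> ` V)" using ch by (simp add: chart_def)
    show "S \<subseteq> topspace C" by simp
    show "0 \<in> topspace C" by (rule subspace_0[OF lcs_subspace[OF lcs_C]])
  qed
  then show ?thesis
  proof (rule smooth_on_cong[OF line_continuous_lcs[OF lcs_TG], rotated 2])
    show "openin TG (\<psi> ` V)" using ch by (simp add: chart_def)
    fix y assume "y \<in> \<psi> ` V"
    then show "((\<lambda>(g, a). \<alpha> g a) \<circ> inv_into (V \<times> S) (map_prod \<psi> id)) (y, f) = \<alpha> (inv_into V \<psi> y) f"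
      using inv_into_map_prod[of \<psi> V id S y f] chart_inj[OF ch] f by simp
  qed
qed

lemma atlas_product:
  assumes "(X, \<xi>) \<in> man_atlas (prod_manifold P LG)"
  obtains U \<phi> V \<psi> where "X = U \<times> V" "\<xi> = map_prod \<phi> \<psi>" "(U, \<phi>) \<in> man_atlas P" "(V, \<psi>) \<in> man_atlas LG"
    "chart (prod_manifold P LG) X \<xi>"
proof -
  obtain U \<phi> V \<psi> where *: "X = U \<times> V" "\<xi> = map_prod \<phi> \<psi>" "(U, \<phi>) \<in> man_atlas P" "(V, \<psi>) \<in> man_atlas LG"
    using assms by (auto simp: prod_manifold_def)
  have "chart (prod_manifold P LG) X \<xi>"
    unfolding *(1,2) by (rule chart_prod[OF chartP[OF *(3)] smooth_manifold_chart[OF smooth_LG *(4)]])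
  with * show ?thesis by (rule that)
qed

text \<open>In charts this pairs the smooth map \<open>g \<mapsto> \<alpha> g f\<close> into the function space with a point of \<open>P\<close>.\<close>

lemma matrix_coefficient_smooth:
  assumes f: "f \<in> S"
  shows "smooth_map (prod_manifold P LG) (lcs_manifold euclidean) (\<lambda>(p, g). \<alpha> g f p)"
proof (rule smooth_map_lcsI)
  fix X \<xi> assume X: "(X, \<xi>) \<in> man_atlas (prod_manifold P LG)"
  then obtain U \<phi> V \<psi> where UV: "X = U \<times> V" "\<xi> = map_prod \<phi> \<psi>" "(U, \<phi>) \<in> man_atlas P" "(V, \<psi>) \<in> man_atlas LG"
    and ch: "chart (prod_manifold P LG) X \<xi>" by (rule atlas_product)
  show "chart (prod_manifold P LG) X \<xi>" by fact
  have chV: "chart LG V \<psi>" by (rule smooth_manifold_chart[OF smooth_LG UV(4)])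
  have im: "\<xi> ` X = \<phi> ` U \<times> \<psi> ` V" using UV by auto
  have oV: "openin TG (\<psi> ` V)" using chV by (simp add: chart_def)
  have "smooth_on (prod_topology E TG) euclidean (\<phi> ` U \<times> \<psi> ` V) (\<lambda>(x, y). \<alpha> (inv_into V \<psi> y) f (inv_into U \<phi> x))"
    by (rule evaluation_smooth[OF lcs_C line_continuous_lcs[OF lcs_TG] oV UV(3) orbit_map_smooth_on[OF UV(4) f]])
  then have "smooth_on (prod_topology E TG) euclidean (\<phi> ` U \<times> \<psi> ` V) ((\<lambda>(p, g). \<alpha> g f p) \<circ> inv_into X \<xi>)"
  proof (rule smooth_on_cong[OF line_continuous_prod[OF lines_E line_continuous_lcs[OF lcs_TG]], rotated 2])
    show "openin (prod_topology E TG) (\<phi> ` U \<times> \<psi> ` V)" using oV chartP_open[OF UV(3)] by (simp add: openin_prod_Times_iff)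
    fix z assume "z \<in> \<phi> ` U \<times> \<psi> ` V"
    then show "(case z of (x, y) \<Rightarrow> \<alpha> (inv_into V \<psi> y) f (inv_into U \<phi> x)) = ((\<lambda>(p, g). \<alpha> g f p) \<circ> inv_into X \<xi>) z"
      using inv_into_map_prod[OF chart_inj[OF chartP[OF UV(3)]] chart_inj[OF chV]] by (auto simp: UV)
  qed
  then show "smooth_on (man_model (prod_manifold P LG)) euclidean (\<xi> ` X) ((\<lambda>(p, g). \<alpha> g f p) \<circ> inv_into X \<xi>)"
    unfolding im by (simp add: prod_manifold_def)
next
  show "points (prod_manifold P LG) \<subseteq> (\<Union>(U, \<phi>)\<in>man_atlas (prod_manifold P LG). U)"
  proof
    fix z assume "z \<in> points (prod_manifold P LG)"
    then obtain p g where z: "z = (p, g)" "p \<in> points P" "g \<in> points LG" by (auto simp: prod_manifold_def)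
    then obtain U \<phi> V \<psi> where "(U, \<phi>) \<in> man_atlas P" "p \<in> U" "(V, \<psi>) \<in> man_atlas LG" "g \<in> V"
      using coverP smooth_LG unfolding smooth_manifold_def by blast
    then have "(U \<times> V, map_prod \<phi> \<psi>) \<in> man_atlas (prod_manifold P LG)" "z \<in> U \<times> V"
      by (auto simp: prod_manifold_def z)
    then show "z \<in> (\<Union>(U, \<phi>)\<in>man_atlas (prod_manifold P LG). U)" by blast
  qed
qed

text \<open>The topology of \<open>P\<close> is generated by the sets where a smooth function does not vanish, and
composing such a function with \<open>\<sigma>\<close> gives a continuous function.\<close>

lemma induced_continuous: "continuous_map (man_top (prod_manifold P LG)) (man_top P) (\<lambda>(p, g). \<sigma> p g)"
  unfolding continuous_map_eq_topcontinuous_at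
proof
  let ?X = "man_top (prod_manifold P LG)"
  have pts: "topspace ?X = points P \<times> carrier G" by (simp add: prod_manifold_def)
  fix z assume z: "z \<in> topspace ?X"
  show "topcontinuous_at ?X (man_top P) (\<lambda>(p, g). \<sigma> p g) z"
    unfolding topcontinuous_at_def
  proof (intro conjI allI impI z)
    show "(\<lambda>(p, g). \<sigma> p g) \<in> topspace ?X \<rightarrow> points P" using induced_closed by (auto simp: pts)
    fix W assume W: "openin (man_top P) W \<and> (\<lambda>(p, g). \<sigma> p g) z \<in> W"
    obtain \<theta> N K where \<theta>: "\<theta> \<in> S" "(\<lambda>(p, g). \<sigma> p g) z \<in> N" "N \<subseteq> K" "K \<subseteq> W"
        "\<forall>p\<in>N. \<theta> p = 1" "\<forall>p. p \<notin> K \<longrightarrow> \<theta> p = 0"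
      using cutoff_exists[OF conjunct1[OF W] conjunct2[OF W]] by blast
    have "continuous_map ?X euclidean (\<lambda>(p, g). \<alpha> g \<theta> p)"
      using matrix_coefficient_smooth[OF \<theta>(1)] by (simp add: smooth_map_def lcs_manifold_def)
    then have "openin ?X {w \<in> topspace ?X. (\<lambda>(p, g). \<alpha> g \<theta> p) w \<in> - {0}}"
      by (rule openin_continuous_map_preimage) auto
    moreover have eq: "(\<lambda>(p, g). \<alpha> g \<theta> p) w = \<theta> ((\<lambda>(p, g). \<sigma> p g) w)" if w: "w \<in> topspace ?X" for w
    proof -
      obtain p g where "w = (p, g)" "p \<in> points P" "g \<in> carrier G" using w by (auto simp: pts)
      then show ?thesis using induced_apply[OF _ _ \<theta>(1), of p g] by simp
    qed
    moreover have "(\<lambda>(p, g). \<sigma> p g) w \<in> W" if "w \<in> topspace ?X" "(\<lambda>(p, g). \<alpha> g \<theta> p) w \<in> - {0}" for w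
      using that(2) \<theta>(4,6) unfolding eq[OF that(1)] by blast
    moreover have "(\<lambda>(p, g). \<alpha> g \<theta> p) z \<in> - {0}"
      unfolding eq[OF z] using \<theta>(2,5) by simp
    ultimately show "\<exists>O'. openin ?X O' \<and> z \<in> O' \<and> (\<forall>w\<in>O'. (\<lambda>(p, g). \<sigma> p g) w \<in> W)"
      using z by blast
  qed
qed

text \<open>Near a given point the coordinates of \<open>\<sigma> p g\<close> are the real parts of \<open>\<alpha> g (f i) p\<close>, where the \<open>f i\<close> are
cut-off coordinates around the image point.\<close>

lemma induced_smooth: "smooth_map (prod_manifold P LG) P (\<lambda>(p, g). \<sigma> p g)"
  unfolding smooth_map_def
proof (intro conjI ballI, rule induced_continuous, clarify)
  let ?s = "\<lambda>(p, g). \<sigma> p g"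
  let ?M = "prod_manifold P LG"
  fix X \<xi> W \<kappa> assume X: "(X, \<xi>) \<in> man_atlas ?M" and W: "(W, \<kappa>) \<in> man_atlas P"
  have ch: "chart ?M X \<xi>" using X by (rule atlas_product)
  have XP: "X \<subseteq> points P \<times> carrier G" using chart_subset[OF ch] by (simp add: prod_manifold_def)
  have lines: "line_continuous (man_model ?M)"
    using line_continuous_prod[OF lines_E line_continuous_lcs[OF lcs_TG]] by (simp add: prod_manifold_def)
  show "smooth_on (man_model ?M) (man_model P) (\<xi> ` (X \<inter> ?s -` W)) (\<kappa> \<circ> ?s \<circ> inv_into X \<xi>)"
  proof (rule smooth_on_local)
    show "\<xi> ` (X \<inter> ?s -` W) \<subseteq> topspace (man_model ?M)"
      using ch openin_subset unfolding chart_def by blast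
    fix z assume "z \<in> \<xi> ` (X \<inter> ?s -` W)"
    then obtain w where w: "w \<in> X" "?s w \<in> W" "z = \<xi> w" by auto
    obtain f N where N: "openin (man_top P) N" "?s w \<in> N" "N \<subseteq> W"
      and f: "\<And>i. f i \<in> S" "\<And>i p. p \<in> N \<Longrightarrow> f i p = complex_of_real (\<kappa> p i)"
      using cutoff_coordinate[OF W w(2)] by blast
    define D where "D = \<xi> ` (X \<inter> {v \<in> topspace (man_top ?M). ?s v \<in> N})"
    have D: "openin (man_model ?M) D" unfolding D_def
      by (rule chart_image_open[OF ch openin_continuous_map_preimage[OF induced_continuous N(1)]])
    have D_pt: "\<exists>p g. y = \<xi> (p, g) \<and> inv_into X \<xi> y = (p, g) \<and> p \<in> points P \<and> g \<in> carrier G \<and> \<sigma> p g \<in> N" if "y \<in> D" for y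
      using that chart_inv[OF ch] XP by (auto simp: D_def)
    have "smooth_on (man_model ?M) E D (\<kappa> \<circ> ?s \<circ> inv_into X \<xi>)"
    proof (rule smooth_on_componentwise[OF lines D])
      fix i
      have "smooth_on (man_model ?M) euclidean (\<xi> ` X) ((\<lambda>(p, g). \<alpha> g (f i) p) \<circ> inv_into X \<xi>)"
        by (rule smooth_map_lcsD[OF matrix_coefficient_smooth[OF f(1)] X chart_subset[OF ch]])
      then have "smooth_on (man_model ?M) euclidean D ((\<lambda>(p, g). \<alpha> g (f i) p) \<circ> inv_into X \<xi>)"
        by (rule smooth_on_subset) (auto simp: D_def)
      then have "smooth_on (man_model ?M) euclideanreal D (\<lambda>y. Re (((\<lambda>(p, g). \<alpha> g (f i) p) \<circ> inv_into X \<xi>) y))"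
        by (intro smooth_on_linear_compose[OF lines D _ _ bounded_linear.linear[OF bounded_linear_Re], where S = euclidean and S' = euclideanreal
              and f = "(\<lambda>(p, g). \<alpha> g (f i) p) \<circ> inv_into X \<xi>"])
           (simp_all only: Hausdorff_space_euclidean continuous_map_iff_continuous2 continuous_on_Re continuous_on_id)
      then show "smooth_on (man_model ?M) euclideanreal D (\<lambda>y. (\<kappa> \<circ> ?s \<circ> inv_into X \<xi>) y i)"
      proof (rule smooth_on_cong[OF lines D, rotated])
        fix y assume "y \<in> D"
        from D_pt[OF this] obtain p g where pg: "inv_into X \<xi> y = (p, g)" "p \<in> points P" "g \<in> carrier G" "\<sigma> p g \<in> N" by blast
        then have "\<alpha> g (f i) p = complex_of_real (\<kappa> (\<sigma> p g) i)"
          using induced_apply[OF pg(2,3) f(1)[of i]] f(2)[OF pg(4), of i] by simp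
        then show "Re (((\<lambda>(p, g). \<alpha> g (f i) p) \<circ> inv_into X \<xi>) y) = (\<kappa> \<circ> ?s \<circ> inv_into X \<xi>) y i"
          using pg by simp
      qed
    next
      fix y i assume y: "y \<in> D" and i: "n \<le> i"
      from D_pt[OF y] obtain p g where pg: "inv_into X \<xi> y = (p, g)" "\<sigma> p g \<in> N" by blast
      then have "\<kappa> (\<sigma> p g) \<in> topspace E" using N(3) chartP_open[OF W] openin_subset by blast
      then show "(\<kappa> \<circ> ?s \<circ> inv_into X \<xi>) y i = 0" using pg i by (simp add: topspace_Euclidean_space)
    qed
    moreover have "z \<in> D" using w N ch chart_subset[OF ch] by (auto simp: D_def)
    moreover have "D \<subseteq> \<xi> ` (X \<inter> ?s -` W)" using N(3) by (auto simp: D_def)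
    ultimately show "\<exists>V. openin (man_model ?M) V \<and> z \<in> V \<and> V \<subseteq> \<xi> ` (X \<inter> ?s -` W) \<and>
        smooth_on (man_model ?M) (man_model P) V (\<kappa> \<circ> ?s \<circ> inv_into X \<xi>)"
      using D by auto
  qed
qed

end

theorem proposition1p4p3:
  fixes P :: "('p, nat \<Rightarrow> real) manifold"
    and n :: nat
    and G :: "('g, 'e::real_vector) lie_group"
    and \<alpha> :: "'g \<Rightarrow> ('p \<Rightarrow> complex) \<Rightarrow> ('p \<Rightarrow> complex)"
  assumes "fin_dim_manifold n P"
    and "is_lie_group G"
    and "smooth_dynamical_system (C_infinity P) G \<alpha>"
  shows "(\<forall>p\<in>points P. \<forall>g\<in>carrier G.
            act_char P \<alpha> (delta P p) g \<in> characters (C_infinity P) \<and>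
            delta P (induced_action P \<alpha> p g) = act_char P \<alpha> (delta P p) g) \<and>
         smooth_right_action P G (induced_action P \<alpha>)"
proof -
  interpret smooth_action_on_functions n P G \<alpha>
    by unfold_locales (fact assms)+
  show ?thesis
    unfolding smooth_right_action_def
    using act_char_character delta_induced induced_closed induced_one induced_mult induced_smooth by simp
qed

end
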